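(* Let $k$ be a perfect field with algebraic closure $\bar{k}$ and let $G_k=\mathrm{Gal}(\bar{k}/k)$. (1) Let $Q\in k[x]$ be a monic squarefree polynomial of degree $5$, with roots $P_1,\dots,P_5\in\bar{k}$, and let $F$ be the Del Pezzo surface of degree $5$ constructed with seed $Q$. Then the homomorphism $f:G_k\to S_5$ (up to $S_5$-conjugacy) corresponding to the $k$-isomorphism class of $F$ is the permutation representation of $G_k$ on $\{P_1,\dots,P_5\}$. (2) Conversely, for any Galois extension $L$ of $k$ such that $\mathrm{Gal}(L/k)$ is isomorphic to a subgroup of $S_5$, and any $S_5$-conjugacy class of injective homomorphisms $f:\mathrm{Gal}(L/k)\hookrightarrow S_5$, $f$ comes from an appropriate monic squarefree quintic polynomial; that is, there is a monic squarefree $Q\in k[x]$ of degree $5$ such that the homomorphism $G_k\to S_5$ corresponding to the surface with seed $Q$ is, up to $S_5$-conjugacy, the composition $G_k\twoheadrightarrow\mathrm{Gal}(L/k)\overset{f}{\hookrightarrow}S_5$.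
   Context: A Del Pezzo surface is a complete nonsingular surface whose anticanonical divisor $-K$ is ample; its degree is $K^2$. Construction from a seed: given a monic squarefree quintic $Q\in k[x]$ (the seed) with roots $P_1,\dots,P_5\in\bar{k}$, put $B=\{(P_i^2:P_i:1)\mid i=1,\dots,5\}\subset\mathbb{P}^2$, a set of five points, no three collinear, defined over $k$. The surface constructed with seed $Q$ is the image $F\subset\mathbb{P}^5$ of $\mathbb{P}^2$ under the rational map, defined over $k$, given by a basis of the space of quintic forms vanishing with order at least $2$ at every point of $B$; it is a Del Pezzo surface of degree $5$ defined over $k$. Its ten lines are the strict transforms of the lines joining two points of $B$. Correspondence: a Del Pezzo surface $F$ of degree $5$ over $k$ has exactly ten exceptional lines (defined over $\bar{k}$). Let $E$ be their incidence graph (one vertex per line, an edge when two lines meet). $E$ is the Petersen graph; the ten lines can be identified with the pairs $\{i,j\}$, $1\le i<j\le 5$, and $\mathrm{Aut}(E)$ with $S_5$, so that the action of $\mathrm{Aut}(E)$ on lines is the natural action of $S_5$ on pairs. The Galois group $G_k$ acts on the lines preserving incidence, giving a homomorphism $G_k\to S_5$, well defined up to $S_5$-conjugacy. Associating this class of homomorphisms to the $k$-isomorphism class of $F$ gives a bijection between $k$-isomorphism classes of Del Pezzo surfaces of degree $5$ over $k$ and $H^1(G_k,S_5)$ (with trivial action), the set of (continuous) homomorphisms $G_k\to S_5$ up to $S_5$-conjugacy. This is "the homomorphism corresponding to the $k$-isomorphism class of $F$".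
   Formalization: Part (2) is stated for k infinite or with at least 5 elements; for every k with fewer than 5 elements it fails as written (L = k, f trivial would need a quintic with five distinct roots in k). *)

theory Defs
  imports
    "HOL-Analysis.Analysis"
    "HOL-Algebra.Algebra"
    "HOL-Algebra.Algebraic_Closure_Type"
    "HOL-Library.Poly_Mapping"
    "HOL-Library.Numeral_Type"
    "HOL-Computational_Algebra.Squarefree"
begin

section \<open>Fields and Galois groups\<close>

definition perfect_field :: "'k::field itself \<Rightarrow> bool" where
  "perfect_field _ \<longleftrightarrow> CHAR('k) = 0 \<or> surj (\<lambda>x :: 'k. x ^ CHAR('k))"

text \<open>
  The ground field \<open>k\<close> is a type \<open>'k\<close>, its algebraic closure is the type
  \<open>'k alg_closure\<close> with the embedding \<open>to_ac\<close>, and algebraic extensions of \<open>k\<close> are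
  subfields of \<open>'k alg_closure\<close>. A field automorphism of \<open>L\<close> is represented by a function
  that is \<open>undefined\<close> outside \<open>L\<close>, as everywhere in the library theory of bijection groups.
\<close>

definition galois_group ::
    "'k::field alg_closure set \<Rightarrow> ('k alg_closure \<Rightarrow> 'k alg_closure) monoid" where
  "galois_group L = BijGroup L \<lparr>carrier :=
     {\<sigma> \<in> Bij L. (\<forall>x\<in>L. \<forall>y\<in>L. \<sigma> (x + y) = \<sigma> x + \<sigma> y \<and> \<sigma> (x * y) = \<sigma> x * \<sigma> y)
        \<and> (\<forall>a. \<sigma> (to_ac a) = to_ac a)}\<rparr>"

definition absolute_galois_group :: "('k::field alg_closure \<Rightarrow> 'k alg_closure) monoid" where
  "absolute_galois_group = galois_group UNIV"

text \<open>Extensions inside the algebraic closure are algebraic, so it suffices to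
  require that the fixed field is \<open>k\<close>.\<close>

definition galois_extension :: "'k::field alg_closure set \<Rightarrow> bool" where
  "galois_extension L \<longleftrightarrow>
     subfield L (ring_of_type_algebra :: 'k alg_closure ring) \<and>
     range to_ac \<subseteq> L \<and>
     {x \<in> L. \<forall>\<sigma> \<in> carrier (galois_group L). \<sigma> x = x} = range to_ac"

text \<open>
  The continuous homomorphisms from the absolute Galois group to \<open>S\<^sub>5\<close>: the stabilisers
  of finite sets form a basis of neighbourhoods of the identity in the Krull topology.
\<close>

definition galois_homs :: "(('k::field alg_closure \<Rightarrow> 'k alg_closure) \<Rightarrow> nat \<Rightarrow> nat) set" where
  "galois_homs =
     {f \<in> hom absolute_galois_group (sym_group 5) \<inter> extensional (carrier absolute_galois_group).
        \<exists>S. finite S \<and>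
          (\<forall>\<sigma> \<in> carrier absolute_galois_group. (\<forall>x\<in>S. \<sigma> x = x) \<longrightarrow> f \<sigma> = id)}"

definition S5_conj_class ::
    "(('k::field alg_closure \<Rightarrow> 'k alg_closure) \<Rightarrow> nat \<Rightarrow> nat)
      \<Rightarrow> (('k alg_closure \<Rightarrow> 'k alg_closure) \<Rightarrow> nat \<Rightarrow> nat) set" where
  "S5_conj_class f =
     {\<lambda>\<sigma> \<in> carrier absolute_galois_group. \<pi> \<circ> f \<sigma> \<circ> inv\<^bsub>sym_group 5\<^esub> \<pi> | \<pi>.
        \<pi> \<in> carrier (sym_group 5)}"

definition roots_in_closure :: "'k::field poly \<Rightarrow> 'k alg_closure set" where
  "roots_in_closure Q = {x. poly (map_poly to_ac Q) x = 0}"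

text \<open>The action on roots \<open>P 1, \<dots>, P 5\<close>, as permutations of the indices:
  \<open>P (root_representation P \<sigma> i) = \<sigma> (P i)\<close>.\<close>

definition root_representation ::
    "(nat \<Rightarrow> 'k::field alg_closure) \<Rightarrow> ('k alg_closure \<Rightarrow> 'k alg_closure) \<Rightarrow> nat \<Rightarrow> nat" where
  "root_representation P =
     (\<lambda>\<sigma> \<in> carrier absolute_galois_group.
        \<lambda>i. if i \<in> {1..5} then inv_into {1..5} P (\<sigma> (P i)) else i)"


section \<open>Polynomials in several variables\<close>

type_synonym ('n, 'a) mpoly = "('n \<Rightarrow>\<^sub>0 nat) \<Rightarrow>\<^sub>0 'a"

definition mpoly_const :: "'a::zero \<Rightarrow> ('n, 'a) mpoly" where
  "mpoly_const c = Poly_Mapping.single 0 c"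

definition mpoly_var :: "'n \<Rightarrow> ('n, 'a::zero_neq_one) mpoly" where
  "mpoly_var i = Poly_Mapping.single (Poly_Mapping.single i 1) 1"

definition monom_degree :: "('n::finite \<Rightarrow>\<^sub>0 nat) \<Rightarrow> nat" where
  "monom_degree e = (\<Sum>i\<in>UNIV. Poly_Mapping.lookup e i)"

definition mpoly_eval ::
    "('a::zero \<Rightarrow> 'b::comm_semiring_1) \<Rightarrow> ('n::finite, 'a) mpoly \<Rightarrow> 'b^'n \<Rightarrow> 'b" where
  "mpoly_eval h p x =
     (\<Sum>e\<in>Poly_Mapping.keys p.
        h (Poly_Mapping.lookup p e) * (\<Prod>i\<in>UNIV. (x $ i) ^ Poly_Mapping.lookup e i))"

definition homogeneous :: "nat \<Rightarrow> ('n::finite, 'a::zero) mpoly \<Rightarrow> bool" where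
  "homogeneous d p \<longleftrightarrow> (\<forall>e \<in> Poly_Mapping.keys p. monom_degree e = d)"

text \<open>
  All terms of \<open>p(v + Y)\<close> have degree at least \<open>m\<close> in \<open>Y\<close>. For a homogeneous \<open>p\<close> and
  \<open>v \<noteq> 0\<close> this is the order of vanishing at the point of projective space given by \<open>v\<close>,
  because the affine cone is locally the product of projective space and a line.
\<close>

definition vanishes_to_order :: "nat \<Rightarrow> ('n::finite, 'a::comm_ring_1) mpoly \<Rightarrow> 'a^'n \<Rightarrow> bool" where
  "vanishes_to_order m p v \<longleftrightarrow>
     (\<forall>e \<in> Poly_Mapping.keys
        (mpoly_eval mpoly_const p (\<chi> i. mpoly_const (v $ i) + mpoly_var i)). m \<le> monom_degree e)"


section \<open>Projective space over a field\<close>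

text \<open>Points of projective space are the one-dimensional subspaces, lines are given by
  the two-dimensional subspaces.\<close>

definition proj_point :: "'a::field^'n \<Rightarrow> ('a^'n) set" where
  "proj_point v = vec.span {v}"

definition zariski_closure :: "('a::field^'n) set set \<Rightarrow> ('a^'n) set set" where
  "zariski_closure S = {proj_point x | x. x \<noteq> 0 \<and>
     (\<forall>d p. homogeneous d p \<and> (\<forall>y. y \<noteq> 0 \<and> proj_point y \<in> S \<longrightarrow> mpoly_eval id p y = 0)
        \<longrightarrow> mpoly_eval id p x = 0)}"

definition rational_map_image :: "('m \<Rightarrow> ('n::finite, 'a::field) mpoly) \<Rightarrow> ('a^'m) set set" where
  "rational_map_image \<phi> =
     zariski_closure {proj_point (\<chi> i. mpoly_eval id (\<phi> i) x) | x.
       (\<chi> i. mpoly_eval id (\<phi> i) x) \<noteq> 0}"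

definition lines_on :: "('a::field^'n) set set \<Rightarrow> ('a^'n) set set" where
  "lines_on F = {W. vec.subspace W \<and> vec.dim W = 2 \<and> (\<forall>v \<in> W - {0}. proj_point v \<in> F)}"

definition lines_meet :: "('a::field^'n) set \<Rightarrow> ('a^'n) set \<Rightarrow> bool" where
  "lines_meet W W' \<longleftrightarrow> W \<inter> W' \<noteq> {0}"


section \<open>The surface constructed from a seed\<close>

definition is_seed :: "'k::field poly \<Rightarrow> bool" where
  "is_seed Q \<longleftrightarrow> Polynomial.degree Q = 5 \<and> Polynomial.lead_coeff Q = 1 \<and> squarefree Q"

definition base_points :: "'k::field poly \<Rightarrow> ('k alg_closure^3) set" where
  "base_points Q = {vector [a\<^sup>2, a, 1] | a. a \<in> roots_in_closure Q}"

definition seed_quintics :: "'k::field poly \<Rightarrow> (3, 'k alg_closure) mpoly set" where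
  "seed_quintics Q = {p. homogeneous 5 p \<and> (\<forall>v \<in> base_points Q. vanishes_to_order 2 p v)}"

definition defined_over_ground_field :: "('n, 'k::field alg_closure) mpoly \<Rightarrow> bool" where
  "defined_over_ground_field p \<longleftrightarrow> (\<forall>e. Poly_Mapping.lookup p e \<in> range to_ac)"

definition is_seed_basis :: "'k::field poly \<Rightarrow> (6 \<Rightarrow> (3, 'k alg_closure) mpoly) \<Rightarrow> bool" where
  "is_seed_basis Q \<phi> \<longleftrightarrow>
     (\<forall>i. \<phi> i \<in> seed_quintics Q \<and> defined_over_ground_field (\<phi> i)) \<and>
     (\<forall>p \<in> seed_quintics Q. \<exists>!c :: 'k alg_closure^6. p = (\<Sum>i\<in>UNIV. mpoly_const (c $ i) * \<phi> i))"

text \<open>A relation, because the surface depends on the choice of the basis (up to a linear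
  change of coordinates over the ground field).\<close>

definition is_seed_surface :: "'k::field poly \<Rightarrow> ('k alg_closure^6) set set \<Rightarrow> bool" where
  "is_seed_surface Q F \<longleftrightarrow> (\<exists>\<phi>. is_seed_basis Q \<phi> \<and> F = rational_map_image \<phi>)"


section \<open>The class of homomorphisms corresponding to a surface\<close>

definition galois_act ::
    "('k::field alg_closure \<Rightarrow> 'k alg_closure) \<Rightarrow> 'k alg_closure^'n \<Rightarrow> 'k alg_closure^'n" where
  "galois_act \<sigma> v = (\<chi> i. \<sigma> (v $ i))"

definition pairs5 :: "nat set set" where
  "pairs5 = {A. A \<subseteq> {1..5} \<and> card A = 2}"

text \<open>
  An identification of the lines on \<open>F\<close> with the pairs. The incidence graph is the Petersen
  graph, whose automorphism group acts on the vertices as \<open>S\<^sub>5\<close> does on pairs exactly when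
  adjacency is disjointness of pairs.
\<close>

definition is_line_marking ::
    "('a::field^'n) set set \<Rightarrow> (nat set \<Rightarrow> ('a^'n) set) \<Rightarrow> bool" where
  "is_line_marking F l \<longleftrightarrow>
     bij_betw l pairs5 (lines_on F) \<and>
     (\<forall>A \<in> pairs5. \<forall>B \<in> pairs5. A \<noteq> B \<longrightarrow> (lines_meet (l A) (l B) \<longleftrightarrow> A \<inter> B = {}))"

text \<open>
  For a Del Pezzo surface of degree 5, anticanonically embedded in projective 5-space, the
  exceptional curves are the lines contained in it. The markings form one \<open>S\<^sub>5\<close>-orbit,
  hence the homomorphisms below form one conjugacy class.
\<close>

definition corresponding_homs ::
    "('k::field alg_closure^6) set set
      \<Rightarrow> (('k alg_closure \<Rightarrow> 'k alg_closure) \<Rightarrow> nat \<Rightarrow> nat) set" where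
  "corresponding_homs F =
     {f \<in> galois_homs. \<exists>l. is_line_marking F l \<and>
        (\<forall>\<sigma> \<in> carrier absolute_galois_group. \<forall>A \<in> pairs5. galois_act \<sigma> ` l A = l (f \<sigma> ` A))}"

end

(*
  The quintics singular at the five points of the conic C = xz - y^2 are spanned by C^2 x, C^2 y, C^2 z,
  C R0, C R1 and one further form q, where R0, R1 and q restrict to Q(t), t Q(t) and Q(t)^2 along
  (t^2 : t : 1): a form that vanishes along the conic is divisible by C. In the corresponding coordinates
  (X, Y, Z, U, V, T) the surface satisfies U C = R0, V C = R1, T C^2 = q (with C, R0, R1, q evaluated at
  X, Y, Z) and two quadratic relations expressing U^2 and V^2. On a line contained in the surface,
  (X : Y : Z) therefore runs through a line of the plane on which C divides R0, and this means that
  the latter is the line through two base points, which in turn determines the line on the surface.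
  Incidence of these ten lines is disjointness of pairs of roots, and the Galois group permutes them as
  it permutes the roots. All other markings arise from this one because the automorphisms of the
  Petersen graph come from the symmetric group.

  For the converse one needs an injective equivariant map from {1..5} to L. It is built orbit by orbit:
  in the fixed field of the stabiliser of a point, fewer than |k| proper affine subspaces have to be
  avoided, and they are proper by the linear independence of automorphisms.
*)

theory Submission
  imports Defs
begin

text \<open>The surface is a Zariski closure, so its lines cannot be read off from the
  parametrisation. They are bounded from two sides: an equation that holds at all image points
  passes to the closure, and five such equations already pin down every line; conversely, a form
  that vanishes at the image points vanishes at all but finitely many points of a candidate line,
  hence on the whole line. Only one basis of quintics has to be treated explicitly. Any other basis
  over k differs from it by a matrix with Galois invariant entries, because coordinates in a basis
  are unique, and such a matrix carries an equivariant marking to an equivariant marking. In the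
  converse, the bound on the size of k reflects the trivial homomorphism: it is realised only by a
  quintic with five distinct roots in k. Five elements also suffice, since no more than four
  subspaces have to be avoided at a time.\<close>

no_notation fps_nth (infixl "$" 75)

abbreviation lookup :: "('b \<Rightarrow>\<^sub>0 'c::zero) \<Rightarrow> 'b \<Rightarrow> 'c" where "lookup \<equiv> Poly_Mapping.lookup"
abbreviation keys :: "('b \<Rightarrow>\<^sub>0 'c::zero) \<Rightarrow> 'b set" where "keys \<equiv> Poly_Mapping.keys"
abbreviation single :: "'b \<Rightarrow> 'c::zero \<Rightarrow> 'b \<Rightarrow>\<^sub>0 'c" where "single \<equiv> Poly_Mapping.single"
abbreviation coeff :: "'a::zero poly \<Rightarrow> nat \<Rightarrow> 'a" where "coeff \<equiv> Polynomial.coeff"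
abbreviation degree :: "'a::zero poly \<Rightarrow> nat" where "degree \<equiv> Polynomial.degree"

abbreviation lin_comb :: "'a::comm_ring_1^'m::finite \<Rightarrow> ('m \<Rightarrow> ('n, 'a) mpoly) \<Rightarrow> ('n, 'a) mpoly" where
  "lin_comb c b \<equiv> \<Sum>i\<in>UNIV. mpoly_const (c $ i) * b i"

section \<open>Polynomials in several variables\<close>

lemma poly_mapping_sum_single:
  "p = (\<Sum>e\<in>keys p. single e (lookup p e))"
  by (rule poly_mapping_eqI)
    (auto simp: lookup_sum lookup_single when_def in_keys_iff sum.delta)

lemma poly_mapping_induct [case_names single add]:
  fixes P :: "('b \<Rightarrow>\<^sub>0 'c::comm_monoid_add) \<Rightarrow> bool"
  assumes "\<And>e c. P (single e c)"
    and "\<And>p q. P p \<Longrightarrow> P q \<Longrightarrow> P (p + q)"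
  shows "P p"
proof -
  have zero: "P 0" using assms(1)[of undefined 0] by simp
  have "P (\<Sum>e\<in>S. single e (lookup p e))" if "finite S" for S
    using that by (induction S) (auto intro: assms zero)
  from this[of "keys p"] show ?thesis
    using poly_mapping_sum_single[of p] by simp
qed

definition eval_monom :: "'a::comm_semiring_1^'n::finite \<Rightarrow> ('n \<Rightarrow>\<^sub>0 nat) \<Rightarrow> 'a" where
  "eval_monom x e = (\<Prod>i\<in>UNIV. (x $ i) ^ lookup e i)"

lemma eval_monom_0 [simp]: "eval_monom x 0 = 1"
  by (simp add: eval_monom_def)

lemma eval_monom_add: "eval_monom x (e + e') = eval_monom x e * eval_monom x e'"
  by (simp add: eval_monom_def lookup_add power_add prod.distrib)

lemma eval_monom_single: "eval_monom x (single i k) = x $ i ^ k"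
proof -
  have "eval_monom x (single i k) = (\<Prod>j\<in>UNIV. if j = i then x $ i ^ k else 1)"
    unfolding eval_monom_def by (rule prod.cong) (auto simp: lookup_single when_def)
  then show ?thesis by simp
qed

lemma monom_degree_0 [simp]: "monom_degree 0 = 0"
  by (simp add: monom_degree_def)

lemma monom_degree_add [simp]: "monom_degree (e + e') = monom_degree e + monom_degree e'"
  by (simp add: monom_degree_def lookup_add sum.distrib)

lemma monom_degree_single [simp]: "monom_degree (single i k) = k"
  by (simp add: monom_degree_def lookup_single when_def)

lemma mpoly_eval_alt:
  "mpoly_eval h p x =
     (\<Sum>e\<in>keys p. h (lookup p e) * eval_monom x e)"
  by (simp add: mpoly_eval_def eval_monom_def)

text \<open>Evaluation is needed along several homomorphisms: \<open>id\<close> gives values,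
  \<open>mpoly_const\<close> gives substitution of polynomials, and \<open>\<lambda>c. [:c:]\<close>
  gives restriction to a parametrised curve. Galois automorphisms are instances as well.\<close>

locale coeff_hom =
  fixes h :: "'a::comm_ring_1 \<Rightarrow> 'b::comm_ring_1"
  assumes hom_add: "h (x + y) = h x + h y"
    and hom_mult: "h (x * y) = h x * h y"
    and hom_one: "h 1 = 1"
begin

lemma hom_zero [simp]: "h 0 = 0"
  using hom_add[of 0 0] by simp

lemma hom_sum: "h (sum f A) = (\<Sum>x\<in>A. h (f x))"
  by (induction A rule: infinite_finite_induct) (auto simp: hom_add)

lemma hom_prod: "h (prod f A) = (\<Prod>x\<in>A. h (f x))"
  by (induction A rule: infinite_finite_induct) (auto simp: hom_mult hom_one)

lemma hom_power: "h (x ^ n) = h x ^ n"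
  by (induction n) (auto simp: hom_mult hom_one)

lemma eval_superset:
  assumes "finite S" "keys p \<subseteq> S"
  shows "mpoly_eval h p x = (\<Sum>e\<in>S. h (lookup p e) * eval_monom x e)"
  unfolding mpoly_eval_alt using assms
  by (intro sum.mono_neutral_left) (auto simp: in_keys_iff)

lemma eval_zero [simp]: "mpoly_eval h 0 x = 0"
  by (simp add: mpoly_eval_alt)

lemma eval_add: "mpoly_eval h (p + q) x = mpoly_eval h p x + mpoly_eval h q x"
proof -
  let ?S = "keys p \<union> keys q"
  have "mpoly_eval h (p + q) x = (\<Sum>e\<in>?S. h (lookup (p + q) e) * eval_monom x e)"
    using Poly_Mapping.keys_add[of p q] by (intro eval_superset) auto
  moreover have "mpoly_eval h p x = (\<Sum>e\<in>?S. h (lookup p e) * eval_monom x e)"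
    by (intro eval_superset) auto
  moreover have "mpoly_eval h q x = (\<Sum>e\<in>?S. h (lookup q e) * eval_monom x e)"
    by (intro eval_superset) auto
  ultimately show ?thesis
    by (simp add: lookup_add hom_add sum.distrib distrib_right)
qed

lemma eval_single: "mpoly_eval h (single e c) x = h c * eval_monom x e"
  using eval_superset[of "{e}" "single e c" x] by (simp add: keys_single)

lemma eval_mult: "mpoly_eval h (p * q) x = mpoly_eval h p x * mpoly_eval h q x"
proof (induction p rule: poly_mapping_induct)
  case (single e c)
  show ?case
  proof (induction q rule: poly_mapping_induct)
    case (single e' c')
    show ?case by (simp add: mult_single eval_single hom_mult eval_monom_add mult_ac)
  next
    case (add p q)
    then show ?case by (simp add: distrib_left eval_add)
  qed
next
  case (add p p')
  then show ?case by (simp add: distrib_right eval_add)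
qed

lemma eval_const [simp]: "mpoly_eval h (mpoly_const c) x = h c"
  by (simp add: mpoly_const_def eval_single)

lemma eval_var [simp]: "mpoly_eval h (mpoly_var i) x = x $ i"
  by (simp add: mpoly_var_def eval_single hom_one eval_monom_single)

lemma eval_one [simp]: "mpoly_eval h 1 x = 1"
  using eval_const[of 1] by (simp add: mpoly_const_def hom_one)

lemma eval_power: "mpoly_eval h (p ^ n) x = mpoly_eval h p x ^ n"
  by (induction n) (simp_all add: eval_mult)

lemma eval_sum: "mpoly_eval h (sum f A) x = (\<Sum>a\<in>A. mpoly_eval h (f a) x)"
  by (induction A rule: infinite_finite_induct) (auto simp: eval_add)

lemma eval_uminus: "mpoly_eval h (- p) x = - mpoly_eval h p x"
  using eval_add[of p "- p" x] by (simp add: add_eq_0_iff)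

lemma eval_diff: "mpoly_eval h (p - q) x = mpoly_eval h p x - mpoly_eval h q x"
  using eval_add[of p "- q" x] by (simp add: eval_uminus)

text \<open>Substituting and then evaluating amounts to evaluating at the composed point. With
  \<open>mpoly_const\<close> for \<open>h\<close> and an evaluation for \<open>g\<close>, this
  undoes a Taylor shift or a linear substitution.\<close>

lemma hom_eval_compose:
  fixes g :: "'b \<Rightarrow> 'c::comm_ring_1"
  assumes "\<And>x y. g (x + y) = g x + g y" "g 0 = 0" "g 1 = 1" "\<And>x y. g (x * y) = g x * g y"
  shows "g (mpoly_eval h p x) = mpoly_eval (\<lambda>c. g (h c)) p (\<chi> i. g (x $ i))"
proof -
  interpret g: coeff_hom g using assms by unfold_locales auto
  show ?thesis
    by (simp add: mpoly_eval_def g.hom_sum g.hom_prod g.hom_power g.hom_mult)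
qed

end

lemmas mpoly_eval_simps =
  coeff_hom.eval_zero coeff_hom.eval_one coeff_hom.eval_add coeff_hom.eval_mult
  coeff_hom.eval_const coeff_hom.eval_var coeff_hom.eval_power coeff_hom.eval_sum
  coeff_hom.eval_uminus coeff_hom.eval_diff

lemma coeff_hom_id: "coeff_hom id"
  by unfold_locales auto

lemma coeff_hom_mpoly_const: "coeff_hom mpoly_const"
  by unfold_locales (auto simp: mpoly_const_def single_add mult_single)

lemma coeff_hom_pCons: "coeff_hom (\<lambda>c::'a::comm_ring_1. [:c:])"
  by unfold_locales (auto simp: one_pCons)

lemma homogeneous_0 [simp]: "homogeneous d 0"
  by (simp add: homogeneous_def)

lemma homogeneous_single: "monom_degree e = d \<Longrightarrow> homogeneous d (single e c)"
  by (auto simp: homogeneous_def keys_single split: if_splits)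

lemma homogeneous_add: "homogeneous d p \<Longrightarrow> homogeneous d q \<Longrightarrow> homogeneous d (p + q)"
  using Poly_Mapping.keys_add[of p q] unfolding homogeneous_def by blast

lemma homogeneous_uminus: "homogeneous d p \<Longrightarrow> homogeneous d (- p :: ('n::finite, 'a::ab_group_add) mpoly)"
  by (simp add: homogeneous_def in_keys_iff)

lemma homogeneous_diff:
  "homogeneous d p \<Longrightarrow> homogeneous d q \<Longrightarrow> homogeneous d (p - q :: ('n::finite, 'a::ab_group_add) mpoly)"
  using homogeneous_add[of d p "- q"] homogeneous_uminus[of d q] by simp

lemma homogeneous_sum: "(\<And>a. a \<in> A \<Longrightarrow> homogeneous d (f a)) \<Longrightarrow> homogeneous d (sum f A)"
  by (induction A rule: infinite_finite_induct) (auto intro: homogeneous_add)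

lemma homogeneous_mult:
  fixes p q :: "('n::finite, 'a::semiring_0) mpoly"
  shows "homogeneous d p \<Longrightarrow> homogeneous d' q \<Longrightarrow> homogeneous (d + d') (p * q)"
  using Poly_Mapping.keys_mult[of p q] unfolding homogeneous_def by fastforce

lemma homogeneous_const: "homogeneous 0 (mpoly_const c)"
  unfolding mpoly_const_def by (rule homogeneous_single) simp

lemma homogeneous_var: "homogeneous 1 (mpoly_var i)"
  unfolding mpoly_var_def by (rule homogeneous_single) simp

lemma homogeneous_power:
  fixes p :: "('n::finite, 'a::comm_semiring_1) mpoly"
  shows "homogeneous d p \<Longrightarrow> homogeneous (d * n) (p ^ n)"
proof (induction n)
  case 0
  then show ?case using homogeneous_single[of "0 :: 'n \<Rightarrow>\<^sub>0 nat" 0 "1 :: 'a"] by simp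
next
  case (Suc n)
  then show ?case using homogeneous_mult[of d p "d * n" "p ^ n"] by simp
qed

lemma homogeneous_const_mult:
  fixes p :: "('n::finite, 'a::semiring_0) mpoly"
  shows "homogeneous d p \<Longrightarrow> homogeneous d (mpoly_const c * p)"
  using homogeneous_mult[OF homogeneous_const] by fastforce

lemma eval_monom_scale: "eval_monom (c *s x) e = c ^ monom_degree e * eval_monom x e"
  by (simp add: eval_monom_def monom_degree_def power_mult_distrib prod.distrib power_sum)

lemma homogeneous_eval_scale:
  fixes p :: "('n::finite, 'a::comm_ring_1) mpoly"
  assumes "homogeneous d p"
  shows "mpoly_eval id p (c *s x) = c ^ d * mpoly_eval id p x"
  using assms unfolding mpoly_eval_alt homogeneous_def
  by (simp add: eval_monom_scale sum_distrib_left mult_ac)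

section \<open>Order of vanishing, read off from the Taylor expansion at a point\<close>

definition shift_poly :: "('n::finite, 'a::comm_ring_1) mpoly \<Rightarrow> 'a^'n \<Rightarrow> ('n, 'a) mpoly" where
  "shift_poly p v = mpoly_eval mpoly_const p (\<chi> i. mpoly_const (v $ i) + mpoly_var i)"

definition order_ge :: "nat \<Rightarrow> ('n::finite, 'a::comm_ring_1) mpoly \<Rightarrow> bool" where
  "order_ge m q \<longleftrightarrow> (\<forall>e\<in>keys q. m \<le> monom_degree e)"

lemma vanishes_to_order_iff: "vanishes_to_order m p v \<longleftrightarrow> order_ge m (shift_poly p v)"
  by (simp add: vanishes_to_order_def shift_poly_def order_ge_def)

lemma order_ge_0: "order_ge 0 q"
  by (simp add: order_ge_def)

lemma order_ge_add: "order_ge m p \<Longrightarrow> order_ge m q \<Longrightarrow> order_ge m (p + q)"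
  using Poly_Mapping.keys_add[of p q] unfolding order_ge_def by blast

lemma order_ge_uminus: "order_ge m p \<Longrightarrow> order_ge m (- p)"
  by (simp add: order_ge_def in_keys_iff)

lemma order_ge_mult: "order_ge m p \<Longrightarrow> order_ge n q \<Longrightarrow> order_ge (m + n) (p * q)"
  using Poly_Mapping.keys_mult[of p q] unfolding order_ge_def by fastforce

lemma shift_poly_add: "shift_poly (p + q) v = shift_poly p v + shift_poly q v"
  and shift_poly_mult: "shift_poly (p * q) v = shift_poly p v * shift_poly q v"
  and shift_poly_uminus: "shift_poly (- p) v = - shift_poly p v"
  and shift_poly_var: "shift_poly (mpoly_var i) v = mpoly_const (v $ i) + mpoly_var i"
  by (simp_all add: shift_poly_def mpoly_eval_simps coeff_hom_mpoly_const)

lemma vanishes_to_order_0: "vanishes_to_order 0 p v"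
  by (simp add: vanishes_to_order_iff order_ge_0)

lemma vanishes_to_order_add:
  "vanishes_to_order m p v \<Longrightarrow> vanishes_to_order m q v \<Longrightarrow> vanishes_to_order m (p + q) v"
  by (simp add: vanishes_to_order_iff shift_poly_add order_ge_add)

lemma vanishes_to_order_uminus: "vanishes_to_order m p v \<Longrightarrow> vanishes_to_order m (- p) v"
  by (simp add: vanishes_to_order_iff shift_poly_uminus order_ge_uminus)

lemma vanishes_to_order_diff:
  "vanishes_to_order m p v \<Longrightarrow> vanishes_to_order m q v \<Longrightarrow> vanishes_to_order m (p - q) v"
  using vanishes_to_order_add[of m p v "- q"] vanishes_to_order_uminus[of m q v] by simp

lemma vanishes_to_order_mult:
  "vanishes_to_order m p v \<Longrightarrow> vanishes_to_order n q v \<Longrightarrow> vanishes_to_order (m + n) (p * q) v"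
  by (simp add: vanishes_to_order_iff shift_poly_mult order_ge_mult)

lemma monom_degree_eq_0_iff: "monom_degree e = 0 \<longleftrightarrow> e = 0"
  by (auto simp: monom_degree_def intro: poly_mapping_eqI)

lemma vanishes_to_order_1:
  fixes v :: "'a::comm_ring_1^'n::finite"
  assumes "mpoly_eval id p v = 0"
  shows "vanishes_to_order 1 p v"
proof -
  \<comment> \<open>Evaluation at the origin is a ring homomorphism that reads off the constant
    term, and it can be pushed through the Taylor shift, where it yields the value at
    \<open>v\<close>.\<close>
  define g where "g = (\<lambda>q::('n, 'a) mpoly. mpoly_eval id q 0)"
  have g: "g q = lookup q 0" for q
  proof -
    have mon: "eval_monom (0 :: 'a^'n) e = (if e = 0 then 1 else 0)" for e
    proof (cases "e = 0")
      case False
      then obtain i where "lookup e i \<noteq> 0" by (metis lookup_zero poly_mapping_eqI)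
      then show ?thesis
        using False by (auto simp: eval_monom_def power_0_left intro!: prod_zero bexI[of _ i])
    qed simp
    have "g q = (\<Sum>e\<in>insert 0 (keys q).
        lookup q e * eval_monom (0 :: 'a^'n) e)"
      unfolding g_def by (subst coeff_hom.eval_superset[OF coeff_hom_id]) auto
    also have "\<dots> = lookup q 0"
      by (simp add: mon if_distrib[of "(*) _"] sum.delta cong: if_cong)
    finally show ?thesis .
  qed
  have "g (shift_poly p v) = mpoly_eval (\<lambda>c. g (mpoly_const c)) p
      (\<chi> i. g ((\<chi> i. mpoly_const (v $ i) + mpoly_var i) $ i))"
    unfolding shift_poly_def
    by (rule coeff_hom.hom_eval_compose[OF coeff_hom_mpoly_const])
      (simp_all add: g_def mpoly_eval_simps coeff_hom_id)
  also have "\<dots> = mpoly_eval id p v"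
    by (simp add: g_def mpoly_eval_simps coeff_hom_id) (simp add: id_def)
  finally have "lookup (shift_poly p v) 0 = 0" using assms g by simp
  then show ?thesis
    unfolding vanishes_to_order_iff order_ge_def
    by (metis in_keys_iff monom_degree_eq_0_iff less_one not_le)
qed

text \<open>Expanded at \<open>v\<close>, the variable becomes \<open>1 + y\<close>, a unit of the
  local ring: a monomial of lowest degree in the expansion of \<open>q\<close> survives
  multiplication by it, because \<open>y\<close> raises degrees.\<close>

lemma vanishes_to_order_cancel_var:
  fixes v :: "'a::comm_ring_1^'n::finite"
  assumes "vanishes_to_order m (mpoly_var i * q) v" "v $ i = 1"
  shows "vanishes_to_order m q v"
proof (rule ccontr)
  let ?q = "shift_poly q v" and ?y = "mpoly_var i :: ('n, 'a) mpoly"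
  let ?B = "{e \<in> keys ?q. monom_degree e < m}"
  assume "\<not> ?thesis"
  then have "?B \<noteq> {}" by (auto simp: vanishes_to_order_iff order_ge_def not_le)
  then obtain e where e: "e \<in> ?B" "\<And>e'. e' \<in> ?B \<Longrightarrow> monom_degree e \<le> monom_degree e'"
    using arg_min_if_finite[of ?B monom_degree] by (metis (no_types, lifting) finite_keys
        arg_min_least finite_subset mem_Collect_eq subsetI)
  have "shift_poly (mpoly_var i * q) v = ?q + ?y * ?q"
    using assms(2) by (simp add: shift_poly_mult shift_poly_var distrib_right mpoly_const_def)
  then have "?q = shift_poly (mpoly_var i * q) v + - (?y * ?q)" by simp
  then have "keys ?q
      \<subseteq> keys (shift_poly (mpoly_var i * q) v) \<union> keys (- (?y * ?q))"
    by (metis Poly_Mapping.keys_add)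
  moreover have "e \<notin> keys (shift_poly (mpoly_var i * q) v)"
    using assms(1) e(1) by (auto simp: vanishes_to_order_iff order_ge_def)
  ultimately have "e \<in> keys (?y * ?q)"
    using e(1) by (auto simp: in_keys_iff)
  then obtain e1 e2 where "e = e1 + e2" "e1 \<in> keys ?y" "e2 \<in> keys ?q"
    using Poly_Mapping.keys_mult[of ?y ?q] by blast
  then have "e2 \<in> ?B" "monom_degree e2 < monom_degree e"
    using e(1) by (auto simp: mpoly_var_def keys_single split: if_splits)
  then show False using e(2)[of e2] by simp
qed

text \<open>Along a curve that passes through \<open>v\<close> at the parameter \<open>a\<close>,
  every local coordinate is divisible by the parameter minus \<open>a\<close>, hence every term of
  degree at least \<open>m\<close> by the \<open>m\<close>-th power.\<close>

lemma vanishes_to_order_dvd: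
  fixes v :: "'a::field^'n::finite" and x :: "'a poly^'n"
  assumes "vanishes_to_order m p v" and "\<And>i. poly (x $ i) a = v $ i"
  shows "[:- a, 1:] ^ m dvd mpoly_eval (\<lambda>c. [:c:]) p x"
proof -
  let ?w = "\<chi> i. x $ i - [:v $ i:]" and ?h = "\<lambda>c::'a. [:c:]"
  have "mpoly_eval ?h (shift_poly p v) ?w =
      mpoly_eval (\<lambda>c. mpoly_eval ?h (mpoly_const c) ?w) p
        (\<chi> i. mpoly_eval ?h ((\<chi> i. mpoly_const (v $ i) + mpoly_var i) $ i) ?w)"
    unfolding shift_poly_def
    by (rule coeff_hom.hom_eval_compose[OF coeff_hom_mpoly_const])
      (simp_all add: mpoly_eval_simps coeff_hom_pCons)
  also have "\<dots> = mpoly_eval ?h p x"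
    by (simp add: mpoly_eval_simps coeff_hom_pCons)
  finally have eq: "mpoly_eval ?h p x = mpoly_eval ?h (shift_poly p v) ?w" by simp
  have lin: "[:- a, 1:] dvd ?w $ i" for i
    using assms(2)[of i] by (simp add: poly_eq_0_iff_dvd[symmetric])
  have "[:- a, 1:] ^ m dvd ?h (lookup (shift_poly p v) e) * eval_monom ?w e"
    if "e \<in> keys (shift_poly p v)" for e
  proof -
    have "m \<le> monom_degree e"
      using assms(1) that by (auto simp: vanishes_to_order_iff order_ge_def)
    then have "[:- a, 1:] ^ m dvd [:- a, 1:] ^ monom_degree e" by (rule le_imp_power_dvd)
    also have "\<dots> = (\<Prod>i\<in>UNIV. [:- a, 1:] ^ lookup e i)"
      by (simp add: monom_degree_def power_sum)
    also have "\<dots> dvd eval_monom ?w e"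
      unfolding eval_monom_def by (intro prod_dvd_prod dvd_power_same lin)
    finally show ?thesis by (rule dvd_mult)
  qed
  then have "[:- a, 1:] ^ m dvd mpoly_eval ?h (shift_poly p v) ?w"
    unfolding mpoly_eval_alt by (rule dvd_sum)
  then show ?thesis by (simp only: eq)
qed

lemma poly_mpoly_eval:
  fixes x :: "'a::comm_ring_1 poly^'n::finite"
  shows "poly (mpoly_eval (\<lambda>c. [:c:]) p x) t = mpoly_eval id p (\<chi> i. poly (x $ i) t)"
  by (subst coeff_hom.hom_eval_compose[OF coeff_hom_pCons, of "\<lambda>q. poly q t"])
    (simp_all add: id_def)

section \<open>Polynomials with coefficients in the ground field\<close>

lemma defined_over_add:
  "defined_over_ground_field p \<Longrightarrow> defined_over_ground_field q \<Longrightarrow> defined_over_ground_field (p + q)"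
  unfolding defined_over_ground_field_def lookup_add
  by (metis (no_types, lifting) rangeE rangeI to_ac_add)

lemma defined_over_uminus: "defined_over_ground_field p \<Longrightarrow> defined_over_ground_field (- p)"
  unfolding defined_over_ground_field_def lookup_uminus
  by (metis (no_types, lifting) rangeE rangeI to_ac_minus)

lemma defined_over_diff:
  "defined_over_ground_field p \<Longrightarrow> defined_over_ground_field q \<Longrightarrow> defined_over_ground_field (p - q)"
  using defined_over_add[of p "- q"] defined_over_uminus[of q] by simp

lemma defined_over_single:
  "c \<in> range to_ac \<Longrightarrow> defined_over_ground_field (single e c)"
  unfolding defined_over_ground_field_def lookup_single when_def
  by (metis (full_types) rangeI to_ac_0)

lemma defined_over_sum:
  "(\<And>a. a \<in> A \<Longrightarrow> defined_over_ground_field (f a)) \<Longrightarrow> defined_over_ground_field (sum f A)"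
proof (induction A rule: infinite_finite_induct)
  case (insert a A)
  then show ?case by (auto intro: defined_over_add)
qed (simp_all add: defined_over_ground_field_def range_eqI[of 0 to_ac 0])

lemma defined_over_mult:
  fixes p q :: "('n, 'k::field alg_closure) mpoly"
  assumes "defined_over_ground_field p" "defined_over_ground_field q"
  shows "defined_over_ground_field (p * q)"
proof -
  have "p * q = (\<Sum>e\<in>keys p. \<Sum>e'\<in>keys q.
      single (e + e') (lookup p e * lookup q e'))"
    by (subst poly_mapping_sum_single[of p], subst poly_mapping_sum_single[of q])
      (simp add: sum_product mult_single)
  moreover have "lookup p e * lookup q e' \<in> range to_ac" for e e'
    using assms unfolding defined_over_ground_field_def
    by (metis (no_types, lifting) rangeE rangeI to_ac_mult)
  ultimately show ?thesis by (auto intro!: defined_over_sum defined_over_single)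
qed

lemma defined_over_const: "c \<in> range to_ac \<Longrightarrow> defined_over_ground_field (mpoly_const c)"
  unfolding mpoly_const_def by (rule defined_over_single)

lemma defined_over_var: "defined_over_ground_field (mpoly_var i)"
  unfolding mpoly_var_def by (rule defined_over_single) (metis rangeI to_ac_1)

section \<open>The quintics singular at five points of a conic\<close>

lemma exhaust_6: "(x::6) = 0 \<or> x = 1 \<or> x = 2 \<or> x = 3 \<or> x = 4 \<or> x = 5"
proof (induct x)
  case (of_int z)
  then have "0 \<le> z" "z < 6" by simp_all
  then have "z = 0 \<or> z = 1 \<or> z = 2 \<or> z = 3 \<or> z = 4 \<or> z = 5" by arith
  then show ?case by auto
qed

lemma UNIV_6: "(UNIV :: 6 set) = {0, 1, 2, 3, 4, 5}"
  using exhaust_6 by auto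

lemma forall_6: "(\<forall>i::6. P i) \<longleftrightarrow> P 0 \<and> P 1 \<and> P 2 \<and> P 3 \<and> P 4 \<and> P 5"
  by (metis exhaust_6)

lemma distinct_6:
  "(0::6) \<noteq> 1" "(0::6) \<noteq> 2" "(0::6) \<noteq> 3" "(0::6) \<noteq> 4" "(0::6) \<noteq> 5"
  "(1::6) \<noteq> 2" "(1::6) \<noteq> 3" "(1::6) \<noteq> 4" "(1::6) \<noteq> 5"
  "(2::6) \<noteq> 3" "(2::6) \<noteq> 4" "(2::6) \<noteq> 5" "(3::6) \<noteq> 4" "(3::6) \<noteq> 5" "(4::6) \<noteq> 5"
  by simp_all

lemma sum_6: "sum f (UNIV :: 6 set) = f 0 + f 1 + f 2 + f 3 + f 4 + f 5"
  unfolding UNIV_6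
  by (simp only: sum.insert finite.intros insert_iff empty_iff distinct_6 simp_thms sum.empty
      add_0_right add.assoc)

text \<open>Like the forms below, it is stated over any commutative ring: the same formula is used
  for field elements, for variables in three or six unknowns and for points with univariate
  polynomial coordinates.\<close>

definition conic :: "'r::comm_ring_1 \<Rightarrow> 'r \<Rightarrow> 'r \<Rightarrow> 'r" where
  "conic x y z = x * z - y ^ 2"

text \<open>Give x, y, z the weights 2, 1, 0. Each power \<open>t ^ m\<close> in Q(t) is replaced by
  the cubic monomial of weight \<open>m\<close> in which y occurs at most once;
  \<open>cubic1\<close> treats t Q(t) in the same way. The leading coefficient 1 of Q is built in,
  so \<open>c\<close> is read only up to index 4.\<close>

definition cubic0 :: "(nat \<Rightarrow> 'r::comm_ring_1) \<Rightarrow> 'r \<Rightarrow> 'r \<Rightarrow> 'r \<Rightarrow> 'r" where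
  "cubic0 c x y z = x ^ 2 * y + c 4 * x ^ 2 * z + c 3 * x * y * z + c 2 * x * z ^ 2
     + c 1 * y * z ^ 2 + c 0 * z ^ 3"

definition cubic1 :: "(nat \<Rightarrow> 'r::comm_ring_1) \<Rightarrow> 'r \<Rightarrow> 'r \<Rightarrow> 'r \<Rightarrow> 'r" where
  "cubic1 c x y z = x ^ 3 + c 4 * x ^ 2 * y + c 3 * x ^ 2 * z + c 2 * x * y * z
     + c 1 * x * z ^ 2 + c 0 * y * z ^ 2"

text \<open>Modulo z, the forms \<open>conic\<close>, \<open>cubic0\<close> and
  \<open>cubic1\<close> - c 4 \<open>cubic0\<close> become -y^2, x^2 y and x^3. Hence the square of
  \<open>cubic0\<close> plus x \<open>conic\<close> (\<open>cubic1\<close> - c 4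
  \<open>cubic0\<close>) is divisible by z, and this is the quotient. No division by 2 occurs, so
  characteristic 2 is included.\<close>

definition quintic :: "(nat \<Rightarrow> 'r::comm_ring_1) \<Rightarrow> 'r \<Rightarrow> 'r \<Rightarrow> 'r \<Rightarrow> 'r" where
  "quintic c x y z =
     (let g = c 4 * x ^ 2 + c 3 * x * y + c 2 * x * z + c 1 * y * z + c 0 * z ^ 2;
          h = c 3 * x ^ 2 + c 2 * x * y + c 1 * x * z + c 0 * y * z
      in 2 * x ^ 2 * y * g + z * g ^ 2 + x ^ 5 + conic x y z * x * (h - c 4 * g))"

text \<open>The source both of the double points of \<open>quintic\<close> and of one of the
  quadratic equations of the surface.\<close>

lemma quintic_relation:
  fixes x y z :: "'r::idom"
  shows "z * quintic c x y z = cubic0 c x y z ^ 2 + conic x y z * x * cubic1 c x y z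
     - c 4 * conic x y z * x * cubic0 c x y z"
proof -
  define g where "g = c 4 * x ^ 2 + c 3 * x * y + c 2 * x * z + c 1 * y * z + c 0 * z ^ 2"
  define h where "h = c 3 * x ^ 2 + c 2 * x * y + c 1 * x * z + c 0 * y * z"
  have "cubic0 c x y z = x ^ 2 * y + z * g" "cubic1 c x y z = x ^ 3 + c 4 * x ^ 2 * y + z * h"
    unfolding cubic0_def cubic1_def g_def h_def by Groebner_Basis.algebra+
  moreover have "quintic c x y z = 2 * x ^ 2 * y * g + z * g ^ 2 + x ^ 5 + conic x y z * x * (h - c 4 * g)"
    unfolding quintic_def g_def h_def Let_def by (rule refl)
  ultimately show ?thesis unfolding conic_def by Groebner_Basis.algebra
qed

definition six :: "'b \<Rightarrow> 'b \<Rightarrow> 'b \<Rightarrow> 'b \<Rightarrow> 'b \<Rightarrow> 'b \<Rightarrow> 6 \<Rightarrow> 'b" where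
  "six a b c d e f i = (if i = 0 then a else if i = 1 then b else if i = 2 then c
     else if i = 3 then d else if i = 4 then e else f)"

lemma six_simps [simp]:
  "six a b c d e f 0 = a" "six a b c d e f 1 = b" "six a b c d e f 2 = c"
  "six a b c d e f 3 = d" "six a b c d e f 4 = e" "six a b c d e f 5 = f"
  by (simp_all add: six_def)

definition quintic_system :: "(nat \<Rightarrow> 'r::comm_ring_1) \<Rightarrow> 'r \<Rightarrow> 'r \<Rightarrow> 'r \<Rightarrow> 6 \<Rightarrow> 'r" where
  "quintic_system c x y z =
     six (conic x y z ^ 2 * x) (conic x y z ^ 2 * y) (conic x y z ^ 2 * z)
       (conic x y z * cubic0 c x y z) (conic x y z * cubic1 c x y z) (quintic c x y z)"

abbreviation conic_form :: "(3, 'a::comm_ring_1) mpoly" where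
  "conic_form \<equiv> conic (mpoly_var 1) (mpoly_var 2) (mpoly_var 3)"

abbreviation cubic0_form :: "'a::comm_ring_1 poly \<Rightarrow> (3, 'a) mpoly" where
  "cubic0_form Q \<equiv> cubic0 (\<lambda>n. mpoly_const (coeff Q n)) (mpoly_var 1) (mpoly_var 2) (mpoly_var 3)"

abbreviation cubic1_form :: "'a::comm_ring_1 poly \<Rightarrow> (3, 'a) mpoly" where
  "cubic1_form Q \<equiv> cubic1 (\<lambda>n. mpoly_const (coeff Q n)) (mpoly_var 1) (mpoly_var 2) (mpoly_var 3)"

abbreviation quintic_form :: "'a::comm_ring_1 poly \<Rightarrow> (3, 'a) mpoly" where
  "quintic_form Q \<equiv> quintic (\<lambda>n. mpoly_const (coeff Q n)) (mpoly_var 1) (mpoly_var 2) (mpoly_var 3)"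

definition standard_basis :: "'a::comm_ring_1 poly \<Rightarrow> 6 \<Rightarrow> (3, 'a) mpoly" where
  "standard_basis Q = quintic_system (\<lambda>n. mpoly_const (coeff Q n)) (mpoly_var 1) (mpoly_var 2) (mpoly_var 3)"

context coeff_hom
begin

lemma hom_diff: "h (x - y) = h x - h y"
  using hom_add[of "x - y" y] by (simp add: algebra_simps)

lemma eval_numeral: "mpoly_eval h (numeral n) x = h (numeral n)"
proof -
  have "(numeral n :: ('n::finite, 'a) mpoly) = mpoly_const (numeral n)"
    unfolding mpoly_const_def by simp
  then show ?thesis by (metis eval_const)
qed

lemma hom_numeral: "h (numeral n) = numeral n"
proof -
  have "h (of_nat m) = of_nat m" for m
    by (induction m) (auto simp: hom_add hom_one)
  from this[of "numeral n"] show ?thesis by simp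
qed

lemma eval_conic [simp]: "mpoly_eval h (conic x y z) v =
    conic (mpoly_eval h x v) (mpoly_eval h y v) (mpoly_eval h z v)"
  by (simp add: conic_def eval_diff eval_mult eval_power)

lemma eval_cubic0 [simp]: "mpoly_eval h (cubic0 (\<lambda>n. mpoly_const (c n)) x y z) v =
    cubic0 (\<lambda>n. h (c n)) (mpoly_eval h x v) (mpoly_eval h y v) (mpoly_eval h z v)"
  by (simp add: cubic0_def eval_add eval_mult eval_power)

lemma eval_cubic1 [simp]: "mpoly_eval h (cubic1 (\<lambda>n. mpoly_const (c n)) x y z) v =
    cubic1 (\<lambda>n. h (c n)) (mpoly_eval h x v) (mpoly_eval h y v) (mpoly_eval h z v)"
  by (simp add: cubic1_def eval_add eval_mult eval_power)

lemma eval_quintic [simp]: "mpoly_eval h (quintic (\<lambda>n. mpoly_const (c n)) x y z) v =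
    quintic (\<lambda>n. h (c n)) (mpoly_eval h x v) (mpoly_eval h y v) (mpoly_eval h z v)"
  by (simp add: quintic_def Let_def eval_add eval_diff eval_mult eval_power eval_numeral hom_numeral)

lemma eval_standard_basis: "mpoly_eval h (standard_basis Q i) v =
    quintic_system (\<lambda>n. h (coeff Q n)) (v $ 1) (v $ 2) (v $ 3) i"
  using exhaust_6[of i]
  by (auto simp: standard_basis_def quintic_system_def eval_mult eval_power)

end

lemmas eval_id_simps = mpoly_eval_simps[OF coeff_hom_id]
  coeff_hom.eval_conic[OF coeff_hom_id] coeff_hom.eval_cubic0[OF coeff_hom_id]
  coeff_hom.eval_cubic1[OF coeff_hom_id] coeff_hom.eval_quintic[OF coeff_hom_id]

context
  fixes x y z :: "('n::finite, 'a::comm_ring_1) mpoly"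
  assumes linear: "homogeneous 1 x" "homogeneous 1 y" "homogeneous 1 z"
begin

lemma homogeneous_conic: "homogeneous 2 (conic x y z)"
  using homogeneous_mult[OF linear(1) linear(3)] homogeneous_power[OF linear(2), of 2]
  unfolding conic_def by (auto intro!: homogeneous_diff simp: numeral_2_eq_2)

lemma homogeneous_trinomial:
  fixes c :: 'a
  assumes "i + j + k = d"
  shows "homogeneous d (mpoly_const c * (x ^ i * y ^ j * z ^ k) :: ('n, 'a) mpoly)"
proof -
  have "homogeneous (i + j + k) (x ^ i * y ^ j * z ^ k :: ('n, 'a) mpoly)"
    using homogeneous_power[OF linear(1)] homogeneous_power[OF linear(2)] homogeneous_power[OF linear(3)] by (intro homogeneous_mult) auto
  then show ?thesis using assms homogeneous_const_mult by auto
qed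

lemma homogeneous_cubic0: "homogeneous 3 (cubic0 (\<lambda>n. mpoly_const (c n)) x y z)"
proof -
  let ?m = "\<lambda>(c::'a) i j k. mpoly_const c * (x ^ i * y ^ j * z ^ k) :: ('n, 'a) mpoly"
  have "cubic0 (\<lambda>n. mpoly_const (c n)) x y z = ?m 1 2 1 0 + ?m (c 4) 2 0 1 + ?m (c 3) 1 1 1 + ?m (c 2) 1 0 2
      + ?m (c 1) 0 1 2 + ?m (c 0) 0 0 3"
    by (simp add: cubic0_def mpoly_const_def mult.assoc)
  also have "homogeneous 3 \<dots>"
    by (intro homogeneous_add homogeneous_trinomial) auto
  finally show ?thesis .
qed

lemma homogeneous_cubic1: "homogeneous 3 (cubic1 (\<lambda>n. mpoly_const (c n)) x y z)"
proof -
  let ?m = "\<lambda>(c::'a) i j k. mpoly_const c * (x ^ i * y ^ j * z ^ k) :: ('n, 'a) mpoly"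
  have "cubic1 (\<lambda>n. mpoly_const (c n)) x y z = ?m 1 3 0 0 + ?m (c 4) 2 1 0 + ?m (c 3) 2 0 1 + ?m (c 2) 1 1 1
      + ?m (c 1) 1 0 2 + ?m (c 0) 0 1 2"
    by (simp add: cubic1_def mpoly_const_def mult.assoc)
  also have "homogeneous 3 \<dots>"
    by (intro homogeneous_add homogeneous_trinomial) auto
  finally show ?thesis .
qed

lemma homogeneous_quintic: "homogeneous 5 (quintic (\<lambda>n. mpoly_const (c n)) x y z)"
proof -
  let ?m = "\<lambda>(c::'a) i j k. mpoly_const c * (x ^ i * y ^ j * z ^ k) :: ('n, 'a) mpoly"
  define g where "g = ?m (c 4) 2 0 0 + ?m (c 3) 1 1 0 + ?m (c 2) 1 0 1 + ?m (c 1) 0 1 1 + ?m (c 0) 0 0 2"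
  define h where "h = ?m (c 3) 2 0 0 + ?m (c 2) 1 1 0 + ?m (c 1) 1 0 1 + ?m (c 0) 0 1 1"
  have g: "homogeneous 2 g" and h: "homogeneous 2 h"
    unfolding g_def h_def by (intro homogeneous_add homogeneous_trinomial; simp)+
  have g': "g = mpoly_const (c 4) * x ^ 2 + mpoly_const (c 3) * x * y
      + mpoly_const (c 2) * x * z
      + mpoly_const (c 1) * y * z + mpoly_const (c 0) * z ^ 2"
    by (simp add: g_def mult.assoc)
  have h': "h = mpoly_const (c 3) * x ^ 2 + mpoly_const (c 2) * x * y
      + mpoly_const (c 1) * x * z
      + mpoly_const (c 0) * y * z"
    by (simp add: h_def mult.assoc)
  have one: "mpoly_const 1 = (1 :: ('n, 'a) mpoly)" by (simp add: mpoly_const_def)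
  have two: "mpoly_const 2 = (2 :: ('n, 'a) mpoly)" by (simp add: mpoly_const_def)
  have "quintic (\<lambda>n. mpoly_const (c n)) x y z = ?m 2 2 1 0 * g + ?m 1 0 0 1 * g ^ 2 + ?m 1 5 0 0
      + conic x y z * ?m 1 1 0 0 * (h - mpoly_const (c 4) * g)"
    unfolding quintic_def Let_def g'[symmetric] h'[symmetric] two one
    by (simp add: mult.assoc)
  also have "homogeneous 5 \<dots>"
  proof (intro homogeneous_add)
    have "homogeneous (3 + 2) (?m 2 2 1 0 * g)"
      by (rule homogeneous_mult[OF homogeneous_trinomial g]) simp
    then show "homogeneous 5 (?m 2 2 1 0 * g)" by simp
    have "homogeneous (1 + 2 * 2) (?m 1 0 0 1 * g ^ 2)"
      by (rule homogeneous_mult[OF homogeneous_trinomial homogeneous_power[OF g]]) simp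
    then show "homogeneous 5 (?m 1 0 0 1 * g ^ 2)" by simp
    show "homogeneous 5 (?m 1 5 0 0)" by (rule homogeneous_trinomial) simp
    have "homogeneous (2 + 1 + 2) (conic x y z * ?m 1 1 0 0 * (h - mpoly_const (c 4) * g))"
      by (intro homogeneous_mult homogeneous_conic homogeneous_trinomial homogeneous_diff
          homogeneous_const_mult g h) simp
    then show "homogeneous 5 (conic x y z * ?m 1 1 0 0 * (h - mpoly_const (c 4) * g))" by simp
  qed
  finally show ?thesis .
qed

end

lemma homogeneous_standard_basis: "homogeneous 5 (standard_basis Q i :: (3, 'a::comm_ring_1) mpoly)"
proof -
  have "homogeneous (2 * 2 + 1) (conic_form ^ 2 * mpoly_var j :: (3, 'a) mpoly)" for j
    by (intro homogeneous_mult homogeneous_power homogeneous_conic homogeneous_var)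
  moreover have "homogeneous (2 + 3) (conic_form * cubic0_form Q)"
    "homogeneous (2 + 3) (conic_form * cubic1_form Q)"
    by (intro homogeneous_mult homogeneous_conic homogeneous_cubic0 homogeneous_cubic1 homogeneous_var)+
  ultimately show ?thesis
    using exhaust_6[of i] homogeneous_quintic[OF homogeneous_var homogeneous_var homogeneous_var]
    by (auto simp: standard_basis_def quintic_system_def)
qed

lemma mpoly_single_eq:
  fixes c :: "'a::comm_ring_1" and e :: "'n::finite \<Rightarrow>\<^sub>0 nat"
  shows "single e c = mpoly_const c * (\<Prod>i\<in>UNIV. mpoly_var i ^ lookup e i)"
proof -
  have pow: "mpoly_var i ^ k = single (single i k) (1::'a)" for i :: 'n and k
    by (induction k) (simp_all add: mpoly_var_def mult_single single_add[symmetric])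
  have "(\<Prod>i\<in>S. single (f i) (1::'a)) = single (\<Sum>i\<in>S. f i) 1"
    if "finite S" for S :: "'n set" and f :: "'n \<Rightarrow> 'n \<Rightarrow>\<^sub>0 nat"
    using that by (induction S) (auto simp: mult_single)
  moreover have "(\<Sum>i\<in>UNIV. single i (lookup e i)) = e"
    by (rule poly_mapping_eqI) (simp add: lookup_sum lookup_single when_def)
  ultimately show ?thesis
    by (simp add: pow mpoly_const_def mult_single)
qed

lemma homogeneous_1_linear:
  fixes p :: "('n::finite, 'a::comm_ring_1) mpoly"
  assumes "homogeneous 1 p"
  shows "p = (\<Sum>i\<in>UNIV. mpoly_const (lookup p (single i 1)) * mpoly_var i)"
proof (rule poly_mapping_eqI)
  fix e
  have rhs: "lookup (\<Sum>i\<in>UNIV. mpoly_const (lookup p (single i 1)) * mpoly_var i) e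
      = (\<Sum>i\<in>UNIV. lookup p (single i 1) when single i 1 = e)"
    by (simp add: mpoly_const_def mpoly_var_def mult_single lookup_sum lookup_single)
  show "lookup p e = lookup
      (\<Sum>i\<in>UNIV. mpoly_const (lookup p (single i 1)) * mpoly_var i) e"
  proof (cases "\<exists>i. e = single i 1")
    case True
    then obtain j where e: "e = single j 1" by blast
    have "(single i (1::nat) = single j 1) = (i = j)" for i
      by (metis lookup_single_eq lookup_single_not_eq zero_neq_one)
    then show ?thesis unfolding rhs by (simp add: e when_def)
  next
    case False
    have "e \<notin> keys p"
    proof
      assume "e \<in> keys p"
      then have deg: "(\<Sum>i\<in>UNIV. lookup e i) = 1"
        using assms by (auto simp: homogeneous_def monom_degree_def)
      then obtain i where i: "lookup e i = 1" "\<And>j. j \<noteq> i \<Longrightarrow> lookup e j = 0"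
        using sum_eq_1_iff[of "UNIV :: 'n set" "lookup e"] by auto
      have "e = single i 1"
        using i by (intro poly_mapping_eqI) (auto simp: lookup_single when_def)
      with False show False by blast
    qed
    moreover have "single i 1 \<noteq> e" for i using False by blast
    ultimately show ?thesis unfolding rhs by (simp add: in_keys_iff when_def del: One_nat_def)
  qed
qed

section \<open>Restriction to the conic and division by its equation\<close>

definition on_conic :: "(3, 'a::comm_ring_1) mpoly \<Rightarrow> 'a poly" where
  "on_conic p = mpoly_eval (\<lambda>c. [:c:]) p (vector [[:0, 0, 1:], [:0, 1:], 1])"

lemma on_conic_simps:
  "on_conic (p + q) = on_conic p + on_conic q" "on_conic (p - q) = on_conic p - on_conic q"
  "on_conic (p * q) = on_conic p * on_conic q" "on_conic (sum f A) = (\<Sum>a\<in>A. on_conic (f a))"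
  "on_conic (mpoly_const c) = [:c:]"
  unfolding on_conic_def by (simp_all add: mpoly_eval_simps coeff_hom_pCons)

lemma poly_on_conic: "poly (on_conic p) t = mpoly_eval id p (vector [t ^ 2, t, 1])"
  unfolding on_conic_def poly_mpoly_eval
  by (rule arg_cong[where f = "mpoly_eval id p"]) (simp add: vec_eq_iff forall_3 power2_eq_square)

lemma on_conic_single:
  "on_conic (single e c)
     = Polynomial.monom c (2 * lookup e 1 + lookup e 2)"
proof -
  have 1: "[:0, 1::'a:] = Polynomial.monom 1 1" and 2: "[:0, 0, 1::'a:] = Polynomial.monom 1 2"
    by (simp_all add: monom_altdef power2_eq_square)
  have "on_conic (single e c) =
      [:c:] * ([:0, 0, 1:] ^ lookup e 1 * [:0, 1:] ^ lookup e 2)"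
    unfolding on_conic_def coeff_hom.eval_single[OF coeff_hom_pCons] eval_monom_def UNIV_3
    by (simp add: mult_ac)
  also have "\<dots> = Polynomial.monom c (2 * lookup e 1 + lookup e 2)"
    by (simp only: 2) (simp only: 1 monom_power mult_monom, simp add: smult_monom)
  finally show ?thesis .
qed

lemma degree_on_conic:
  assumes "homogeneous d p"
  shows "degree (on_conic p) \<le> 2 * d"
proof -
  have "on_conic p = (\<Sum>e\<in>keys p. on_conic (single e (lookup p e)))"
    by (subst poly_mapping_sum_single) (simp only: on_conic_simps)
  also have "degree \<dots> \<le> 2 * d"
  proof (rule degree_sum_le)
    fix e assume "e \<in> keys p"
    then have "monom_degree e = d" using assms by (auto simp: homogeneous_def)
    then have "lookup e 1 + lookup e 2 + lookup e 3 = d"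
      by (simp add: monom_degree_def sum_3)
    then show "degree (on_conic (single e (lookup p e))) \<le> 2 * d"
      unfolding on_conic_single by (intro order.trans[OF degree_monom_le]) simp
  qed simp
  finally show ?thesis .
qed

text \<open>Modulo the conic, y^2 equals x z, so every monomial is congruent to one with y-exponent
  0 or 1. For a given degree this one depends only on the weight, which is the exponent of t on the
  conic.\<close>

lemma conic_normal_form_single:
  fixes c :: "'a::field"
  assumes "monom_degree e = d" "2 \<le> d"
  defines "lift \<equiv> \<lambda>m. mpoly_var 1 ^ (m div 2) * mpoly_var 2 ^ (m mod 2)
      * mpoly_var 3 ^ (d - m div 2 - m mod 2) :: (3, 'a) mpoly"
  shows "\<exists>r. homogeneous (d - 2) r \<and>
    single e c = mpoly_const c * lift (2 * lookup e 1 + lookup e 2)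
      + conic_form * r"
proof -
  let ?i = "lookup e 1" and ?j = "lookup e 2" and ?k = "lookup e 3"
  let ?x = "mpoly_var 1 :: (3, 'a) mpoly" and ?y = "mpoly_var 2 :: (3, 'a) mpoly"
    and ?z = "mpoly_var 3 :: (3, 'a) mpoly"
  \<comment> \<open>The number of factors y^2 that are traded for x z.\<close>
  define n where "n = ?j div 2"
  have d: "?i + ?j + ?k = d" using assms(1) by (simp add: monom_degree_def sum_3)
  have j: "?j = 2 * n + ?j mod 2" by (simp add: n_def)
  \<comment> \<open>The cofactor in the factorisation of a difference of \<open>n\<close>-th
    powers.\<close>
  define s where "s = (\<Sum>i<n. (?y ^ 2) ^ (n - Suc i) * (?x * ?z) ^ i)"
  have s: "(?x * ?z) ^ n - (?y ^ 2) ^ n = conic_form * s"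
    unfolding s_def conic_def by (rule power_diff_sumr2)
  have ident: "k * (u * (b * v) * w) = k * (u * w * v * a) + f * (- (k * (u * v * w)) * s)"
    if "a - b = f * s" for a b f s k u v w :: "(3, 'a) mpoly"
    using that by Groebner_Basis.algebra
  define r where "r = - (mpoly_const c * (?x ^ ?i * ?y ^ (?j mod 2) * ?z ^ ?k)) * s"
  have "homogeneous (d - 2) r"
  proof (cases "n = 0")
    case False
    have "homogeneous (2 * (n - 1)) ((?y ^ 2) ^ (n - Suc i) * (?x * ?z) ^ i)" if "i < n" for i
    proof -
      have "homogeneous (1 * 2 * (n - Suc i) + (1 + 1) * i) ((?y ^ 2) ^ (n - Suc i) * (?x * ?z) ^ i)"
        by (intro homogeneous_mult homogeneous_power homogeneous_var)
      moreover have "1 * 2 * (n - Suc i) + (1 + 1) * i = 2 * (n - 1)" using that by auto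
      ultimately show ?thesis by metis
    qed
    then have "homogeneous (2 * (n - 1)) s"
      unfolding s_def by (intro homogeneous_sum) auto
    then have "homogeneous (?i + ?j mod 2 + ?k + 2 * (n - 1)) r"
      unfolding r_def by (intro homogeneous_mult homogeneous_uminus homogeneous_trinomial homogeneous_var) auto
    moreover have "?i + ?j mod 2 + ?k + 2 * (n - 1) = d - 2"
      using d j False by linarith
    ultimately show ?thesis by simp
  qed (simp add: r_def s_def)
  moreover have "single e c = mpoly_const c * (?x ^ ?i * ?y ^ ?j * ?z ^ ?k)"
    unfolding mpoly_single_eq UNIV_3 by (simp add: mult_ac)
  moreover have "?y ^ ?j = (?y ^ 2) ^ n * ?y ^ (?j mod 2)"
    by (metis j power_add power_mult)
  moreover have "lift (2 * ?i + ?j) = ?x ^ ?i * ?z ^ ?k * ?y ^ (?j mod 2) * (?x * ?z) ^ n"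
  proof -
    have 1: "(2 * ?i + ?j) div 2 = ?i + n" "(2 * ?i + ?j) mod 2 = ?j mod 2"
      by (simp_all add: n_def)
    have 2: "d - (?i + n) - ?j mod 2 = ?k + n" using d j by linarith
    show ?thesis
      unfolding lift_def 1 2 by (simp add: power_add power_mult_distrib mult_ac)
  qed
  ultimately have "single e c = mpoly_const c * lift (2 * ?i + ?j) + conic_form * r"
    using ident[OF s] unfolding r_def by (simp only:)
  with \<open>homogeneous (d - 2) r\<close> show ?thesis by blast
qed

text \<open>After reduction to normal form, the coefficient in weight \<open>m\<close> is the sum of
  the coefficients of all monomials of weight \<open>m\<close>, which is also the coefficient of
  \<open>t ^ m\<close> on the conic. If all of them vanish, only the multiple of the conic is
  left.\<close>

lemma conic_dvd:
  fixes p :: "(3, 'a::field) mpoly"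
  assumes "homogeneous d p" "2 \<le> d" "on_conic p = 0"
  obtains r where "homogeneous (d - 2) r" "p = conic_form * r"
proof -
  define lift where "lift = (\<lambda>m. mpoly_var 1 ^ (m div 2) * mpoly_var 2 ^ (m mod 2)
      * mpoly_var 3 ^ (d - m div 2 - m mod 2) :: (3, 'a) mpoly)"
  define w where "w = (\<lambda>e::3 \<Rightarrow>\<^sub>0 nat. 2 * lookup e 1 + lookup e 2)"
  let ?S = "keys p" and ?c = "lookup p"
  have "\<forall>e\<in>?S. \<exists>r. homogeneous (d - 2) r \<and>
      single e (?c e) = mpoly_const (?c e) * lift (w e) + conic_form * r"
    using assms(1,2) conic_normal_form_single[of _ d] unfolding homogeneous_def lift_def w_def by blast
  then obtain r where r: "\<And>e. e \<in> ?S \<Longrightarrow> homogeneous (d - 2) (r e)"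
    "\<And>e. e \<in> ?S \<Longrightarrow> single e (?c e) = mpoly_const (?c e) * lift (w e) + conic_form * r e"
    by metis
  have coeff: "(\<Sum>e\<in>{e \<in> ?S. w e = m}. ?c e) = 0" for m
  proof -
    have "on_conic p = (\<Sum>e\<in>?S. Polynomial.monom (?c e) (w e))"
      by (subst poly_mapping_sum_single) (simp only: on_conic_simps on_conic_single w_def)
    then have "0 = (\<Sum>e\<in>?S. coeff (Polynomial.monom (?c e) (w e)) m)"
      using assms(3) by (metis coeff_0 coeff_sum)
    also have "\<dots> = (\<Sum>e\<in>{e \<in> ?S. w e = m}. ?c e)"
      by (simp add: sum.inter_filter)
    finally show ?thesis by simp
  qed
  have "(\<Sum>e\<in>?S. mpoly_const (?c e) * lift (w e))
      = (\<Sum>m\<in>w ` ?S. \<Sum>e\<in>{e \<in> ?S. w e = m}. mpoly_const (?c e) * lift (w e))"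
    by (rule sum.image_gen) simp
  also have "\<dots> = (\<Sum>m\<in>w ` ?S. mpoly_const (\<Sum>e\<in>{e \<in> ?S. w e = m}. ?c e) * lift m)"
    by (intro sum.cong) (auto simp: coeff_hom.hom_sum[OF coeff_hom_mpoly_const] sum_distrib_right)
  also have "\<dots> = 0" by (simp add: coeff mpoly_const_def)
  finally have 0: "(\<Sum>e\<in>?S. mpoly_const (?c e) * lift (w e)) = 0" .
  have "p = (\<Sum>e\<in>?S. mpoly_const (?c e) * lift (w e) + conic_form * r e)"
    by (subst poly_mapping_sum_single) (auto intro: sum.cong simp: r(2))
  also have "\<dots> = conic_form * (\<Sum>e\<in>?S. r e)"
    by (simp add: sum.distrib 0 sum_distrib_left)
  finally show ?thesis using that[of "\<Sum>e\<in>?S. r e"] r(1) by (auto intro: homogeneous_sum)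
qed

lemma poly_quintic_eq:
  fixes Q :: "'a::comm_ring_1 poly"
  assumes "degree Q = 5" "Polynomial.lead_coeff Q = 1"
  shows "poly Q t = t ^ 5 + coeff Q 4 * t ^ 4 + coeff Q 3 * t ^ 3
    + coeff Q 2 * t ^ 2 + coeff Q 1 * t + coeff Q 0"
proof -
  have "{..5::nat} = {0, 1, 2, 3, 4, 5}" by auto
  then show ?thesis using assms by (simp add: poly_altdef)
qed

lemma cubic_on_conic:
  fixes t :: "'a::idom"
  shows "cubic0 c (t ^ 2) t 1 = t ^ 5 + c 4 * t ^ 4 + c 3 * t ^ 3 + c 2 * t ^ 2 + c 1 * t + c 0"
    and "cubic1 c (t ^ 2) t 1 = t * (t ^ 5 + c 4 * t ^ 4 + c 3 * t ^ 3 + c 2 * t ^ 2 + c 1 * t + c 0)"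
  unfolding cubic0_def cubic1_def by (simp_all add: eval_nat_numeral algebra_simps)

lemma on_conic_values:
  fixes Q :: "'a::idom poly"
  assumes "degree Q = 5" "Polynomial.lead_coeff Q = 1"
  shows "conic (t ^ 2) t 1 = 0"
    and "cubic0 (coeff Q) (t ^ 2) t 1 = poly Q t"
    and "cubic1 (coeff Q) (t ^ 2) t 1 = t * poly Q t"
    and "quintic (coeff Q) (t ^ 2) t 1 = poly Q t ^ 2"
proof -
  note e = poly_quintic_eq[OF assms, of t]
  show 0: "conic (t ^ 2) t 1 = 0" by (simp add: conic_def)
  show 1: "cubic0 (coeff Q) (t ^ 2) t 1 = poly Q t"
    unfolding e by (rule cubic_on_conic)
  show "cubic1 (coeff Q) (t ^ 2) t 1 = t * poly Q t"
    unfolding e by (rule cubic_on_conic)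
  show "quintic (coeff Q) (t ^ 2) t 1 = poly Q t ^ 2"
    using quintic_relation[of 1 "coeff Q" "t ^ 2" t] by (simp add: 0 1)
qed

text \<open>The density argument in one variable that fills in finitely many exceptional
  points.\<close>

lemma infinite_poly_eq:
  fixes p :: "'a::idom poly"
  assumes "infinite (UNIV :: 'a set)" "finite A" "\<And>t. t \<notin> A \<Longrightarrow> poly p t = 0"
  shows "p = 0"
proof (rule ccontr)
  assume "p \<noteq> 0"
  then have "finite {t. poly p t = 0}" by (rule poly_roots_finite)
  then have "finite (A \<union> {t. poly p t = 0})" using assms(2) by simp
  moreover have "A \<union> {t. poly p t = 0} = UNIV" using assms(3) by auto
  ultimately show False using assms(1) by simp
qed

text \<open>Distinct linear factors are coprime: the product over the earlier roots has order 0 at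
  \<open>a\<close>, so the whole order of \<open>p\<close> at \<open>a\<close> is left to the
  cofactor.\<close>

lemma square_factors_dvd:
  fixes p :: "'a::idom poly"
  assumes "finite S" "\<And>a. a \<in> S \<Longrightarrow> [:- a, 1:] ^ n dvd p"
  shows "(\<Prod>a\<in>S. [:- a, 1:]) ^ n dvd p"
  using assms
proof (induction S)
  case (insert a S)
  let ?P = "(\<Prod>a\<in>S. [:- a, 1:]) ^ n"
  obtain g where g: "p = ?P * g" using insert by (meson dvdE insertCI)
  show ?case
  proof (cases "p = 0")
    case False
    then have "g \<noteq> 0" "?P \<noteq> 0" using g by auto
    have "poly ?P a \<noteq> 0"
      using insert.hyps by (auto simp: poly_prod)
    then have "Polynomial.order a ?P = 0" using order_root[of ?P a] by blast
    then have "Polynomial.order a p = Polynomial.order a g"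
      using False by (simp add: g order_mult)
    moreover have "n \<le> Polynomial.order a p"
      using insert.prems[of a] False by (simp add: order_divides)
    ultimately have "[:- a, 1:] ^ n dvd g" using \<open>g \<noteq> 0\<close> by (simp add: order_divides)
    then have "[:- a, 1:] ^ n * ?P dvd g * ?P" by (rule mult_dvd_mono) simp
    then show ?thesis
      unfolding prod.insert[OF insert.hyps] power_mult_distrib g by (simp only: mult.commute)
  qed simp
qed simp

text \<open>The geometry takes place over any infinite field in which the quintic has five distinct
  roots; the ground field and its Galois group enter only later. An infinite field allows polynomial
  identities to be checked on values.\<close>

locale split_quintic =
  fixes Q :: "'a::field poly" and R :: "'a set"
  assumes infinite_field: "infinite (UNIV :: 'a set)"
    and roots: "Q = (\<Prod>a\<in>R. [:- a, 1:])" and card_roots: "card R = 5"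
begin

abbreviation "cf \<equiv> coeff Q"

lemma finite_roots: "finite R"
  using card_roots by (simp add: card_ge_0_finite)

lemma degree_Q: "degree Q = 5"
  unfolding roots by (subst degree_prod_eq_sum_degree) (auto simp: card_roots)

lemma lead_Q: "Polynomial.lead_coeff Q = 1"
  unfolding roots by (simp add: lead_coeff_prod)

lemma Q_neq_0: "Q \<noteq> 0"
  using degree_Q by auto

lemma root_iff: "poly Q t = 0 \<longleftrightarrow> t \<in> R"
  unfolding roots using finite_roots by (auto simp: poly_prod)

lemmas on_conic_value = on_conic_values[OF degree_Q lead_Q]

definition singular_quintics :: "(3, 'a) mpoly set" where
  "singular_quintics = {p. homogeneous 5 p \<and> (\<forall>a\<in>R. vanishes_to_order 2 p (vector [a ^ 2, a, 1]))}"

text \<open>The conic and both cubics vanish at the base points, so products of two of them are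
  singular there. The last form is reached only after multiplication by z, which has the value 1 at
  the base points and can be cancelled.\<close>

lemma standard_basis_singular: "standard_basis Q i \<in> singular_quintics"
proof -
  have "vanishes_to_order 2 (standard_basis Q i) (vector [a ^ 2, a, 1])" if a: "a \<in> R" for a
  proof -
    let ?v = "vector [a ^ 2, a, 1] :: 'a^3"
    have Qa: "poly Q a = 0" using a by (simp add: root_iff)
    have c: "vanishes_to_order 1 conic_form ?v"
      by (rule vanishes_to_order_1) (simp add: eval_id_simps on_conic_value)
    have r0: "vanishes_to_order 1 (cubic0_form Q) ?v"
      by (rule vanishes_to_order_1)
        (simp add: eval_id_simps on_conic_value Qa)
    have r1: "vanishes_to_order 1 (cubic1_form Q) ?v"
      by (rule vanishes_to_order_1)
        (simp add: eval_id_simps on_conic_value Qa)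
    note two = vanishes_to_order_mult[of 1 _ _ 1, unfolded one_add_one]
    note any = vanishes_to_order_mult[OF _ vanishes_to_order_0, of 2, unfolded add_0_right]
    have "vanishes_to_order 2 (mpoly_var 3 * quintic_form Q) ?v"
      unfolding quintic_relation
    proof (intro vanishes_to_order_add vanishes_to_order_diff)
      show "vanishes_to_order 2 (cubic0_form Q ^ 2) ?v"
        using two[OF r0 r0] by (simp only: power2_eq_square[of "cubic0_form Q"])
      have "vanishes_to_order 2 (conic_form * cubic1_form Q * mpoly_var 1) ?v"
        by (rule any[OF two[OF c r1]])
      then show "vanishes_to_order 2 (conic_form * mpoly_var 1 * cubic1_form Q) ?v"
        by (simp add: mult_ac)
      have "vanishes_to_order 2 (conic_form * cubic0_form Q * (mpoly_const (cf 4) * mpoly_var 1)) ?v"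
        by (rule any[OF two[OF c r0]])
      then show "vanishes_to_order 2 (mpoly_const (cf 4) * conic_form * mpoly_var 1 * cubic0_form Q) ?v"
        by (simp add: mult_ac)
    qed
    then have "vanishes_to_order 2 (quintic_form Q) ?v"
      by (rule vanishes_to_order_cancel_var) simp
    moreover have "vanishes_to_order 2 (conic_form ^ 2 * mpoly_var j) ?v" for j
      using any[OF two[OF c c]] by (simp only: power2_eq_square[of conic_form])
    ultimately show ?thesis
      using exhaust_6[of i] two[OF c r0] two[OF c r1]
      by (auto simp: standard_basis_def quintic_system_def)
  qed
  then show ?thesis by (simp add: singular_quintics_def homogeneous_standard_basis)
qed

lemma on_conic_forms:
  "on_conic (conic_form :: (3, 'a) mpoly) = 0" "on_conic (cubic0_form Q) = Q"
  "on_conic (cubic1_form Q) = [:0, 1:] * Q" "on_conic (quintic_form Q) = Q ^ 2"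
proof -
  have eqI: "p = q" if "\<And>t. poly p t = poly q t" for p q :: "'a poly"
    using infinite_poly_eq[OF infinite_field, of "{}" "p - q"] that by simp
  note [simp] = poly_on_conic eval_id_simps on_conic_value
  show "on_conic (conic_form :: (3, 'a) mpoly) = 0" by (rule eqI) simp
  show "on_conic (cubic0_form Q) = Q" by (rule eqI) simp
  show "on_conic (cubic1_form Q) = [:0, 1:] * Q" by (rule eqI) simp
  show "on_conic (quintic_form Q) = Q ^ 2" by (rule eqI) simp
qed

text \<open>On the conic, \<open>p\<close> has degree at most 10 and is divisible by Q^2, so a
  multiple of \<open>quintic_form\<close> corrects it to a multiple of the conic. The cofactor is a
  cubic through the five points and restricts to Q times a polynomial of degree at most 1; after a
  second correction a linear form remains.\<close>

lemma singular_quintic_expand: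
  assumes "p \<in> singular_quintics"
  shows "\<exists>c :: 'a^6. p = lin_comb c (standard_basis Q)"
proof -
  have hom: "homogeneous 5 p" and van: "\<And>a. a \<in> R \<Longrightarrow> vanishes_to_order 2 p (vector [a ^ 2, a, 1])"
    using assms by (auto simp: singular_quintics_def)
  have "(\<Prod>a\<in>R. [:- a, 1:]) ^ 2 dvd on_conic p"
  proof (rule square_factors_dvd[OF finite_roots])
    fix a assume "a \<in> R"
    then show "[:- a, 1:] ^ 2 dvd on_conic p"
      unfolding on_conic_def
    proof (rule vanishes_to_order_dvd[OF van])
      have "\<forall>i. poly (vector [[:0, 0, 1:], [:0, 1:], 1] $ i :: 'a poly) a = (vector [a ^ 2, a, 1] :: 'a^3) $ i"
        by (simp add: forall_3 power2_eq_square)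
      then show "poly (vector [[:0, 0, 1:], [:0, 1:], 1] $ i :: 'a poly) a = (vector [a ^ 2, a, 1] :: 'a^3) $ i"
        for i :: 3 by blast
    qed
  qed
  then obtain g where g: "on_conic p = Q ^ 2 * g" unfolding roots by blast
  have "degree g = 0"
  proof (cases "g = 0")
    case False
    have "degree (on_conic p) = 10 + degree g"
      unfolding g using False Q_neq_0 by (simp add: degree_mult_eq degree_power_eq degree_Q)
    then show ?thesis using degree_on_conic[OF hom] by simp
  qed simp
  then obtain c where c: "g = [:c:]" by (metis degree_eq_zeroE)
  define p' where "p' = p - mpoly_const c * quintic_form Q"
  have "homogeneous 5 p'"
    unfolding p'_def by (intro homogeneous_diff hom homogeneous_const_mult homogeneous_quintic homogeneous_var)
  moreover have "on_conic p' = 0"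
    by (simp add: p'_def on_conic_simps on_conic_forms g c)
  ultimately obtain r where r: "homogeneous 3 r" "p' = conic_form * r"
    using conic_dvd[of 5 p'] by auto
  have r_zero: "poly (on_conic r) a = 0" if a: "a \<in> R" for a
  proof -
    \<comment> \<open>A line through the base point along which the conic equals the parameter, so
      that one of the two factors of the parameter can be cancelled.\<close>
    let ?x = "vector [[:a ^ 2, 1:], [:a:], 1] :: 'a poly^3"
    have "quintic_form Q \<in> singular_quintics"
      using standard_basis_singular[of 5] by (simp add: standard_basis_def quintic_system_def)
    then have "vanishes_to_order 2 (quintic_form Q) (vector [a ^ 2, a, 1])"
      using a by (simp add: singular_quintics_def)
    then have "vanishes_to_order (0 + 2) (mpoly_const c * quintic_form Q) (vector [a ^ 2, a, 1])"
      by (intro vanishes_to_order_mult vanishes_to_order_0)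
    then have "vanishes_to_order 2 (mpoly_const c * quintic_form Q) (vector [a ^ 2, a, 1])"
      by (simp only: add_0)
    then have "vanishes_to_order 2 p' (vector [a ^ 2, a, 1])"
      unfolding p'_def using van[OF a] by (intro vanishes_to_order_diff)
    then have "[:- 0, 1:] ^ 2 dvd mpoly_eval (\<lambda>c. [:c:]) p' ?x"
    proof (rule vanishes_to_order_dvd)
      have "\<forall>i. poly (?x $ i) 0 = (vector [a ^ 2, a, 1] :: 'a^3) $ i" by (simp add: forall_3)
      then show "poly (?x $ i) 0 = (vector [a ^ 2, a, 1] :: 'a^3) $ i" for i by blast
    qed
    also have "mpoly_eval (\<lambda>c. [:c:]) p' ?x = [:0, 1:] * mpoly_eval (\<lambda>c. [:c:]) r ?x"
      unfolding r(2) coeff_hom.eval_mult[OF coeff_hom_pCons] coeff_hom.eval_conic[OF coeff_hom_pCons]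
      by (simp add: mpoly_eval_simps[OF coeff_hom_pCons] conic_def power2_eq_square)
    finally have "[:0, 1:] dvd mpoly_eval (\<lambda>c. [:c:]) r ?x"
      by (simp only: power2_eq_square dvd_mult_cancel_left minus_zero) simp
    then have "poly (mpoly_eval (\<lambda>c. [:c:]) r ?x) 0 = 0"
      by (simp add: poly_eq_0_iff_dvd)
    moreover have "(\<chi> i. poly (?x $ i) 0) = vector [a ^ 2, a, 1]"
      by (simp add: vec_eq_iff forall_3)
    ultimately show ?thesis
      by (simp add: poly_mpoly_eval poly_on_conic)
  qed
  have "(\<Prod>a\<in>R. [:- a, 1:]) ^ 1 dvd on_conic r"
    by (rule square_factors_dvd[OF finite_roots]) (simp add: r_zero poly_eq_0_iff_dvd[symmetric])
  then obtain g' where g': "on_conic r = Q * g'" unfolding roots by auto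
  have "degree g' \<le> 1"
  proof (cases "g' = 0")
    case False
    have "degree (on_conic r) = 5 + degree g'"
      unfolding g' using False Q_neq_0 by (simp add: degree_mult_eq degree_Q)
    then show ?thesis using degree_on_conic[OF r(1)] by simp
  qed simp
  then have "g' = [:coeff g' 0, coeff g' 1:]"
    by (intro poly_eqI) (auto simp: coeff_pCons coeff_eq_0 split: nat.split)
  then obtain b0 b1 where b: "g' = [:b0, b1:]" by blast
  define r' where "r' = r - mpoly_const b0 * cubic0_form Q - mpoly_const b1 * cubic1_form Q"
  have "homogeneous 3 r'"
    unfolding r'_def
    by (intro homogeneous_diff r(1) homogeneous_const_mult homogeneous_cubic0
        homogeneous_cubic1 homogeneous_var)
  moreover have "on_conic r' = 0"
    by (simp add: r'_def on_conic_simps on_conic_forms g' b)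
  ultimately obtain l where l: "homogeneous 1 l" "r' = conic_form * l"
    using conic_dvd[of 3 r'] by auto
  define m where "m = (\<lambda>i. lookup l (single i 1))"
  have l': "l = mpoly_const (m 1) * mpoly_var 1 + mpoly_const (m 2) * mpoly_var 2
      + mpoly_const (m 3) * mpoly_var 3"
    by (subst homogeneous_1_linear[OF l(1)]) (simp add: sum_3 m_def)
  have "p = mpoly_const c * quintic_form Q + conic_form * (mpoly_const b0 * cubic0_form Q
      + mpoly_const b1 * cubic1_form Q + conic_form * l)"
  proof -
    have "p = mpoly_const c * quintic_form Q + conic_form * r"
      using r(2) unfolding p'_def by (simp add: algebra_simps)
    moreover have "r = mpoly_const b0 * cubic0_form Q + mpoly_const b1 * cubic1_form Q + conic_form * l"
      using l(2) unfolding r'_def by (simp add: algebra_simps)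
    ultimately show ?thesis by metis
  qed
  also have "\<dots> = lin_comb (\<chi> i. six (m 1) (m 2) (m 3) b0 b1 c i) (standard_basis Q)"
    unfolding l' sum_6 standard_basis_def quintic_system_def
    by (simp add: algebra_simps power2_eq_square)
  finally show ?thesis by blast
qed

text \<open>The order along the conic separates the coefficients: values on the conic isolate the
  last one, first-order terms the two belonging to the cubics, and points off the conic the
  remaining three.\<close>

lemma standard_basis_independent:
  fixes d :: "'a^6"
  assumes "lin_comb d (standard_basis Q) = 0"
  shows "d = 0"
proof -
  let ?C = conic and ?R0 = "cubic0 cf" and ?R1 = "cubic1 cf" and ?q = "quintic cf"
  have F: "?C x y z ^ 2 * (d $ 0 * x + d $ 1 * y + d $ 2 * z)
      + ?C x y z * (d $ 3 * ?R0 x y z + d $ 4 * ?R1 x y z) + d $ 5 * ?q x y z = 0" for x y z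
  proof -
    have "mpoly_eval id (lin_comb d (standard_basis Q)) (vector [x, y, z]) = 0"
      unfolding assms by (simp add: eval_id_simps)
    then have "(\<Sum>i\<in>UNIV. d $ i * quintic_system cf x y z i) = 0"
      by (simp add: eval_id_simps coeff_hom.eval_standard_basis[OF coeff_hom_id])
    then show ?thesis
      unfolding sum_6 quintic_system_def six_simps by (simp add: algebra_simps)
  qed
  obtain t where t: "t \<notin> R" using infinite_field finite_roots ex_new_if_finite by blast
  obtain u where u: "u \<notin> insert t R" using infinite_field finite_roots ex_new_if_finite
    by (metis finite_insert)
  have d5: "d $ 5 = 0"
    using F[of "t ^ 2" t 1] t by (simp add: on_conic_value root_iff)
  \<comment> \<open>The point (t^2 + s : t : 1) has conic value s. Dividing by s as a polynomial and
    then setting s = 0 reads off the first-order term.\<close>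
  have on: "(d $ 3 + d $ 4 * t) * poly Q t = 0" for t
  proof -
    let ?c = "\<lambda>n. [:cf n:]" and ?x = "[:t ^ 2, 1:]"
    define f where "f = [:0, 1:] * ([:d $ 0:] * ?x + [:d $ 1 * t:] + [:d $ 2:])
      + ([:d $ 3:] * cubic0 ?c ?x [:t:] 1 + [:d $ 4:] * cubic1 ?c ?x [:t:] 1)"
    have poly_f: "poly f s = s * (d $ 0 * (t ^ 2 + s) + d $ 1 * t + d $ 2)
      + (d $ 3 * ?R0 (t ^ 2 + s) t 1 + d $ 4 * ?R1 (t ^ 2 + s) t 1)" for s
      by (simp add: f_def cubic0_def cubic1_def algebra_simps)
    have "poly f s = 0" if "s \<notin> {0}" for s
    proof -
      have "s * poly f s = 0"
        using F[of "t ^ 2 + s" t 1] unfolding d5 poly_f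
        by (simp add: conic_def algebra_simps power2_eq_square)
      then show ?thesis using that by simp
    qed
    then have "f = 0" by (intro infinite_poly_eq[OF infinite_field, of "{0}"]) auto
    then have "poly f 0 = 0" by simp
    then show ?thesis unfolding poly_f by (simp add: on_conic_value algebra_simps)
  qed
  have "d $ 3 + d $ 4 * t = 0" "d $ 3 + d $ 4 * u = 0"
    using on[of t] on[of u] t u by (auto simp: root_iff)
  then have "(d $ 3 + d $ 4 * t) - (d $ 3 + d $ 4 * u) = 0" by simp
  then have "d $ 4 * (t - u) = 0" by (simp add: algebra_simps)
  then have d4: "d $ 4 = 0" using u by auto
  with \<open>d $ 3 + d $ 4 * t = 0\<close> have d3: "d $ 3 = 0" by simp
  have F': "d $ 0 * x + d $ 1 * y + d $ 2 * z = 0" if "?C x y z \<noteq> 0" for x y z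
    using F[of x y z] that by (simp add: d3 d4 d5)
  have d1: "d $ 1 = 0" using F'[of 0 1 0] by (simp add: conic_def)
  obtain w where w: "w \<notin> {0, 1::'a}" using infinite_field ex_new_if_finite
    by (metis finite.emptyI finite.insertI)
  have "d $ 0 + d $ 2 = 0" "d $ 0 * w + d $ 2 = 0"
    using F'[of 1 0 1] F'[of w 0 1] w by (simp_all add: conic_def)
  then have "(d $ 0 * w + d $ 2) - (d $ 0 + d $ 2) = 0" by simp
  then have "d $ 0 * (w - 1) = 0" by (simp add: algebra_simps)
  then have d0: "d $ 0 = 0" using w by auto
  with \<open>d $ 0 + d $ 2 = 0\<close> have d2: "d $ 2 = 0" by simp
  have "\<forall>i. d $ i = 0" unfolding forall_6 using d0 d1 d2 d3 d4 d5 by simp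
  then show ?thesis by (simp add: vec_eq_iff)
qed

lemma standard_basis_inject:
  fixes c d :: "'a^6"
  assumes "lin_comb c (standard_basis Q)
    = lin_comb d (standard_basis Q)"
  shows "c = d"
proof -
  have "lin_comb (c - d) (standard_basis Q) = 0"
    using assms by (simp add: coeff_hom.hom_diff[OF coeff_hom_mpoly_const] left_diff_distrib
      sum_subtractf)
  then show ?thesis using standard_basis_independent by fastforce
qed

lemma standard_basis_unique:
  assumes "p \<in> singular_quintics"
  shows "\<exists>!c :: 'a^6. p = lin_comb c (standard_basis Q)"
proof -
  obtain c :: "'a^6" where c: "p = lin_comb c (standard_basis Q)"
    using singular_quintic_expand[OF assms] by blast
  show ?thesis by (rule ex1I[of _ c]) (use c standard_basis_inject in auto)
qed

end

section \<open>Projective closures\<close>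

text \<open>Closures depend only on the values of forms. As functions, forms undergo a linear change
  of coordinates by plain composition.\<close>

definition form_function :: "nat \<Rightarrow> ('a::comm_ring_1^'n::finite \<Rightarrow> 'a) \<Rightarrow> bool" where
  "form_function d g \<longleftrightarrow> (\<exists>p. homogeneous d p \<and> (\<forall>x. mpoly_eval id p x = g x))"

lemma homogeneous_subst:
  fixes p :: "('n::finite, 'a::comm_ring_1) mpoly" and l :: "('m::finite, 'a) mpoly^'n"
  assumes "homogeneous d p" "\<And>i. homogeneous 1 (l $ i)"
  shows "homogeneous d (mpoly_eval mpoly_const p l)"
  unfolding mpoly_eval_alt
proof (intro homogeneous_sum homogeneous_const_mult)
  fix e assume "e \<in> keys p"
  then have d: "(\<Sum>i\<in>UNIV. lookup e i) = d"
    using assms(1) by (auto simp: homogeneous_def monom_degree_def)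
  have "homogeneous (\<Sum>i\<in>S. lookup e i) (\<Prod>i\<in>S. l $ i ^ lookup e i)"
    if "finite S" for S
    using that
  proof (induction S)
    case empty
    then show ?case using homogeneous_single[of "0 :: 'm \<Rightarrow>\<^sub>0 nat" 0 "1 :: 'a"] by simp
  next
    case (insert i S)
    have "homogeneous (1 * lookup e i) (l $ i ^ lookup e i)"
      by (rule homogeneous_power[OF assms(2)])
    then show ?case using insert by (simp add: homogeneous_mult)
  qed
  from this[OF finite_class.finite_UNIV] show "homogeneous d (eval_monom l e)"
    by (simp add: d eval_monom_def)
qed

lemma form_function_linear:
  fixes A :: "'a::comm_ring_1^'m^'n"
  assumes "form_function d g"
  shows "form_function d (\<lambda>v. g (A *v v))"
proof -
  obtain p where p: "homogeneous d p" "\<And>x. mpoly_eval id p x = g x"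
    using assms unfolding form_function_def by blast
  let ?l = "\<chi> i. \<Sum>j\<in>UNIV. mpoly_const (A $ i $ j) * mpoly_var j"
  have "homogeneous d (mpoly_eval mpoly_const p ?l)"
    by (intro homogeneous_subst[OF p(1)], unfold vec_lambda_beta)
      (intro homogeneous_sum homogeneous_const_mult homogeneous_var)
  moreover have "mpoly_eval id (mpoly_eval mpoly_const p ?l) v = g (A *v v)" for v
  proof -
    have "mpoly_eval id (mpoly_eval mpoly_const p ?l) v
        = mpoly_eval (\<lambda>c. mpoly_eval id (mpoly_const c) v) p (\<chi> i. mpoly_eval id (?l $ i) v)"
      by (rule coeff_hom.hom_eval_compose[OF coeff_hom_mpoly_const, of "\<lambda>q. mpoly_eval id q v"])
        (simp_all only: eval_id_simps)
    also have "\<dots> = mpoly_eval id p (A *v v)"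
      by (simp add: eval_id_simps matrix_vector_mult_def) (simp add: id_def)
    finally show ?thesis by (simp add: p(2))
  qed
  ultimately show ?thesis unfolding form_function_def by blast
qed

lemma proj_point_eq_iff:
  fixes v w :: "'a::field^'n"
  assumes "v \<noteq> 0"
  shows "proj_point v = proj_point w \<longleftrightarrow> (\<exists>c. c \<noteq> 0 \<and> w = c *s v)"
proof
  assume eq: "proj_point v = proj_point w"
  have "w \<in> vec.span {v}" "v \<in> vec.span {w}"
    using eq vec.span_superset[of "{w}"] vec.span_superset[of "{v}"] unfolding proj_point_def by auto
  then obtain c c' where "w = c *s v" "v = c' *s w"
    unfolding vec.span_singleton by blast
  with assms show "\<exists>c. c \<noteq> 0 \<and> w = c *s v" by force
next
  assume "\<exists>c. c \<noteq> 0 \<and> w = c *s v"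
  then obtain c where c: "c \<noteq> 0" "w = c *s v" by blast
  have "k *s v \<in> range (\<lambda>k. k *s w)" for k
    by (rule range_eqI[of _ _ "k / c"]) (use c in \<open>simp add: vector_smult_assoc\<close>)
  moreover have "k *s w \<in> range (\<lambda>k. k *s v)" for k
    by (rule range_eqI[of _ _ "k * c"]) (use c in \<open>simp add: vector_smult_assoc\<close>)
  ultimately show "proj_point v = proj_point w"
    unfolding proj_point_def vec.span_singleton by blast
qed

text \<open>The closure condition on a vector instead of a projective point, which avoids choosing
  representatives.\<close>

definition on_image :: "('m::finite \<Rightarrow> ('n::finite, 'a::field) mpoly) \<Rightarrow> 'a^'m \<Rightarrow> bool" where
  "on_image \<phi> v \<longleftrightarrow> (\<forall>d g. form_function d g \<and> (\<forall>x. (\<chi> i. mpoly_eval id (\<phi> i) x) \<noteq> 0 \<longrightarrow>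
      g (\<chi> i. mpoly_eval id (\<phi> i) x) = 0) \<longrightarrow> g v = 0)"

lemma form_function_scale:
  assumes "form_function d g"
  shows "g (c *s v) = c ^ d * g v"
  using assms homogeneous_eval_scale unfolding form_function_def by metis

text \<open>Whether a form vanishes does not depend on the representative, so it is enough to test
  it at the image vectors themselves.\<close>

lemma proj_point_in_image_iff:
  fixes \<phi> :: "'m::finite \<Rightarrow> ('n::finite, 'a::field) mpoly"
  assumes v: "v \<noteq> 0"
  shows "proj_point v \<in> rational_map_image \<phi> \<longleftrightarrow> on_image \<phi> v"
proof -
  let ?f = "\<lambda>x. (\<chi> i. mpoly_eval id (\<phi> i) x) :: 'a^'m"
  define S where "S = {proj_point (?f x) | x. ?f x \<noteq> 0}"
  have vanish: "(\<forall>y. y \<noteq> 0 \<and> proj_point y \<in> S \<longrightarrow> mpoly_eval id p y = 0)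
      \<longleftrightarrow> (\<forall>x. ?f x \<noteq> 0 \<longrightarrow> mpoly_eval id p (?f x) = 0)" if p: "homogeneous d p" for d p
  proof
    assume "\<forall>y. y \<noteq> 0 \<and> proj_point y \<in> S \<longrightarrow> mpoly_eval id p y = 0"
    then show "\<forall>x. ?f x \<noteq> 0 \<longrightarrow> mpoly_eval id p (?f x) = 0" unfolding S_def by blast
  next
    assume *: "\<forall>x. ?f x \<noteq> 0 \<longrightarrow> mpoly_eval id p (?f x) = 0"
    show "\<forall>y. y \<noteq> 0 \<and> proj_point y \<in> S \<longrightarrow> mpoly_eval id p y = 0"
    proof (intro allI impI, elim conjE)
      fix y assume "y \<noteq> 0" "proj_point y \<in> S"
      then obtain x where x: "?f x \<noteq> 0" "proj_point (?f x) = proj_point y" unfolding S_def by auto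
      then obtain c where "y = c *s ?f x" using proj_point_eq_iff[OF x(1)] by auto
      then show "mpoly_eval id p y = 0"
        using * x(1) homogeneous_eval_scale[OF p] by simp
    qed
  qed
  have closed: "(\<forall>d p. homogeneous d p \<and> (\<forall>y. y \<noteq> 0 \<and> proj_point y \<in> S \<longrightarrow> mpoly_eval id p y = 0)
      \<longrightarrow> mpoly_eval id p w = 0) \<longleftrightarrow> on_image \<phi> w" (is "?L \<longleftrightarrow> _") for w
  proof
    assume L: ?L
    show "on_image \<phi> w"
      unfolding on_image_def
    proof (intro allI impI, elim conjE)
      fix d g assume "form_function d g" and g: "\<forall>x. ?f x \<noteq> 0 \<longrightarrow> g (?f x) = 0"
      then obtain p where p: "homogeneous d p" "\<And>x. mpoly_eval id p x = g x"
        unfolding form_function_def by blast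
      have "\<forall>y. y \<noteq> 0 \<and> proj_point y \<in> S \<longrightarrow> mpoly_eval id p y = 0"
        unfolding vanish[OF p(1)] using g by (simp add: p(2))
      then have "mpoly_eval id p w = 0" using L p(1) by blast
      then show "g w = 0" by (simp add: p(2))
    qed
  next
    assume R: "on_image \<phi> w"
    show ?L
    proof (intro allI impI, elim conjE)
      fix d p assume p: "homogeneous d p"
        and q: "\<forall>y. y \<noteq> 0 \<and> proj_point y \<in> S \<longrightarrow> mpoly_eval id p y = 0"
      have "\<forall>x. ?f x \<noteq> 0 \<longrightarrow> mpoly_eval id p (?f x) = 0"
        by (rule iffD1[OF vanish[OF p] q])
      moreover have "form_function d (mpoly_eval id p)"
        using p unfolding form_function_def by blast
      ultimately show "mpoly_eval id p w = 0"
        using R unfolding on_image_def by blast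
    qed
  qed
  have "proj_point v \<in> rational_map_image \<phi> \<longleftrightarrow>
      (\<exists>w. proj_point v = proj_point w \<and> w \<noteq> 0 \<and> on_image \<phi> w)"
    unfolding rational_map_image_def zariski_closure_def S_def[symmetric] mem_Collect_eq closed ..
  also have "\<dots> \<longleftrightarrow> on_image \<phi> v"
  proof
    assume "\<exists>w. proj_point v = proj_point w \<and> w \<noteq> 0 \<and> on_image \<phi> w"
    then obtain w where w: "proj_point v = proj_point w" "on_image \<phi> w" by blast
    then obtain c where c: "c \<noteq> 0" "w = c *s v" using proj_point_eq_iff[OF v] by blast
    show "on_image \<phi> v"
      unfolding on_image_def
    proof (intro allI impI, elim conjE)
      fix d g assume g: "form_function d g" "\<forall>x. ?f x \<noteq> 0 \<longrightarrow> g (?f x) = 0"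
      then have "g w = 0" using w(2) unfolding on_image_def by blast
      then show "g v = 0" using c form_function_scale[OF g(1), of c v] by simp
    qed
  qed (use v in blast)
  finally show ?thesis .
qed

lemma lines_on_image:
  fixes \<phi> :: "'m::finite \<Rightarrow> ('n::finite, 'a::field) mpoly"
  shows "lines_on (rational_map_image \<phi>)
    = {W. vec.subspace W \<and> vec.dim W = 2 \<and> (\<forall>v\<in>W - {0}. on_image \<phi> v)}"
  unfolding lines_on_def using proj_point_in_image_iff[of _ \<phi>] by auto

text \<open>A form vanishing on the image of \<open>\<phi>\<close> pulls back along \<open>M\<close>
  to one vanishing on the image of \<open>\<psi>\<close>. The left inverse \<open>N\<close> ensures
  that nonzero image vectors stay nonzero.\<close>

lemma on_image_linear_change:
  fixes \<phi> \<psi> :: "'m::finite \<Rightarrow> ('n::finite, 'a::field) mpoly"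
  assumes M: "\<And>i. \<phi> i = lin_comb (M $ i) \<psi>"
    and inv: "N ** M = mat 1"
    and v: "on_image \<psi> v"
  shows "on_image \<phi> (M *v v)"
proof -
  let ?f = "\<lambda>\<phi> x. (\<chi> i. mpoly_eval id (\<phi> i) x) :: 'a^'m"
  have f: "?f \<phi> x = M *v ?f \<psi> x" for x
    by (simp add: M eval_id_simps matrix_vector_mult_def)
  show ?thesis
    unfolding on_image_def
  proof (intro allI impI, elim conjE)
    fix d and g :: "'a^'m \<Rightarrow> 'a"
    assume g: "form_function d g" "\<forall>x. ?f \<phi> x \<noteq> 0 \<longrightarrow> g (?f \<phi> x) = 0"
    have "g (M *v ?f \<psi> x) = 0" if "?f \<psi> x \<noteq> 0" for x
    proof -
      have "M *v ?f \<psi> x \<noteq> 0"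
      proof
        assume "M *v ?f \<psi> x = 0"
        then have "(N ** M) *v ?f \<psi> x = 0"
          by (simp add: matrix_vector_mul_assoc[symmetric] matrix_vector_mult_0_right)
        with that show False by (simp add: inv)
      qed
      then show ?thesis using g(2) by (simp add: f)
    qed
    then show "g (M *v v) = 0"
      using v form_function_linear[OF g(1), of M] unfolding on_image_def by blast
  qed
qed

section \<open>The ten lines\<close>

text \<open>On the conic, both the left side and x \<open>quintic\<close> become t^2 Q(t)^2, so they
  differ by a multiple of the conic. Multiplied by the square of the conic, this becomes the second
  quadratic equation of the surface.\<close>

lemma quintic_relation':
  fixes x y z :: "'r::idom"
  shows "cubic1 c x y z ^ 2 = x * quintic c x y z + conic x y z *
    ((c 3 * x + c 1 * z) * cubic1 c x y z - (c 2 * x + c 0 * z) * cubic0 c x y z)"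
  unfolding quintic_def cubic0_def cubic1_def conic_def Let_def by Groebner_Basis.algebra

lemma scale_forms:
  fixes k x y z :: "'r::idom"
  shows "conic (k * x) (k * y) (k * z) = k ^ 2 * conic x y z"
    and "cubic0 c (k * x) (k * y) (k * z) = k ^ 3 * cubic0 c x y z"
    and "cubic1 c (k * x) (k * y) (k * z) = k ^ 3 * cubic1 c x y z"
    and "quintic c (k * x) (k * y) (k * z) = k ^ 5 * quintic c x y z"
proof -
  show 1: "conic (k * x) (k * y) (k * z) = k ^ 2 * conic x y z"
    unfolding conic_def by Groebner_Basis.algebra
  show "cubic0 c (k * x) (k * y) (k * z) = k ^ 3 * cubic0 c x y z"
    unfolding cubic0_def by Groebner_Basis.algebra
  show "cubic1 c (k * x) (k * y) (k * z) = k ^ 3 * cubic1 c x y z"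
    unfolding cubic1_def by Groebner_Basis.algebra
  show "quintic c (k * x) (k * y) (k * z) = k ^ 5 * quintic c x y z"
    unfolding quintic_def Let_def conic_def by Groebner_Basis.algebra
qed

text \<open>Coefficients of the equations of the line lying over \<open>x = e\<^sub>1 y - e\<^sub>2 z\<close>: on that line of the
  plane the conic divides the cubics and its square divides the quintic, with linear quotients.\<close>

definition quot0 :: "(nat \<Rightarrow> 'r::comm_ring_1) \<Rightarrow> 'r \<Rightarrow> 'r \<Rightarrow> 'r \<Rightarrow> 'r \<Rightarrow> 'r" where
  "quot0 c e1 e2 y z = - (e1 ^ 2) * y + e1 * (2 * e2 - c 3 - e1 * c 4 - e1 ^ 2) * z"

definition quot1 :: "(nat \<Rightarrow> 'r::comm_ring_1) \<Rightarrow> 'r \<Rightarrow> 'r \<Rightarrow> 'r \<Rightarrow> 'r \<Rightarrow> 'r" where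
  "quot1 c e1 e2 y z = - (e1 ^ 3 + c 4 * e1 ^ 2) * y + (e2 ^ 2 - c 3 * e2 + c 1) * z"

definition quot2 :: "(nat \<Rightarrow> 'r::comm_ring_1) \<Rightarrow> 'r \<Rightarrow> 'r \<Rightarrow> 'r \<Rightarrow> 'r \<Rightarrow> 'r" where
  "quot2 c e1 e2 y z =
     (let g = c 4 * e1 ^ 2 + c 3 * e1; h = c 3 * e1 ^ 2 + c 2 * e1;
          u = e1 * (2 * e2 - c 3 - e1 * c 4 - e1 ^ 2)
      in (2 * e1 ^ 2 * g + e1 ^ 5 - e1 * (h - c 4 * g)) * y
       + (u ^ 2 - e2 ^ 3 + c 3 * e2 ^ 2 - c 1 * e2 + c 4 * e2 * u) * z)"

text \<open>The assumptions say that t^2 - e1 t + e2 divides Q with cofactor t^3 + c2 t^2 + c1 t +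
  c0. The homogenised quadratic \<open>n\<close> is, up to sign, the conic on the line x = e1 y - e2
  z.\<close>

lemma quot_identities:
  fixes e1 e2 y z c0 c1 c2 :: "'r::idom"
  assumes "c 4 = c2 - e1" "c 3 = c1 - e1 * c2 + e2" "c 2 = c0 - e1 * c1 + e2 * c2"
    "c 1 = e2 * c1 - e1 * c0" "c 0 = e2 * c0"
  defines "n \<equiv> y ^ 2 - e1 * y * z + e2 * z ^ 2"
  shows "cubic0 c (e1 * y - e2 * z) y z = - n * quot0 c e1 e2 y z"
    and "cubic1 c (e1 * y - e2 * z) y z = - n * quot1 c e1 e2 y z"
    and "quintic c (e1 * y - e2 * z) y z = n ^ 2 * quot2 c e1 e2 y z"
  unfolding n_def quot0_def quot1_def quot2_def cubic0_def cubic1_def quintic_def conic_def Let_def assms(1-5)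
  by Groebner_Basis.algebra+

lemma conic_on_line:
  fixes e1 e2 y z :: "'r::idom"
  shows "conic (e1 * y - e2 * z) y z = - (y ^ 2 - e1 * y * z + e2 * z ^ 2)"
  unfolding conic_def by Groebner_Basis.algebra

text \<open>Division of Q by t^2 - e1 t + e2 with remainder: \<open>k2\<close>, \<open>k1\<close>,
  \<open>k0\<close> are the lower coefficients of the monic cubic quotient, and the factor next to
  z^2 is the homogenised remainder. A line on the surface will force this remainder to
  vanish.\<close>

lemma cubic0_on_line:
  fixes c :: "nat \<Rightarrow> 'r::idom" and e1 e2 y z :: "'r::idom"
  defines "k2 \<equiv> c 4 + e1"
  defines "k1 \<equiv> c 3 - e2 + e1 * k2"
  defines "k0 \<equiv> c 2 - e2 * k2 + e1 * k1"
  shows "cubic0 c (e1 * y - e2 * z) y z = - (y ^ 2 - e1 * y * z + e2 * z ^ 2) * quot0 c e1 e2 y z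
    + z ^ 2 * ((c 1 - e2 * k1 + e1 * k0) * y + (c 0 - e2 * k0) * z)"
  unfolding cubic0_def quot0_def k0_def k1_def k2_def by Groebner_Basis.algebra

text \<open>The parameters reappear as the coordinates 1 and 2, so a vector of the line determines
  them.\<close>

definition line_vec :: "(nat \<Rightarrow> 'a::comm_ring_1) \<Rightarrow> 'a \<Rightarrow> 'a \<Rightarrow> 'a \<Rightarrow> 'a \<Rightarrow> 'a^6" where
  "line_vec c e1 e2 y z = (\<chi> i. six (e1 * y - e2 * z) y z
     (quot0 c e1 e2 y z) (quot1 c e1 e2 y z) (quot2 c e1 e2 y z) i)"

definition surface_line :: "(nat \<Rightarrow> 'a::comm_ring_1) \<Rightarrow> 'a \<Rightarrow> 'a \<Rightarrow> ('a^6) set" where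
  "surface_line c e1 e2 = {line_vec c e1 e2 y z | y z. True}"

lemma line_vec_nth [simp]:
  "line_vec c e1 e2 y z $ 0 = e1 * y - e2 * z" "line_vec c e1 e2 y z $ 1 = y"
  "line_vec c e1 e2 y z $ 2 = z" "line_vec c e1 e2 y z $ 3 = quot0 c e1 e2 y z"
  "line_vec c e1 e2 y z $ 4 = quot1 c e1 e2 y z" "line_vec c e1 e2 y z $ 5 = quot2 c e1 e2 y z"
  by (simp_all add: line_vec_def)

lemma vec6_eq_iff: "v = (w :: 'a^6) \<longleftrightarrow> v $ 0 = w $ 0 \<and> v $ 1 = w $ 1 \<and> v $ 2 = w $ 2
    \<and> v $ 3 = w $ 3 \<and> v $ 4 = w $ 4 \<and> v $ 5 = w $ 5"
  by (simp only: vec_eq_iff forall_6)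

lemma quot_linear:
  "quot0 c e1 e2 y z = y * quot0 c e1 e2 1 0 + z * quot0 c e1 e2 0 1"
  "quot1 c e1 e2 y z = y * quot1 c e1 e2 1 0 + z * quot1 c e1 e2 0 1"
  "quot2 c e1 e2 y z = y * quot2 c e1 e2 1 0 + z * quot2 c e1 e2 0 1"
  by (simp_all add: quot0_def quot1_def quot2_def Let_def mult_ac)

lemma line_vec_linear:
  "line_vec c e1 e2 y z = y *s line_vec c e1 e2 1 0 + z *s line_vec c e1 e2 0 1"
  unfolding vec6_eq_iff vector_add_component vector_smult_component line_vec_nth
  using quot_linear[of c e1 e2 y z] by (simp add: mult_ac)

lemma surface_line_span:
  "surface_line c e1 e2 = vec.span {line_vec c e1 e2 1 0, line_vec c e1 e2 (0::'a::field) 1}"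
proof -
  let ?p = "line_vec c e1 e2 1 0" and ?q = "line_vec c e1 e2 0 1"
  show ?thesis
  proof (intro equalityI subsetI)
    fix v assume "v \<in> surface_line c e1 e2"
    then obtain y z where v: "v = line_vec c e1 e2 y z" unfolding surface_line_def by blast
    have "y *s ?p + z *s ?q \<in> vec.span {?p, ?q}"
      by (intro vec.span_add vec.span_scale vec.span_base) auto
    then show "v \<in> vec.span {?p, ?q}" unfolding v by (subst line_vec_linear)
  next
    fix v assume "v \<in> vec.span {?p, ?q}"
    then obtain k where "v - k *s ?p \<in> vec.span {?q}" unfolding vec.span_insert by blast
    then obtain m where "v - k *s ?p = m *s ?q" unfolding vec.span_singleton by blast
    then have "v = k *s ?p + m *s ?q" by (simp add: diff_eq_eq add.commute)
    then have "v = line_vec c e1 e2 k m" by (subst line_vec_linear)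
    then show "v \<in> surface_line c e1 e2" unfolding surface_line_def by blast
  qed
qed

lemma surface_line_dim:
  "vec.subspace (surface_line c e1 (e2::'a::field))" "vec.dim (surface_line c e1 e2) = 2"
proof -
  let ?v = "line_vec c e1 e2 1 0" and ?w = "line_vec c e1 e2 0 1"
  show "vec.subspace (surface_line c e1 e2)" unfolding surface_line_span by (rule vec.subspace_span)
  have "?w \<noteq> 0" by (auto simp: vec6_eq_iff)
  moreover have "?v \<notin> vec.span {?w}"
    unfolding vec.span_singleton by (auto simp: vec6_eq_iff)
  moreover have "?v \<noteq> ?w" by (auto simp: vec6_eq_iff)
  ultimately have "vec.independent {?v, ?w}" "card {?v, ?w} = 2"
    by (auto simp: vec.independent_insert)
  then show "vec.dim (surface_line c e1 e2) = 2"
    unfolding surface_line_span vec.dim_span by (simp add: vec.dim_eq_card_independent)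
qed

section \<open>Equations of the surface, and ten lines contained in it\<close>

lemma on_imageD:
  assumes "on_image \<phi> v" "homogeneous d p"
    and "\<And>x. mpoly_eval id p (\<chi> i. mpoly_eval id (\<phi> i) x) = 0"
  shows "mpoly_eval id p v = 0"
  using assms unfolding on_image_def form_function_def by blast

lemma quadratic_product_coeffs:
  fixes c0 c1 c2 e1 e2 :: "'a::comm_ring_1"
  defines "p \<equiv> [:e2, - e1, 1:] * [:c0, c1, c2, 1:]"
  shows "coeff p 4 = c2 - e1" "coeff p 3 = c1 - e1 * c2 + e2"
    "coeff p 2 = c0 - e1 * c1 + e2 * c2" "coeff p 1 = e2 * c1 - e1 * c0"
    "coeff p 0 = e2 * c0" "coeff p 5 = 1"
  unfolding p_def by (simp_all add: eval_nat_numeral algebra_simps)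

context split_quintic
begin

abbreviation std_point :: "'a^3 \<Rightarrow> 'a^6" where
  "std_point x \<equiv> (\<chi> i. mpoly_eval id (standard_basis Q i) x)"

lemma std_point_nth:
  "std_point x $ i = quintic_system cf (x $ 1) (x $ 2) (x $ 3) i"
  by (simp add: coeff_hom.eval_standard_basis[OF coeff_hom_id])

text \<open>Each relation is a form in the six coordinates that vanishes at all image points, hence
  on the closure. The quadratic ones give information where the conic vanishes and the first three
  say little.\<close>

lemma surface_relations:
  assumes "on_image (standard_basis Q) v"
  shows "v $ 3 * conic (v $ 0) (v $ 1) (v $ 2) = cubic0 cf (v $ 0) (v $ 1) (v $ 2)"
    and "v $ 4 * conic (v $ 0) (v $ 1) (v $ 2) = cubic1 cf (v $ 0) (v $ 1) (v $ 2)"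
    and "v $ 5 * conic (v $ 0) (v $ 1) (v $ 2) ^ 2 = quintic cf (v $ 0) (v $ 1) (v $ 2)"
    and "v $ 3 ^ 2 = v $ 2 * v $ 5 - v $ 0 * v $ 4 + cf 4 * v $ 0 * v $ 3"
    and "v $ 4 ^ 2 = v $ 0 * v $ 5 + (cf 3 * v $ 0 + cf 1 * v $ 2) * v $ 4
      - (cf 2 * v $ 0 + cf 0 * v $ 2) * v $ 3"
proof -
  let ?x = "\<lambda>i. mpoly_var i :: (6, 'a) mpoly" and ?c = "\<lambda>n. mpoly_const (cf n) :: (6, 'a) mpoly"
  let ?C = "conic (?x 0) (?x 1) (?x 2)" and ?q = "quintic ?c (?x 0) (?x 1) (?x 2)"
    and ?r = "cubic0 ?c (?x 0) (?x 1) (?x 2)" and ?s = "cubic1 ?c (?x 0) (?x 1) (?x 2)"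
  note D = on_imageD[OF assms] and ev = eval_id_simps std_point_nth quintic_system_def six_simps id_apply
  note hom = homogeneous_diff homogeneous_add homogeneous_mult homogeneous_var homogeneous_conic
    homogeneous_cubic0 homogeneous_cubic1 homogeneous_quintic homogeneous_const_mult
  have n: "(1::nat) + 2 = 3" "(1::nat) + (2 + 2) = 5" by simp_all
  have "mpoly_eval id (?x 3 * ?C - ?r) v = 0"
  proof (rule D[of 3])
    have "homogeneous (1 + 2) (?x 3 * ?C)" by (intro hom)
    then have "homogeneous 3 (?x 3 * ?C)" by (simp only: n)
    then show "homogeneous 3 (?x 3 * ?C - ?r)"
      by (intro hom)
  qed (simp only: ev scale_forms, simp add: eval_nat_numeral mult_ac)
  then show "v $ 3 * conic (v $ 0) (v $ 1) (v $ 2) = cubic0 cf (v $ 0) (v $ 1) (v $ 2)"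
    unfolding ev by simp
  have "mpoly_eval id (?x 4 * ?C - ?s) v = 0"
  proof (rule D[of 3])
    have "homogeneous (1 + 2) (?x 4 * ?C)" by (intro hom)
    then have "homogeneous 3 (?x 4 * ?C)" by (simp only: n)
    then show "homogeneous 3 (?x 4 * ?C - ?s)"
      by (intro hom)
  qed (simp only: ev scale_forms, simp add: eval_nat_numeral mult_ac)
  then show "v $ 4 * conic (v $ 0) (v $ 1) (v $ 2) = cubic1 cf (v $ 0) (v $ 1) (v $ 2)"
    unfolding ev by simp
  have "mpoly_eval id (?x 5 * (?C * ?C)
      - ?q) v = 0"
  proof (rule D[of 5])
    have "homogeneous (1 + (2 + 2)) (?x 5 * (?C * ?C))"
      by (intro hom)
    then have "homogeneous 5 (?x 5 * (?C * ?C))" by (simp only: n)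
    then show "homogeneous 5 (?x 5 * (?C * ?C)
        - ?q)"
      by (intro hom)
  qed (simp only: ev scale_forms, simp add: eval_nat_numeral mult_ac)
  then show "v $ 5 * conic (v $ 0) (v $ 1) (v $ 2) ^ 2 = quintic cf (v $ 0) (v $ 1) (v $ 2)"
    unfolding ev by (simp add: power2_eq_square)
  \<comment> \<open>\<open>quintic_relation\<close> multiplied by the square of the conic, in terms
    of the coordinates of an image point.\<close>
  have i1: "C * r0 * (C * r0) - (C ^ 2 * z * q - C ^ 2 * x * (C * r1) + a * (C ^ 2 * x * (C * r0))) = 0"
    if "z * q = r0 ^ 2 + C * x * r1 - a * C * x * r0" for C r0 r1 q x z a :: 'a
    using that by Groebner_Basis.algebra
  have "mpoly_eval id (?x 3 * ?x 3 - (?x 2 * ?x 5 - ?x 0 * ?x 4 + ?c 4 * (?x 0 * ?x 3))) v = 0"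
  proof (rule D[of "1 + 1"])
    show "homogeneous (1 + 1) (?x 3 * ?x 3 - (?x 2 * ?x 5 - ?x 0 * ?x 4 + ?c 4 * (?x 0 * ?x 3)))"
      by (intro hom)
  qed (simp only: ev, rule i1, rule quintic_relation)
  then show "v $ 3 ^ 2 = v $ 2 * v $ 5 - v $ 0 * v $ 4 + cf 4 * v $ 0 * v $ 3"
    unfolding ev by (simp add: power2_eq_square mult.assoc)
  have i2: "C * r1 * (C * r1) - (C ^ 2 * x * q + (a3 * (C ^ 2 * x) + a1 * (C ^ 2 * z)) * (C * r1)
      - (a2 * (C ^ 2 * x) + a0 * (C ^ 2 * z)) * (C * r0)) = 0"
    if "r1 ^ 2 = x * q + C * ((a3 * x + a1 * z) * r1 - (a2 * x + a0 * z) * r0)"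
    for C r0 r1 q x z a0 a1 a2 a3 :: 'a
    using that by Groebner_Basis.algebra
  have "mpoly_eval id (?x 4 * ?x 4 - (?x 0 * ?x 5 + (?c 3 * ?x 0 + ?c 1 * ?x 2) * ?x 4
      - (?c 2 * ?x 0 + ?c 0 * ?x 2) * ?x 3)) v = 0"
  proof (rule D[of "1 + 1"])
    show "homogeneous (1 + 1) (?x 4 * ?x 4 - (?x 0 * ?x 5 + (?c 3 * ?x 0 + ?c 1 * ?x 2) * ?x 4
      - (?c 2 * ?x 0 + ?c 0 * ?x 2) * ?x 3))"
      by (intro hom)
  qed (simp only: ev, rule i2, rule quintic_relation')
  then show "v $ 4 ^ 2 = v $ 0 * v $ 5 + (cf 3 * v $ 0 + cf 1 * v $ 2) * v $ 4
      - (cf 2 * v $ 0 + cf 0 * v $ 2) * v $ 3"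
    unfolding ev by (simp add: power2_eq_square)
qed

lemma pair_factor:
  assumes "a \<in> R" "b \<in> R" "a \<noteq> b"
  obtains c0 c1 c2 where "Q = [:a * b, - (a + b), 1:] * [:c0, c1, c2, 1:]"
proof -
  define G where "G = (\<Prod>r\<in>R - {a, b}. [:- r, 1:])"
  have "degree G = 3"
    unfolding G_def using assms finite_roots card_roots
    by (subst degree_prod_eq_sum_degree) (auto simp: card_Diff_subset)
  moreover have "Polynomial.lead_coeff G = 1"
    unfolding G_def by (simp add: lead_coeff_prod)
  ultimately have "G = [:coeff G 0, coeff G 1, coeff G 2, 1:]"
    by (intro poly_eqI) (auto simp: coeff_pCons coeff_eq_0 eval_nat_numeral split: nat.split)
  moreover have "Q = [:- a, 1:] * ([:- b, 1:] * G)"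
  proof -
    have "(\<Prod>r\<in>R. [:- r, 1:]) = [:- a, 1:] * (\<Prod>r\<in>R - {a}. [:- r, 1:])"
      using assms finite_roots by (intro prod.remove)
    moreover have "(\<Prod>r\<in>R - {a}. [:- r, 1:]) = [:- b, 1:] * (\<Prod>r\<in>R - {a} - {b}. [:- r, 1:])"
      using assms finite_roots by (intro prod.remove) auto
    moreover have "R - {a} - {b} = R - {a, b}" by blast
    ultimately show ?thesis unfolding roots G_def by (simp only:)
  qed
  moreover have "[:- a, 1:] * ([:- b, 1:] * G) = [:a * b, - (a + b), 1:] * G"
  proof -
    have "[:- a, 1:] * [:- b, 1:] = [:a * b, - (a + b), 1:]" by simp
    then show ?thesis by (simp only: mult.assoc[symmetric])
  qed
  ultimately have "Q = [:a * b, - (a + b), 1:]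
      * [:coeff G 0, coeff G 1, coeff G 2, 1:]"
    by (simp only:)
  then show ?thesis by (rule that)
qed

text \<open>The cofactor has degree 3 and takes up at most three of the five roots, so two distinct
  ones are roots of the quadratic.\<close>

lemma quadratic_dvd_roots:
  assumes "[:e2, - e1, 1:] dvd Q"
  obtains a b where "a \<in> R" "b \<in> R" "a \<noteq> b" "e1 = a + b" "e2 = a * b"
proof -
  let ?q = "[:e2, - e1, 1:]"
  obtain g where g: "Q = ?q * g" using assms by blast
  then have "g \<noteq> 0" using Q_neq_0 by auto
  then have "degree Q = 2 + degree g"
    unfolding g by (subst degree_mult_eq) auto
  then have "card {x. poly g x = 0} \<le> 3"
    using card_poly_roots_bound[OF \<open>g \<noteq> 0\<close>] degree_Q by simp
  moreover have sub: "R \<subseteq> {x \<in> R. poly ?q x = 0} \<union> {x. poly g x = 0}"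
  proof
    fix r assume "r \<in> R"
    then have "poly ?q r * poly g r = 0" using root_iff[of r] g by (metis poly_mult)
    with \<open>r \<in> R\<close> show "r \<in> {x \<in> R. poly ?q x = 0} \<union> {x. poly g x = 0}"
      by (simp del: poly_pCons)
  qed
  moreover from sub have "card R \<le> card ({x \<in> R. poly ?q x = 0} \<union> {x. poly g x = 0})"
    using poly_roots_finite[OF \<open>g \<noteq> 0\<close>] finite_roots by (intro card_mono) auto
  then have "card R \<le> card {x \<in> R. poly ?q x = 0} + card {x. poly g x = 0}"
    by (rule order.trans[OF _ card_Un_le])
  ultimately have "2 \<le> card {x \<in> R. poly ?q x = 0}" using card_roots by simp
  then obtain a b where ab: "a \<in> R" "poly ?q a = 0" "b \<in> R" "poly ?q b = 0" "a \<noteq> b"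
    by (auto simp: card_le_Suc_iff numeral_2_eq_2)
  \<comment> \<open>Subtracting the two equations eliminates \<open>e2\<close> and leaves Vieta's
    formula for the sum.\<close>
  have "(a - b) * (a + b - e1) = poly ?q a - poly ?q b" by (simp add: algebra_simps)
  then have e1: "e1 = a + b" using ab by (simp del: poly_pCons)
  moreover have "e2 = a * b" using ab(2) unfolding e1 by (simp add: algebra_simps)
  ultimately show ?thesis using that ab by blast
qed

lemma line_forms:
  assumes "a \<in> R" "b \<in> R" "a \<noteq> b"
  defines "e1 \<equiv> a + b" and "e2 \<equiv> a * b"
  shows "cubic0 cf (e1 * y - e2 * z) y z = - ((y - a * z) * (y - b * z)) * quot0 cf e1 e2 y z"
    and "cubic1 cf (e1 * y - e2 * z) y z = - ((y - a * z) * (y - b * z)) * quot1 cf e1 e2 y z"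
    and "quintic cf (e1 * y - e2 * z) y z = ((y - a * z) * (y - b * z)) ^ 2 * quot2 cf e1 e2 y z"
    and "conic (e1 * y - e2 * z) y z = - ((y - a * z) * (y - b * z))"
proof -
  obtain c0 c1 c2 where Q: "Q = [:e2, - e1, 1:] * [:c0, c1, c2, 1:]"
    using pair_factor[OF assms(1-3)] unfolding e1_def e2_def by blast
  note c = quadratic_product_coeffs[of e2 e1 c0 c1 c2, folded Q]
  have n: "y ^ 2 - e1 * y * z + e2 * z ^ 2 = (y - a * z) * (y - b * z)"
    unfolding e1_def e2_def by Groebner_Basis.algebra
  show "cubic0 cf (e1 * y - e2 * z) y z = - ((y - a * z) * (y - b * z)) * quot0 cf e1 e2 y z"
    "cubic1 cf (e1 * y - e2 * z) y z = - ((y - a * z) * (y - b * z)) * quot1 cf e1 e2 y z"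
    "quintic cf (e1 * y - e2 * z) y z = ((y - a * z) * (y - b * z)) ^ 2 * quot2 cf e1 e2 y z"
    using quot_identities[of cf c2 e1 c1 e2 c0 y z, OF c(1-5)] unfolding n by auto
  show "conic (e1 * y - e2 * z) y z = - ((y - a * z) * (y - b * z))"
    using conic_on_line[of e1 y e2 z] unfolding n .
qed

text \<open>Away from two base points, the line in the plane maps to this line, up to the factor (y
  - a z)^2 (y - b z)^2. At the base points that factor vanishes; there the claim follows by density,
  since a form restricted to the line is a polynomial in one parameter.\<close>

lemma line_vec_on_image:
  assumes R: "a \<in> R" "b \<in> R" "a \<noteq> b"
  defines "v \<equiv> line_vec cf (a + b) (a * b)"
  shows "on_image (standard_basis Q) (v y z)"
proof -
  have generic: "g (v y z) = 0" if yz: "(y - a * z) * (y - b * z) \<noteq> 0"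
    and g: "form_function d g" "\<forall>x. std_point x \<noteq> 0 \<longrightarrow> g (std_point x) = 0" for d g y z
  proof -
    let ?n = "(y - a * z) * (y - b * z)" and ?x = "vector [(a + b) * y - (a * b) * z, y, z] :: 'a^3"
    have pt: "std_point ?x = ?n ^ 2 *s v y z"
      unfolding vec6_eq_iff std_point_nth quintic_system_def six_simps vector_smult_component v_def
        line_vec_nth vector_3 line_forms[OF R]
      by (simp add: power2_eq_square)
    have "v y z \<noteq> 0"
    proof
      assume "v y z = 0"
      then have "y = 0" "z = 0" unfolding v_def vec6_eq_iff line_vec_nth by simp_all
      with yz show False by simp
    qed
    then have "std_point ?x \<noteq> 0" unfolding pt using yz by simp
    then have "g (?n ^ 2 *s v y z) = 0" using g(2) unfolding pt[symmetric] by blast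
    then have "(?n ^ 2) ^ d * g (v y z) = 0"
      using form_function_scale[OF g(1), of "?n ^ 2" "v y z"] by simp
    then show ?thesis using yz by simp
  qed
  show ?thesis
    unfolding on_image_def
  proof (intro allI impI, elim conjE)
    fix d and g :: "'a^6 \<Rightarrow> 'a"
    assume g: "form_function d g" "\<forall>x. std_point x \<noteq> 0 \<longrightarrow> g (std_point x) = 0"
    then obtain p where p: "\<And>w. mpoly_eval id p w = g w" unfolding form_function_def by blast
    \<comment> \<open>The form along the line through \<open>v y z\<close> in the direction
      \<open>v 1 0\<close>; at most two parameters are not covered by
      \<open>generic\<close>.\<close>
    define f where "f = mpoly_eval (\<lambda>c. [:c:]) p (\<chi> i. [:v y z $ i, v 1 0 $ i:])"
    have f: "poly f t = g (v (y + t) z)" for t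
    proof -
      have "(\<chi> i. poly ((\<chi> i. [:v y z $ i, v 1 0 $ i:]) $ i) t) = v y z + t *s v 1 0"
        by (simp add: vec_eq_iff)
      also have "\<dots> = v (y + t) z"
        unfolding v_def line_vec_linear[of cf _ _ y z] line_vec_linear[of cf _ _ "y + t" z]
        by (simp add: vec.scale_left_distrib)
      finally show ?thesis unfolding f_def poly_mpoly_eval p by simp
    qed
    have "poly f t = 0" if "t \<notin> {a * z - y, b * z - y}" for t
    proof -
      have eq: "t = c - y" if "y + t = c" for c using that by auto
      have "y + t \<noteq> a * z" "y + t \<noteq> b * z" using that eq by blast+
      then show ?thesis unfolding f by (intro generic[OF _ g]) simp
    qed
    then have "f = 0" by (intro infinite_poly_eq[OF infinite_field, of "{a * z - y, b * z - y}"]) auto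
    then show "g (v y z) = 0" using f[of 0] by simp
  qed
qed

end

section \<open>Every line of the surface lies over a line through two base points\<close>

lemma subspace_dim_2_not_multiple:
  fixes W :: "('a::field^'n) set"
  assumes "vec.dim W = 2"
  obtains w where "w \<in> W" "\<And>k. w \<noteq> k *s v"
proof -
  have "\<not> W \<subseteq> vec.span {v}"
  proof
    assume "W \<subseteq> vec.span {v}"
    then have "vec.dim W \<le> card {v}" by (intro vec.dim_le_card) auto
    then show False using assms by simp
  qed
  then show ?thesis using that unfolding vec.span_singleton by blast
qed

context split_quintic
begin

text \<open>For z = 0 the conic is -y^2, and then \<open>cubic1\<close> is x^3, so the first three
  coordinates vanish; the quadratic relations then annihilate the next two. What remains is the
  point (0 : ... : 0 : 1), to which the conic is contracted.\<close>

lemma on_image_at_infinity: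
  assumes v: "on_image (standard_basis Q) v" and "conic (v $ 0) (v $ 1) (v $ 2) = 0" "v $ 2 = 0"
  shows "v $ 0 = 0" "v $ 1 = 0" "v $ 3 = 0" "v $ 4 = 0"
proof -
  show 1: "v $ 1 = 0" using assms(2,3) by (simp add: conic_def)
  have "cubic1 cf (v $ 0) (v $ 1) (v $ 2) = 0" using surface_relations(2)[OF v] assms(2) by simp
  then show 0: "v $ 0 = 0" using 1 assms(3) by (simp add: cubic1_def)
  show "v $ 3 = 0" using surface_relations(4)[OF v] 0 1 assms(3) by simp
  show "v $ 4 = 0" using surface_relations(5)[OF v] 0 1 assms(3) by simp
qed

text \<open>The coordinates y and z parametrise \<open>W\<close>, because a vector of
  \<open>W\<close> with z = 0 and vanishing conic is zero. Along this parametrisation, the relation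
  for coordinate 3 becomes an identity of polynomials in y that makes a quadratic divide Q. The last
  three coordinates are then forced at points off the conic, and by linearity everywhere.\<close>

lemma line_classification:
  assumes sub: "vec.subspace W" and dim: "vec.dim W = 2"
    and on: "\<And>v. v \<in> W \<Longrightarrow> v \<noteq> 0 \<Longrightarrow> on_image (standard_basis Q) v"
  obtains a b where "a \<in> R" "b \<in> R" "a \<noteq> b" "W = surface_line cf (a + b) (a * b)"
proof -
  have comb: "k *s v + m *s w \<in> W" if "v \<in> W" "w \<in> W" for k m v w
    using that sub by (intro vec.subspace_add vec.subspace_scale)
  \<comment> \<open>The point to which the conic is contracted lies on no line: adding it to another
    vector \<open>w\<close> changes only the last coordinate, and comparing the relations before and
    after makes z and the conic vanish at \<open>w\<close>.\<close>
  have no_vertex: "v $ 5 = 0" if v: "v \<in> W" "v $ 0 = 0" "v $ 1 = 0" "v $ 2 = 0" "v $ 3 = 0" "v $ 4 = 0" for v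
  proof (rule ccontr)
    assume v5: "v $ 5 \<noteq> 0"
    obtain w where w: "w \<in> W" "\<And>k. w \<noteq> k *s v" using subspace_dim_2_not_multiple[OF dim] by blast
    define w' where "w' = w + v"
    have "w \<noteq> 0" "w' \<noteq> 0"
      using w(2)[of 0] w(2)[of "- 1"] by (auto simp: w'_def add_eq_0_iff2)
    moreover have "w' \<in> W" using comb[OF w(1) v(1), of 1 1] by (simp add: w'_def)
    ultimately have i: "on_image (standard_basis Q) w" and i': "on_image (standard_basis Q) w'"
      using on w(1) by auto
    have nth: "w' $ 0 = w $ 0" "w' $ 1 = w $ 1" "w' $ 2 = w $ 2" "w' $ 3 = w $ 3" "w' $ 4 = w $ 4"
      "w' $ 5 = w $ 5 + v $ 5"
      using v by (simp_all add: w'_def)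
    have "v $ 5 * conic (w $ 0) (w $ 1) (w $ 2) ^ 2 = 0"
      using surface_relations(3)[OF i] surface_relations(3)[OF i'] unfolding nth
      by (simp add: algebra_simps)
    then have C: "conic (w $ 0) (w $ 1) (w $ 2) = 0" using v5 by simp
    have "w $ 2 * v $ 5 = 0"
      using surface_relations(4)[OF i] surface_relations(4)[OF i'] unfolding nth
      by (simp add: algebra_simps)
    then have "w $ 2 = 0" using v5 by simp
    note z = on_image_at_infinity[OF i C this] this
    have "w = (w $ 5 / v $ 5) *s v"
      unfolding vec6_eq_iff using v v5 z by simp
    with w(2) show False by blast
  qed
  have zero: "v = 0" if "v \<in> W" "conic (v $ 0) (v $ 1) (v $ 2) = 0" "v $ 2 = 0" for v
  proof (rule ccontr)
    assume "v \<noteq> 0"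
    then have "on_image (standard_basis Q) v" using on that(1) by blast
    note z = on_image_at_infinity[OF this that(2,3)]
    moreover have "v $ 5 = 0" using no_vertex[OF that(1)] z that(3) by blast
    ultimately have "v = 0" unfolding vec6_eq_iff using that(3) by simp
    with \<open>v \<noteq> 0\<close> show False ..
  qed
  obtain p where p: "p \<in> W" "p \<noteq> 0" "p $ 2 = 0"
  proof -
    obtain u where u: "u \<in> W" "\<And>k. u \<noteq> k *s 0" using subspace_dim_2_not_multiple[OF dim] by blast
    obtain w where w: "w \<in> W" "\<And>k. w \<noteq> k *s u" using subspace_dim_2_not_multiple[OF dim] by blast
    show thesis
    proof (cases "u $ 2 = 0")
      case True
      then show ?thesis using u(2)[of 0] by (intro that[OF u(1)]) auto
    next
      case False
      have "1 *s w + (- (w $ 2 / u $ 2)) *s u \<in> W" by (rule comb[OF w(1) u(1)])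
      moreover have "1 *s w + (- (w $ 2 / u $ 2)) *s u \<noteq> 0"
        using w(2)[of "w $ 2 / u $ 2"] by (simp add: vector_sneg_minus1[symmetric] add_eq_0_iff2 vec.scale_minus_left)
      moreover have "(1 *s w + (- (w $ 2 / u $ 2)) *s u) $ 2 = 0" using False by simp
      ultimately show ?thesis by (rule that)
    qed
  qed
  have p1: "p $ 1 \<noteq> 0" using zero[OF p(1)] p(2,3) by (auto simp: conic_def)
  define w2 where "w2 = (1 / p $ 1) *s p"
  have w2: "w2 \<in> W" "w2 $ 1 = 1" "w2 $ 2 = 0"
    using p p1 sub by (auto simp: w2_def intro: vec.subspace_scale)
  obtain u where u: "u \<in> W" "\<And>k. u \<noteq> k *s w2" using subspace_dim_2_not_multiple[OF dim] by blast
  define u' where "u' = 1 *s u + (- u $ 1) *s w2"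
  have u': "u' \<in> W" "u' $ 1 = 0" "u' $ 2 = u $ 2"
    using comb[OF u(1) w2(1), of 1 "- u $ 1"] w2 unfolding u'_def by simp_all
  have "u' \<noteq> 0" using u(2)[of "u $ 1"]
    unfolding u'_def by (simp add: vec.scale_minus_left)
  then have u2: "u' $ 2 \<noteq> 0" using zero[OF u'(1)] u'(2) by (auto simp: conic_def)
  define w1 where "w1 = (1 / u' $ 2) *s u'"
  have w1: "w1 \<in> W" "w1 $ 1 = 0" "w1 $ 2 = 1"
    using u' u2 sub by (auto simp: w1_def intro: vec.subspace_scale)
  \<comment> \<open>The basis \<open>w2\<close>, \<open>w1\<close> is normalised to (y, z) = (1, 0)
    and (0, 1), so the first coordinates yield the equation x = e1 y - e2 z of the projected
    line.\<close>
  define e1 e2 where "e1 = w2 $ 0" and "e2 = - (w1 $ 0)"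
  define pt where "pt y z = y *s w2 + z *s w1" for y z
  have pt: "pt y z \<in> W" "pt y z $ 0 = e1 * y - e2 * z" "pt y z $ 1 = y" "pt y z $ 2 = z"
    "pt y z $ 3 = y * w2 $ 3 + z * w1 $ 3" "pt y z $ 4 = y * w2 $ 4 + z * w1 $ 4"
    "pt y z $ 5 = y * w2 $ 5 + z * w1 $ 5" for y z
    using comb[OF w2(1) w1(1)] w1 w2 by (auto simp: pt_def e1_def e2_def mult.commute)
  have all: "W = {pt y z | y z. True}"
  proof
    show "{pt y z | y z. True} \<subseteq> W" using pt(1) by auto
    show "W \<subseteq> {pt y z | y z. True}"
    proof
      fix v assume v: "v \<in> W"
      have "1 *s v + (- 1) *s pt (v $ 1) (v $ 2) \<in> W" by (rule comb[OF v pt(1)])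
      then have "1 *s v + (- 1) *s pt (v $ 1) (v $ 2) = 0"
        by (rule zero) (simp_all add: pt(3,4) conic_def)
      then have "v = pt (v $ 1) (v $ 2)" by (simp add: vec.scale_minus_left)
      then show "v \<in> {pt y z | y z. True}" by blast
    qed
  qed
  have on_pt: "on_image (standard_basis Q) (pt y z)" if "y \<noteq> 0 \<or> z \<noteq> 0" for y z
  proof (rule on[OF pt(1)])
    show "pt y z \<noteq> 0" using that pt(3,4)[of y z] by auto
  qed
  define k2 where "k2 = cf 4 + e1"
  define k1 where "k1 = cf 3 - e2 + e1 * k2"
  define k0 where "k0 = cf 2 - e2 * k2 + e1 * k1"
  define r1 where "r1 = cf 1 - e2 * k1 + e1 * k0"
  define r0 where "r0 = cf 0 - e2 * k0"
  \<comment> \<open>The deviation of coordinate 3 from its expected value, at z = 1. The relation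
    says that (t^2 - e1 t + e2) times \<open>D\<close> plus a remainder of degree at most 1 is zero,
    so both summands vanish.\<close>
  define D where "D = [:w1 $ 3 - quot0 cf e1 e2 0 1, w2 $ 3 - quot0 cf e1 e2 1 0:]"
  define f where "f = [:e2, - e1, 1:] * D + [:r0, r1:]"
  have "poly f y = 0" for y
  proof -
    let ?n = "y ^ 2 - e1 * y * 1 + e2 * 1 ^ 2"
    have "(y * w2 $ 3 + 1 * w1 $ 3) * - ?n = - ?n * quot0 cf e1 e2 y 1 + 1 ^ 2 * (r1 * y + r0 * 1)"
      using surface_relations(1)[OF on_pt[of y 1]]
      unfolding pt conic_on_line cubic0_on_line r0_def r1_def k0_def k1_def k2_def by simp
    moreover have "poly f y = ?n * (y * w2 $ 3 + 1 * w1 $ 3 - quot0 cf e1 e2 y 1) + (r1 * y + r0)"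
      unfolding f_def D_def quot_linear(1)[of cf e1 e2 y 1] by (simp add: algebra_simps power2_eq_square)
    ultimately show ?thesis by (simp add: algebra_simps)
  qed
  then have f0: "f = 0" by (intro infinite_poly_eq[OF infinite_field, of "{}"]) auto
  have D0: "D = 0"
  proof (rule ccontr)
    assume "D \<noteq> 0"
    then have "2 \<le> degree ([:e2, - e1, 1:] * D)" by (subst degree_mult_eq) auto
    moreover have "[:e2, - e1, 1:] * D = - [:r0, r1:]" using f0 unfolding f_def by (simp only: add_eq_0_iff2)
    moreover have "degree (- [:r0, r1:]) \<le> 1" unfolding degree_minus by (simp add: degree_pCons_le)
    ultimately show False by simp
  qed
  then have r: "r0 = 0" "r1 = 0" using f0 unfolding f_def by simp_all
  have "Q = [:e2, - e1, 1:] * [:k0, k1, k2, 1:]"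
  proof (rule poly_eqI)
    fix n :: nat
    let ?P = "[:e2, - e1, 1:] * [:k0, k1, k2, 1:]"
    note c = quadratic_product_coeffs[of e2 e1 k0 k1 k2]
    consider "n = 0" | "n = 1" | "n = 2" | "n = 3" | "n = 4" | "n = 5" | "n > 5" by linarith
    then show "coeff Q n = coeff ?P n"
    proof cases
      case 6
      have "cf 5 = 1" using lead_Q degree_Q by simp
      with 6 show ?thesis using c(6) by (simp only:)
    next
      case 7
      have "degree ?P \<le> 2 + 3"
        by (intro order.trans[OF degree_mult_le] add_mono) (simp_all add: degree_pCons_le)
      with 7 have "coeff ?P n = 0" by (intro coeff_eq_0) linarith
      moreover have "coeff Q n = 0" using 7 degree_Q by (intro coeff_eq_0) simp
      ultimately show ?thesis by simp
    qed (use r in \<open>simp_all only: c\<close>, simp_all add: k2_def k1_def k0_def r1_def r0_def algebra_simps)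
  qed
  then have "[:e2, - e1, 1:] dvd Q" by (rule dvdI)
  then obtain a b where ab: "a \<in> R" "b \<in> R" "a \<noteq> b" and e: "e1 = a + b" "e2 = a * b"
    by (rule quadratic_dvd_roots)
  \<comment> \<open>A parameter off both base points, where the conic can be divided out; the pair
    (1, 0) is another one. Together they determine \<open>w2\<close> and \<open>w1\<close>.\<close>
  obtain t where t: "t \<notin> {a, b}" using infinite_field ex_new_if_finite
    by (metis finite.emptyI finite.insertI)
  have eqs: "pt y z $ 3 = quot0 cf e1 e2 y z \<and> pt y z $ 4 = quot1 cf e1 e2 y z
      \<and> pt y z $ 5 = quot2 cf e1 e2 y z" if "(y - a * z) * (y - b * z) \<noteq> 0" for y z
  proof -
    have "on_image (standard_basis Q) (pt y z)" using that by (intro on_pt) auto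
    note rel = surface_relations(1-3)[OF this, unfolded pt(2-4), unfolded e line_forms[OF ab]]
    show ?thesis unfolding e
      using rel that by (auto simp: power2_eq_square)
  qed
  have w2': "w2 = line_vec cf e1 e2 1 0"
    using eqs[of 1 0] unfolding pt(5-7) vec6_eq_iff line_vec_nth by (simp add: w2 e1_def)
  have "pt t 1 $ 3 = quot0 cf e1 e2 t 1 \<and> pt t 1 $ 4 = quot1 cf e1 e2 t 1
      \<and> pt t 1 $ 5 = quot2 cf e1 e2 t 1" using eqs[of t 1] t by auto
  then have "w1 = line_vec cf e1 e2 0 1"
    unfolding pt(5-7) vec6_eq_iff line_vec_nth w2' quot_linear[of cf e1 e2 t 1]
    by (simp add: w1 e2_def)
  with w2' have "pt y z = line_vec cf e1 e2 y z" for y z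
    unfolding pt_def by (subst line_vec_linear) simp
  then have "W = surface_line cf e1 e2" unfolding all surface_line_def by simp
  then show ?thesis using that[OF ab] e by simp
qed

lemma lines_on_standard_surface:
  "lines_on (rational_map_image (standard_basis Q))
     = {surface_line cf (a + b) (a * b) | a b. a \<in> R \<and> b \<in> R \<and> a \<noteq> b}"
proof (intro equalityI subsetI)
  fix W assume "W \<in> lines_on (rational_map_image (standard_basis Q))"
  then have "vec.subspace W" "vec.dim W = 2" "\<And>v. v \<in> W \<Longrightarrow> v \<noteq> 0 \<Longrightarrow> on_image (standard_basis Q) v"
    unfolding lines_on_image by auto
  then obtain a b where "a \<in> R" "b \<in> R" "a \<noteq> b" "W = surface_line cf (a + b) (a * b)"
    by (rule line_classification)
  then show "W \<in> {surface_line cf (a + b) (a * b) | a b. a \<in> R \<and> b \<in> R \<and> a \<noteq> b}" by blast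
next
  fix W assume "W \<in> {surface_line cf (a + b) (a * b) | a b. a \<in> R \<and> b \<in> R \<and> a \<noteq> b}"
  then obtain a b where "a \<in> R" "b \<in> R" "a \<noteq> b" "W = surface_line cf (a + b) (a * b)" by blast
  then show "W \<in> lines_on (rational_map_image (standard_basis Q))"
    unfolding lines_on_image mem_Collect_eq
    by (auto simp: surface_line_dim) (auto simp: surface_line_def intro: line_vec_on_image)
qed

end

section \<open>Distinctness and incidence of the ten lines\<close>

lemma surface_line_inj:
  assumes "surface_line c e1 e2 = surface_line c e1' (e2' :: 'a::comm_ring_1)"
  shows "e1 = e1' \<and> e2 = e2'"
proof -
  have "line_vec c e1 e2 y z \<in> surface_line c e1' e2'" for y z
    using assms unfolding surface_line_def by blast
  from this[of 1 0] this[of 0 1] show ?thesis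
    unfolding surface_line_def by (auto simp: vec6_eq_iff)
qed

context split_quintic
begin

text \<open>The plane lines meet in a point off the conic, and there the first three coordinates
  determine the others.\<close>

lemma disjoint_lines_meet:
  assumes R: "a \<in> R" "b \<in> R" "a \<noteq> b" "a' \<in> R" "b' \<in> R" "a' \<noteq> b'"
    and disj: "a \<noteq> a'" "a \<noteq> b'" "b \<noteq> a'" "b \<noteq> b'"
  shows "lines_meet (surface_line cf (a + b) (a * b)) (surface_line cf (a' + b') (a' * b'))"
proof -
  \<comment> \<open>The intersection of the two plane lines, by Cramer's rule. The factors y - a z
    and y - b z then split into differences of distinct roots.\<close>
  define y where "y = a * b - a' * b'"
  define z where "z = a + b - (a' + b')"
  have x: "(a + b) * y - a * b * z = (a' + b') * y - a' * b' * z"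
    unfolding y_def z_def by Groebner_Basis.algebra
  have n: "(y - a * z) * (y - b * z) = (y - a' * z) * (y - b' * z)"
    using x by Groebner_Basis.algebra
  have "y - a * z = (a - a') * (b' - a)" "y - b * z = (b - a') * (b' - b)"
    unfolding y_def z_def by Groebner_Basis.algebra+
  then have n0: "(y - a * z) * (y - b * z) \<noteq> 0" using disj by auto
  note f = line_forms[OF R(1-3), of y z] and f' = line_forms[OF R(4-6), of y z, folded x n]
  have "line_vec cf (a + b) (a * b) y z = line_vec cf (a' + b') (a' * b') y z"
    unfolding vec6_eq_iff line_vec_nth x
    using f(1-3) f'(1-3) n0 by simp
  moreover have "line_vec cf (a + b) (a * b) y z \<noteq> 0" using n0 by (auto simp: vec6_eq_iff)
  ultimately show ?thesis unfolding lines_meet_def surface_line_def by blast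
qed

text \<open>The other two roots form the quadratic t^2 + h1 t + h0, which does not vanish at
  \<open>a\<close>. Only the two coefficients of Q that enter \<open>quot0\<close> are expressed
  through it.\<close>

lemma triple_factor:
  assumes "a \<in> R" "b \<in> R" "d \<in> R" "a \<noteq> b" "a \<noteq> d" "b \<noteq> d"
  obtains h0 h1 where "cf 4 = h1 - (a + b + d)" "cf 3 = h0 - (a + b + d) * h1 + (a * b + a * d + b * d)"
    "a ^ 2 + h1 * a + h0 \<noteq> 0"
proof -
  define G where "G = (\<Prod>r\<in>R - {a, b, d}. [:- r, 1:])"
  have "card (R - {a, b, d}) = 2"
    using assms finite_roots card_roots by (simp add: card_Diff_subset)
  then have "degree G = 2"
    unfolding G_def by (subst degree_prod_eq_sum_degree) auto
  moreover have "Polynomial.lead_coeff G = 1"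
    unfolding G_def by (simp add: lead_coeff_prod)
  ultimately have G: "G = [:coeff G 0, coeff G 1, 1:]"
    by (intro poly_eqI) (auto simp: coeff_pCons coeff_eq_0 eval_nat_numeral split: nat.split)
  then obtain h0 h1 where h: "G = [:h0, h1, 1:]" by blast
  have "Q = [:- a, 1:] * ([:- b, 1:] * ([:- d, 1:] * G))"
  proof -
    have "(\<Prod>r\<in>R. [:- r, 1:]) = [:- a, 1:] * (\<Prod>r\<in>R - {a}. [:- r, 1:])"
      using assms finite_roots by (intro prod.remove)
    moreover have "(\<Prod>r\<in>R - {a}. [:- r, 1:]) = [:- b, 1:] * (\<Prod>r\<in>R - {a} - {b}. [:- r, 1:])"
      using assms finite_roots by (intro prod.remove) auto
    moreover have "(\<Prod>r\<in>R - {a} - {b}. [:- r, 1:]) = [:- d, 1:] * (\<Prod>r\<in>R - {a} - {b} - {d}. [:- r, 1:])"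
      using assms finite_roots by (intro prod.remove) auto
    moreover have "R - {a} - {b} - {d} = R - {a, b, d}" by blast
    ultimately show ?thesis unfolding roots G_def by (simp only:)
  qed
  note Q = this[unfolded h]
  have "poly G a \<noteq> 0" unfolding G_def using finite_roots by (auto simp: poly_prod)
  then have "a ^ 2 + h1 * a + h0 \<noteq> 0" unfolding h by (simp add: algebra_simps power2_eq_square)
  moreover have "cf 4 = h1 - (a + b + d)" "cf 3 = h0 - (a + b + d) * h1 + (a * b + a * d + b * d)"
    unfolding Q by (simp_all add: eval_nat_numeral algebra_simps)
  ultimately show ?thesis using that by blast
qed

text \<open>The plane lines meet only in the base point (a^2 : a : 1), which is blown up. Over it,
  the values of coordinate 3 differ, up to sign, by (b - d) (a^2 + h1 a + h0) z, so the two
  directions are separated.\<close>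

lemma incident_lines_disjoint:
  assumes R: "a \<in> R" "b \<in> R" "d \<in> R" "a \<noteq> b" "a \<noteq> d" "b \<noteq> d"
  shows "\<not> lines_meet (surface_line cf (a + b) (a * b)) (surface_line cf (a + d) (a * d))"
proof
  assume "lines_meet (surface_line cf (a + b) (a * b)) (surface_line cf (a + d) (a * d))"
  moreover have "0 \<in> surface_line cf e1 e2" for e1 e2
    using surface_line_dim(1) by (rule vec.subspace_0)
  ultimately obtain v where "v \<in> surface_line cf (a + b) (a * b)" "v \<in> surface_line cf (a + d) (a * d)" "v \<noteq> 0"
    unfolding lines_meet_def by blast
  then obtain y z y' z' where v: "line_vec cf (a + b) (a * b) y z = line_vec cf (a + d) (a * d) y' z'"
    "line_vec cf (a + b) (a * b) y z \<noteq> 0"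
    unfolding surface_line_def by blast
  then have yz: "y' = y" "z' = z" by (auto simp: vec6_eq_iff)
  have "(a + b) * y - a * b * z = (a + d) * y - a * d * z"
    using v(1) by (simp add: vec6_eq_iff yz)
  then have "(b - d) * (y - a * z) = 0" by Groebner_Basis.algebra
  then have y: "y = a * z" using R by simp
  obtain h0 h1 where h: "cf 4 = h1 - (a + b + d)"
    "cf 3 = h0 - (a + b + d) * h1 + (a * b + a * d + b * d)" "a ^ 2 + h1 * a + h0 \<noteq> 0"
    using triple_factor[OF R] by blast
  have "quot0 cf (a + b) (a * b) (a * z) z = quot0 cf (a + d) (a * d) (a * z) z"
    using v(1) by (simp add: vec6_eq_iff yz y)
  then have "(b - d) * (a ^ 2 + h1 * a + h0) * z = 0"
    unfolding quot0_def h(1,2) by Groebner_Basis.algebra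
  then have "z = 0" using R h(3) by simp
  with y v(2) show False by (simp add: vec6_eq_iff quot0_def quot1_def quot2_def Let_def)
qed

end

section \<open>Automorphisms of the Petersen graph\<close>

text \<open>The stars are the independent sets of four vertices in the Petersen graph. An
  automorphism permutes them, which recovers the five points from the graph.\<close>

definition star5 :: "nat \<Rightarrow> nat set set" where
  "star5 i = {A \<in> pairs5. i \<in> A}"

lemma pair_in_pairs5: "{i, j} \<in> pairs5 \<longleftrightarrow> i \<in> {1..5} \<and> j \<in> {1..5} \<and> i \<noteq> j"
  by (auto simp: pairs5_def card_insert_if)

lemma pairs5E:
  assumes "A \<in> pairs5"
  obtains i j where "i \<in> {1..5}" "j \<in> {1..5}" "i \<noteq> j" "A = {i, j}"
  using assms unfolding pairs5_def by (auto simp: card_2_iff)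

lemma finite_pairs5: "finite pairs5"
  unfolding pairs5_def by (rule finite_subset[of _ "Pow {1..5}"]) auto

lemma star5_eq: "i \<in> {1..5} \<Longrightarrow> star5 i = (\<lambda>j. {i, j}) ` ({1..5} - {i})"
  unfolding star5_def by (auto simp: pair_in_pairs5 elim!: pairs5E)

lemma card_star5: "i \<in> {1..5} \<Longrightarrow> card (star5 i) = 4"
  unfolding star5_eq by (subst card_image) (auto simp: inj_on_def doubleton_eq_iff)

text \<open>Pairwise intersecting pairs either share a point or form a triangle, and a triangle has
  only three members.\<close>

lemma intersecting_pairs_common:
  assumes "A \<in> pairs5" "B \<in> pairs5" "C \<in> pairs5" "D \<in> pairs5"
    and "A \<noteq> B" "A \<noteq> C" "A \<noteq> D" "B \<noteq> C" "B \<noteq> D" "C \<noteq> D"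
    and "A \<inter> B \<noteq> {}" "A \<inter> C \<noteq> {}" "A \<inter> D \<noteq> {}" "B \<inter> C \<noteq> {}" "B \<inter> D \<noteq> {}" "C \<inter> D \<noteq> {}"
  obtains c where "c \<in> A" "c \<in> B" "c \<in> C" "c \<in> D"
proof -
  obtain c where c: "c \<in> A" "c \<in> B" using assms by blast
  obtain x where x: "A = {c, x}" "x \<noteq> c" using assms(1) c(1) by (auto elim!: pairs5E)
  obtain y where y: "B = {c, y}" "y \<noteq> c" using assms(2) c(2) by (auto elim!: pairs5E)
  have xy: "x \<noteq> y" using x y assms(5) by auto
  have third: "E = {x, y}" if "E \<in> pairs5" "c \<notin> E" "A \<inter> E \<noteq> {}" "B \<inter> E \<noteq> {}" for E
    using that x y xy by (auto elim!: pairs5E)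
  have fourth: "E = A \<or> E = B" if "E \<in> pairs5" "c \<in> E" "E \<inter> {x, y} \<noteq> {}" for E
    using that x y by (auto elim!: pairs5E)
  show ?thesis
  proof (cases "c \<in> C")
    case True
    have "c \<in> D"
    proof (rule ccontr)
      assume "c \<notin> D"
      then have "D = {x, y}" by (rule third[OF assms(4) _ assms(13,15)])
      then have "C \<inter> {x, y} \<noteq> {}" using assms(16) by simp
      then have "C = A \<or> C = B" by (rule fourth[OF assms(3) True])
      then show False using assms(6,8) by simp
    qed
    then show ?thesis using that c True by blast
  next
    case False
    then have C: "C = {x, y}" by (rule third[OF assms(3) _ assms(12,14)])
    have cD: "c \<in> D"
    proof (rule ccontr)
      assume "c \<notin> D"
      then have "D = {x, y}" by (rule third[OF assms(4) _ assms(13,15)])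
      then show False using C assms(10) by simp
    qed
    have "D \<inter> {x, y} \<noteq> {}" using assms(16) C by (simp add: Int_commute)
    then have "D = A \<or> D = B" by (rule fourth[OF assms(4) cD])
    then show ?thesis using assms(7,9) by simp
  qed
qed

text \<open>A star goes to four pairwise intersecting pairs, hence to a star. A pair is determined
  by the two stars that contain it, so the induced map on the points determines
  \<open>g\<close>.\<close>

lemma petersen_automorphism:
  assumes g: "bij_betw g pairs5 pairs5"
    and adj: "\<And>A B. A \<in> pairs5 \<Longrightarrow> B \<in> pairs5 \<Longrightarrow> A \<noteq> B \<Longrightarrow> g A \<inter> g B = {} \<longleftrightarrow> A \<inter> B = {}"
  obtains \<pi> where "\<pi> permutes {1..5}" "\<And>A. A \<in> pairs5 \<Longrightarrow> g A = \<pi> ` A"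
proof -
  have inj: "inj_on g pairs5" and g_in: "\<And>A. A \<in> pairs5 \<Longrightarrow> g A \<in> pairs5"
    using g by (auto simp: bij_betw_def)
  have "\<exists>c\<in>{1..5}. g ` star5 i = star5 c" if i: "i \<in> {1..5}" for i
  proof -
    have "card ({1..5} - {i}) = 4" using i by simp
    then obtain j1 j2 j3 j4 where j: "{1..5} - {i} = {j1, j2, j3, j4}"
      and d: "j1 \<noteq> j2" "j1 \<noteq> j3" "j1 \<noteq> j4" "j2 \<noteq> j3" "j2 \<noteq> j4" "j3 \<noteq> j4"
      by (auto simp: card_Suc_eq eval_nat_numeral)
    have in5: "j1 \<in> {1..5} - {i}" "j2 \<in> {1..5} - {i}" "j3 \<in> {1..5} - {i}" "j4 \<in> {1..5} - {i}"
      unfolding j by auto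
    then have p: "{i, j1} \<in> pairs5" "{i, j2} \<in> pairs5" "{i, j3} \<in> pairs5" "{i, j4} \<in> pairs5"
      using i unfolding pair_in_pairs5 by auto
    have neq: "{i, a} \<noteq> {i, b}" if "a \<noteq> b" for a b :: nat using that by (auto simp: doubleton_eq_iff)
    have gneq: "g {i, a} \<noteq> g {i, b}" if "a \<noteq> b" "{i, a} \<in> pairs5" "{i, b} \<in> pairs5" for a b
      using neq[OF that(1)] inj that(2,3) by (auto dest: inj_onD)
    have meet: "g {i, a} \<inter> g {i, b} \<noteq> {}" if "a \<noteq> b" "{i, a} \<in> pairs5" "{i, b} \<in> pairs5" for a b
      using adj[OF that(2,3) neq[OF that(1)]] by auto
    obtain c where c: "c \<in> g {i, j1}" "c \<in> g {i, j2}" "c \<in> g {i, j3}" "c \<in> g {i, j4}"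
      by (rule intersecting_pairs_common[OF g_in[OF p(1)] g_in[OF p(2)] g_in[OF p(3)] g_in[OF p(4)]])
        (use gneq meet p d in auto)
    have c5: "c \<in> {1..5}" using c(1) g_in[OF p(1)] unfolding pairs5_def by auto
    have sub: "g ` star5 i \<subseteq> star5 c"
      unfolding star5_eq[OF i] j using c g_in p by (auto simp: star5_def)
    have "card (g ` star5 i) = 4"
      using card_star5[OF i] inj by (subst card_image) (auto simp: star5_def inj_on_def)
    then have "g ` star5 i = star5 c"
      using sub card_star5[OF c5] finite_pairs5 by (intro card_subset_eq) (auto simp: star5_def)
    with c5 show ?thesis by blast
  qed
  then obtain p where p: "\<And>i. i \<in> {1..5} \<Longrightarrow> p i \<in> {1..5}"
    "\<And>i. i \<in> {1..5} \<Longrightarrow> g ` star5 i = star5 (p i)" by metis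
  have inj_p: "inj_on p {1..5}"
  proof (rule inj_onI, rule ccontr)
    fix i j assume ij: "i \<in> {1..5}" "j \<in> {1..5}" "p i = p j" "i \<noteq> j"
    then have "g ` star5 i = g ` star5 j" using p(2) by simp
    then have "star5 i = star5 j"
      using inj by (subst (asm) inj_on_image_eq_iff[of g pairs5]) (auto simp: star5_def)
    have "card ({1..5} - {i, j}) = 3" using ij by (simp add: card_Diff_subset)
    then obtain k where "k \<in> {1..5} - {i, j}" by (metis all_not_in_conv card.empty zero_neq_numeral)
    then have "{i, k} \<in> star5 i" "{i, k} \<notin> star5 j"
      using ij by (auto simp: star5_def pair_in_pairs5)
    with \<open>star5 i = star5 j\<close> show False by simp
  qed
  define \<pi> where "\<pi> = (\<lambda>i. if i \<in> {1..5} then p i else i)"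
  have "\<pi> permutes {1..5}"
  proof (rule bij_imp_permutes)
    have "p ` {1..5} = {1..5}" using inj_p p(1) by (intro endo_inj_surj) auto
    then show "bij_betw \<pi> {1..5} {1..5}"
      using inj_p unfolding bij_betw_def \<pi>_def inj_on_def by auto
  qed (simp add: \<pi>_def del: atLeastAtMost_iff)
  moreover have "g A = \<pi> ` A" if "A \<in> pairs5" for A
  proof -
    obtain i j where A: "i \<in> {1..5}" "j \<in> {1..5}" "i \<noteq> j" "A = {i, j}" using \<open>A \<in> pairs5\<close> by (rule pairs5E)
    have "A \<in> star5 i" "A \<in> star5 j" using that A by (auto simp: star5_def)
    then have "g A \<in> star5 (p i)" "g A \<in> star5 (p j)" using p(2) A by blast+
    then have "p i \<in> g A" "p j \<in> g A" "g A \<in> pairs5" by (auto simp: star5_def)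
    moreover have "p i \<noteq> p j" using inj_p A by (auto dest: inj_onD)
    ultimately have "g A = {p i, p j}" by (auto elim!: pairs5E)
    then show ?thesis using A by (simp add: \<pi>_def)
  qed
  ultimately show ?thesis by (rule that)
qed

lemma permutes_image_pairs5:
  assumes "\<pi> permutes {1..5}" "A \<in> pairs5"
  shows "\<pi> ` A \<in> pairs5"
  using assms permutes_inj[OF assms(1)] permutes_image[OF assms(1)]
  unfolding pairs5_def by (auto simp: card_image inj_on_subset)

text \<open>A point i is the only common element of {i, j} and {i, k}, so the action on pairs is
  faithful.\<close>

lemma permutes_pairs5_eqI:
  assumes "\<sigma> permutes {1..5}" "\<tau> permutes {1..5}" "\<And>A. A \<in> pairs5 \<Longrightarrow> \<sigma> ` A = \<tau> ` A"
  shows "\<sigma> = \<tau>"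
proof
  fix i
  show "\<sigma> i = \<tau> i"
  proof (cases "i \<in> {1..5}")
    case True
    have "card ({1..5} - {i}) = 4" using True by simp
    then obtain j k T where T: "{1..5} - {i} = insert j (insert k T)" and "j \<noteq> k"
      by (auto simp: card_Suc_eq eval_nat_numeral)
    then have jk: "j \<in> {1..5} - {i}" "k \<in> {1..5} - {i}" "j \<noteq> k" by auto
    have "{i, j} \<in> pairs5" "{i, k} \<in> pairs5" using True jk by (auto simp: pair_in_pairs5)
    then have "{\<sigma> i, \<sigma> j} = {\<tau> i, \<tau> j}" "{\<sigma> i, \<sigma> k} = {\<tau> i, \<tau> k}"
      using assms(3)[of "{i, j}"] assms(3)[of "{i, k}"] by auto
    moreover have "\<sigma> j \<noteq> \<sigma> k" "\<tau> j \<noteq> \<tau> k"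
      using jk permutes_inj[OF assms(1)] permutes_inj[OF assms(2)] by (auto dest: injD)
    ultimately show ?thesis by (auto simp: doubleton_eq_iff)
  next
    case False
    then show ?thesis using assms(1,2) by (simp add: permutes_not_in)
  qed
qed

section \<open>Homomorphisms to the symmetric group\<close>

lemma galois_group_simps:
  "carrier (galois_group L) = {\<sigma> \<in> Bij L. (\<forall>x\<in>L. \<forall>y\<in>L. \<sigma> (x + y) = \<sigma> x + \<sigma> y \<and> \<sigma> (x * y) = \<sigma> x * \<sigma> y)
        \<and> (\<forall>a. \<sigma> (to_ac a) = to_ac a)}"
  by (simp add: galois_group_def)

lemma galois_group_mult:
  assumes "\<sigma> \<in> carrier (galois_group L)" "\<tau> \<in> carrier (galois_group L)"
  shows "\<sigma> \<otimes>\<^bsub>galois_group L\<^esub> \<tau> = compose L \<sigma> \<tau>"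
  using assms by (simp add: galois_group_def BijGroup_def)

abbreviation "Gal \<equiv> carrier absolute_galois_group"

lemma absolute_galois_groupD:
  assumes "\<sigma> \<in> Gal"
  shows "bij \<sigma>" "\<sigma> (x + y) = \<sigma> x + \<sigma> y" "\<sigma> (x * y) = \<sigma> x * \<sigma> y" "\<sigma> (to_ac a) = to_ac a"
  using assms unfolding absolute_galois_group_def galois_group_simps by (auto simp: Bij_def)

lemma absolute_galois_group_hom:
  assumes "\<sigma> \<in> Gal"
  shows "coeff_hom \<sigma>"
  using absolute_galois_groupD[OF assms] absolute_galois_groupD(4)[OF assms, of 1]
  by unfold_locales auto

lemma absolute_galois_group_mult:
  assumes "\<sigma> \<in> Gal" "\<tau> \<in> Gal"
  shows "\<sigma> \<otimes>\<^bsub>absolute_galois_group\<^esub> \<tau> = \<sigma> \<circ> \<tau>"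
  using assms galois_group_mult[of \<sigma> UNIV \<tau>]
  by (auto simp: absolute_galois_group_def compose_def)

lemma absolute_galois_group_closed:
  assumes "\<sigma> \<in> Gal" "\<tau> \<in> Gal"
  shows "\<sigma> \<circ> \<tau> \<in> Gal"
  using absolute_galois_groupD[OF assms(1)] absolute_galois_groupD[OF assms(2)]
  unfolding absolute_galois_group_def galois_group_simps by (auto simp: Bij_def bij_comp)

lemma galois_homs_conj:
  fixes f :: "('k::field alg_closure \<Rightarrow> 'k alg_closure) \<Rightarrow> nat \<Rightarrow> nat"
  assumes f: "f \<in> galois_homs" and \<pi>: "\<pi> permutes {1..5}"
  shows "(\<lambda>\<sigma> \<in> Gal. \<pi> \<circ> f \<sigma> \<circ> inv' \<pi>) \<in> galois_homs"
proof -
  let ?G = "Gal :: ('k alg_closure \<Rightarrow> 'k alg_closure) set"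
  let ?c = "\<lambda>\<sigma> \<in> ?G. \<pi> \<circ> f \<sigma> \<circ> inv' \<pi>"
  have hom: "f \<in> hom absolute_galois_group (sym_group 5)" using f by (simp add: galois_homs_def)
  have perm: "f \<sigma> permutes {1..5}" if "\<sigma> \<in> ?G" for \<sigma>
    using hom_in_carrier[OF hom that] by (simp add: sym_group_def)
  have mult: "f (\<sigma> \<circ> \<tau>) = f \<sigma> \<circ> f \<tau>" if "\<sigma> \<in> ?G" "\<tau> \<in> ?G" for \<sigma> \<tau>
    using hom_mult[OF hom that] absolute_galois_group_mult[OF that] by (simp add: sym_group_def)
  have inv: "inv' \<pi> \<circ> \<pi> = id" "\<pi> \<circ> inv' \<pi> = id" using \<pi> by (simp_all add: permutes_inv_o)
  have "?c \<in> hom absolute_galois_group (sym_group 5)"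
  proof (rule homI)
    fix \<sigma> assume "\<sigma> \<in> ?G"
    then show "?c \<sigma> \<in> carrier (sym_group 5)"
      using perm \<pi> by (simp add: sym_group_def permutes_compose permutes_inv)
  next
    fix \<sigma> \<tau> assume st: "\<sigma> \<in> ?G" "\<tau> \<in> ?G"
    have "\<pi> \<circ> (f \<sigma> \<circ> f \<tau>) \<circ> inv' \<pi> = \<pi> \<circ> f \<sigma> \<circ> (inv' \<pi> \<circ> \<pi>) \<circ> f \<tau> \<circ> inv' \<pi>"
      unfolding inv by (simp add: comp_assoc)
    then show "?c (\<sigma> \<otimes>\<^bsub>absolute_galois_group\<^esub> \<tau>)
        = ?c \<sigma> \<otimes>\<^bsub>sym_group 5\<^esub> ?c \<tau>"
      using st by (simp add: absolute_galois_group_mult absolute_galois_group_closed mult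
        sym_group_mult comp_assoc)
  qed
  moreover obtain S where S: "finite S" "\<And>\<sigma>. \<sigma> \<in> ?G \<Longrightarrow> \<forall>x\<in>S. \<sigma> x = x \<Longrightarrow> f \<sigma> = id"
    using f unfolding galois_homs_def by blast
  have "\<forall>\<sigma>\<in>?G. (\<forall>x\<in>S. \<sigma> x = x) \<longrightarrow> ?c \<sigma> = id"
    using S(2) inv by simp
  ultimately show ?thesis using S(1) unfolding galois_homs_def by blast
qed

text \<open>Reduces the class to a single equivariant marking. Conjugating the homomorphism by \<pi>
  amounts to relabelling the marking by the inverse of \<pi>, and two markings of the same lines
  differ by an automorphism of the Petersen graph.\<close>

lemma corresponding_homs_eq:
  fixes F :: "('k::field alg_closure^6) set set"
  assumes marking: "is_line_marking F l" and \<rho>: "\<rho> \<in> galois_homs"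
    and equi: "\<And>\<sigma> A. \<sigma> \<in> Gal \<Longrightarrow> A \<in> pairs5 \<Longrightarrow> galois_act \<sigma> ` l A = l (\<rho> \<sigma> ` A)"
  shows "corresponding_homs F = S5_conj_class \<rho>"
proof (intro equalityI subsetI)
  let ?G = "Gal :: ('k alg_closure \<Rightarrow> 'k alg_closure) set"
  have perm: "f \<sigma> permutes {1..5}" if "f \<in> galois_homs" "\<sigma> \<in> ?G" for f \<sigma>
    using hom_in_carrier[of f absolute_galois_group "sym_group 5"] that
    by (auto simp: sym_group_def galois_homs_def)
  have l: "bij_betw l pairs5 (lines_on F)"
    and l_meet: "\<And>A B. A \<in> pairs5 \<Longrightarrow> B \<in> pairs5 \<Longrightarrow> A \<noteq> B \<Longrightarrow> lines_meet (l A) (l B) \<longleftrightarrow> A \<inter> B = {}"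
    using marking by (auto simp: is_line_marking_def)
  {
    fix f assume "f \<in> S5_conj_class \<rho>"
    then obtain \<pi> where \<pi>: "\<pi> permutes {1..5}" and f: "f = (\<lambda>\<sigma> \<in> ?G. \<pi> \<circ> \<rho> \<sigma> \<circ> inv' \<pi>)"
      unfolding S5_conj_class_def
      by (auto simp: sym_group_carrier sym_group_inv_equality[unfolded sym_group_carrier] cong: restrict_cong)
    let ?p = "inv' \<pi>"
    have p: "?p permutes {1..5}" using \<pi> by (rule permutes_inv)
    have inv: "?p ` \<pi> ` A = A" "\<pi> ` ?p ` A = A" for A
      using \<pi> by (auto simp: image_comp permutes_inv_o)
    have "bij_betw (\<lambda>A. ?p ` A) pairs5 pairs5"
      by (rule bij_betwI[where g = "\<lambda>A. \<pi> ` A"])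
        (use permutes_image_pairs5[OF p] permutes_image_pairs5[OF \<pi>] inv in auto)
    then have bij: "bij_betw (\<lambda>A. l (?p ` A)) pairs5 (lines_on F)"
      using bij_betw_trans[OF _ l] by (simp add: comp_def)
    have "is_line_marking F (\<lambda>A. l (?p ` A))"
      unfolding is_line_marking_def
    proof (intro conjI ballI impI bij)
      fix A B assume AB: "A \<in> pairs5" "B \<in> pairs5" "A \<noteq> B"
      have "?p ` A \<noteq> ?p ` B" using AB(3) inv(2) by metis
      then have "lines_meet (l (?p ` A)) (l (?p ` B)) \<longleftrightarrow> ?p ` A \<inter> ?p ` B = {}"
        using AB permutes_image_pairs5[OF p] by (intro l_meet)
      also have "\<dots> \<longleftrightarrow> A \<inter> B = {}"
        using permutes_inj[OF p] by (simp add: image_Int[symmetric])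
      finally show "lines_meet (l (?p ` A)) (l (?p ` B)) \<longleftrightarrow> A \<inter> B = {}" .
    qed
    moreover have "galois_act \<sigma> ` l (?p ` A) = l (?p ` f \<sigma> ` A)" if "\<sigma> \<in> ?G" "A \<in> pairs5" for \<sigma> A
    proof -
      have "f \<sigma> ` A = \<pi> ` \<rho> \<sigma> ` ?p ` A" using that(1) by (simp add: f image_comp)
      then show ?thesis using equi[OF that(1) permutes_image_pairs5[OF p that(2)]] by (simp add: inv)
    qed
    moreover have "f \<in> galois_homs" unfolding f by (rule galois_homs_conj[OF \<rho> \<pi>])
    ultimately show "f \<in> corresponding_homs F" unfolding corresponding_homs_def by blast
  }
  fix f assume "f \<in> corresponding_homs F"
  then obtain m where f: "f \<in> galois_homs" and m: "is_line_marking F m"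
    and fm: "\<And>\<sigma> A. \<sigma> \<in> ?G \<Longrightarrow> A \<in> pairs5 \<Longrightarrow> galois_act \<sigma> ` m A = m (f \<sigma> ` A)"
    unfolding corresponding_homs_def by auto
  have m_bij: "bij_betw m pairs5 (lines_on F)"
    and m_meet: "\<And>A B. A \<in> pairs5 \<Longrightarrow> B \<in> pairs5 \<Longrightarrow> A \<noteq> B \<Longrightarrow> lines_meet (m A) (m B) \<longleftrightarrow> A \<inter> B = {}"
    using m by (auto simp: is_line_marking_def)
  define g where "g = inv_into pairs5 l \<circ> m"
  have g: "bij_betw g pairs5 pairs5"
    unfolding g_def by (rule bij_betw_trans[OF m_bij bij_betw_inv_into[OF l]])
  have lg: "l (g A) = m A" if "A \<in> pairs5" for A
  proof -
    have "m A \<in> l ` pairs5" using that m_bij l unfolding bij_betw_def by blast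
    then show ?thesis unfolding g_def comp_def by (rule f_inv_into_f)
  qed
  have g_in: "g A \<in> pairs5" if "A \<in> pairs5" for A using g that by (auto simp: bij_betw_def)
  have adj: "g A \<inter> g B = {} \<longleftrightarrow> A \<inter> B = {}" if "A \<in> pairs5" "B \<in> pairs5" "A \<noteq> B" for A B
  proof -
    have "g A \<noteq> g B" using g that by (auto simp: bij_betw_def dest: inj_onD)
    then have "lines_meet (l (g A)) (l (g B)) \<longleftrightarrow> g A \<inter> g B = {}" using that g_in by (intro l_meet)
    then show ?thesis using m_meet[OF that] lg that by simp
  qed
  have "\<exists>\<pi>. \<pi> permutes {1..5} \<and> (\<forall>A\<in>pairs5. g A = \<pi> ` A)"
    by (rule petersen_automorphism[OF g]) (erule (2) adj, blast)
  then obtain \<pi> where \<pi>: "\<pi> permutes {1..5}" and g\<pi>: "\<And>A. A \<in> pairs5 \<Longrightarrow> g A = \<pi> ` A"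
    by blast
  \<comment> \<open>By faithfulness it suffices to compare the action on pairs, where this is the
    equivariance of both markings.\<close>
  have key: "\<rho> \<sigma> \<circ> \<pi> = \<pi> \<circ> f \<sigma>" if \<sigma>: "\<sigma> \<in> ?G" for \<sigma>
  proof (rule permutes_pairs5_eqI)
    show "\<rho> \<sigma> \<circ> \<pi> permutes {1..5}" "\<pi> \<circ> f \<sigma> permutes {1..5}"
      using perm[OF \<rho> \<sigma>] perm[OF f \<sigma>] \<pi> by (auto intro: permutes_compose)
    fix A assume A: "A \<in> pairs5"
    have fA: "f \<sigma> ` A \<in> pairs5" using perm[OF f \<sigma>] A by (rule permutes_image_pairs5)
    have "l (\<rho> \<sigma> ` g A) = galois_act \<sigma> ` m A" using equi[OF \<sigma> g_in[OF A]] lg[OF A] by simp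
    also have "\<dots> = l (g (f \<sigma> ` A))" using fm[OF \<sigma> A] lg[OF fA] by simp
    finally have "\<rho> \<sigma> ` g A = g (f \<sigma> ` A)"
      using l g_in[OF fA] permutes_image_pairs5[OF perm[OF \<rho> \<sigma>] g_in[OF A]]
      by (auto simp: bij_betw_def dest: inj_onD)
    then show "(\<rho> \<sigma> \<circ> \<pi>) ` A = (\<pi> \<circ> f \<sigma>) ` A" using g\<pi> A fA by (simp add: image_comp)
  qed
  have f_eq: "f \<sigma> = inv' \<pi> \<circ> \<rho> \<sigma> \<circ> \<pi>" if "\<sigma> \<in> ?G" for \<sigma>
  proof -
    have "inv' \<pi> \<circ> \<rho> \<sigma> \<circ> \<pi> = (inv' \<pi> \<circ> \<pi>) \<circ> f \<sigma>" using key[OF that] by (simp add: comp_assoc)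
    then show ?thesis using \<pi> by (simp add: permutes_inv_o)
  qed
  have p: "inv' \<pi> permutes {1..5}" using \<pi> by (rule permutes_inv)
  have inv: "inv\<^bsub>sym_group 5\<^esub> (inv' \<pi>) = \<pi>"
    using sym_group_inv_equality[of "inv' \<pi>" 5] p permutes_inv_inv[OF \<pi>] by (simp add: sym_group_carrier)
  have "f = (\<lambda>\<sigma> \<in> ?G. inv' \<pi> \<circ> \<rho> \<sigma> \<circ> inv\<^bsub>sym_group 5\<^esub> (inv' \<pi>))"
    unfolding inv
  proof (rule extensionalityI[of _ ?G])
    show "f \<in> extensional ?G" using f by (simp add: galois_homs_def)
  qed (auto simp: f_eq)
  then show "f \<in> S5_conj_class \<rho>"
    unfolding S5_conj_class_def mem_Collect_eq
    by (intro exI[of _ "inv' \<pi>"] conjI) (simp_all only: sym_group_carrier p)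
qed

text \<open>Over a finite field, one plus the product of all x - a is a nonconstant polynomial
  without roots.\<close>

lemma infinite_alg_closed_field: "infinite (UNIV :: 'a::alg_closed_field set)"
proof
  assume fin: "finite (UNIV :: 'a set)"
  define p where "p = (\<Prod>a\<in>(UNIV :: 'a set). [:- a, 1:]) + 1"
  have deg: "degree (\<Prod>a\<in>(UNIV :: 'a set). [:- a, 1:]) = card (UNIV :: 'a set)"
    by (subst degree_prod_eq_sum_degree) auto
  have "card (UNIV :: 'a set) > 0" using fin by (simp add: card_gt_0_iff)
  then have "degree p > 0"
    unfolding p_def by (subst degree_add_eq_left) (simp_all add: deg)
  then obtain x where "poly p x = 0" using alg_closed_imp_poly_has_root by blast
  moreover have "poly p x = 1" for x
    using fin by (auto simp: p_def poly_prod)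
  ultimately show False by simp
qed

lemma lookup_const_mult:
  fixes p :: "('n, 'a::comm_ring_1) mpoly"
  shows "lookup (mpoly_const c * p) e = c * lookup p e"
  unfolding mpoly_const_def mult_map_scale_conv_mult[symmetric]
  by (simp add: Poly_Mapping.map.rep_eq when_def)

text \<open>The situation is symmetric in \<open>M\<close> and \<open>N\<close>, so one inclusion,
  proved for arbitrary systems and matrices, yields both.\<close>

lemma lines_on_linear_change:
  fixes \<phi> \<psi> :: "'m::finite \<Rightarrow> ('n::finite, 'a::field) mpoly"
  assumes M: "\<And>i. \<phi> i = lin_comb (M $ i) \<psi>"
    and N: "\<And>i. \<psi> i = lin_comb (N $ i) \<phi>"
    and inv: "N ** M = mat 1"
  shows "lines_on (rational_map_image \<phi>) = (\<lambda>W. (*v) M ` W) ` lines_on (rational_map_image \<psi>)"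
proof -
  have inv': "M ** N = mat 1" using inv by (simp add: matrix_left_right_inverse)
  have NM: "N *v (M *v v) = v" and MN: "M *v (N *v v) = v" for v
    by (simp_all add: matrix_vector_mul_assoc inv inv')
  have dim: "vec.dim ((*v) A ` W) = vec.dim W" if "\<And>v. B *v (A *v v) = v" for A B :: "'a^'m^'m" and W
    by (rule vec.dim_image_eq) (auto simp: inj_on_def intro: inj_onI dest: arg_cong[of _ _ "(*v) B"] simp: that)
  have sub: "vec.subspace ((*v) A ` W)" if "vec.subspace W" for A :: "'a^'m^'m" and W
    by (rule vec.subspace_image) (simp_all add: that)
  have line_image: "(*v) A ` W \<in> lines_on (rational_map_image f)"
    if W: "W \<in> lines_on (rational_map_image f')"
      and A: "\<And>i. f i = (\<Sum>j\<in>UNIV. mpoly_const (A $ i $ j) * f' j)"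
      and B: "B ** A = mat 1" for A B W and f f' :: "'m \<Rightarrow> ('n, 'a) mpoly"
  proof -
    have BA: "B *v (A *v v) = v" for v by (simp add: matrix_vector_mul_assoc B)
    have "on_image f v" if v: "v \<in> (*v) A ` W" "v \<noteq> 0" for v
    proof -
      obtain w where w: "w \<in> W" "v = A *v w" using v(1) by blast
      then have "w \<noteq> 0" using v(2) by (auto simp: matrix_vector_mult_0_right)
      then have "on_image f' w" using W w(1) unfolding lines_on_image by blast
      then show ?thesis unfolding w(2) by (rule on_image_linear_change[OF A B])
    qed
    then show ?thesis
      using W sub[of W A] dim[OF BA, of W] unfolding lines_on_image by simp
  qed
  show ?thesis
  proof (intro equalityI subsetI)
    fix W assume "W \<in> lines_on (rational_map_image \<phi>)"
    then have "(*v) N ` W \<in> lines_on (rational_map_image \<psi>)"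
      by (rule line_image[OF _ N inv'])
    moreover have "W = (*v) M ` (*v) N ` W" by (simp add: image_comp comp_def MN)
    ultimately show "W \<in> (\<lambda>W. (*v) M ` W) ` lines_on (rational_map_image \<psi>)" by blast
  next
    fix W assume "W \<in> (\<lambda>W. (*v) M ` W) ` lines_on (rational_map_image \<psi>)"
    then show "W \<in> lines_on (rational_map_image \<phi>)"
      using line_image[OF _ M inv] by blast
  qed
qed

section \<open>The class of a seed surface\<close>

locale marked_seed =
  fixes Q :: "'k::field poly" and P :: "nat \<Rightarrow> 'k alg_closure"
  assumes seed: "is_seed Q" and P: "bij_betw P {1..5} (roots_in_closure Q)"
begin

abbreviation QK :: "'k alg_closure poly" where "QK \<equiv> map_poly to_ac Q"

lemma coeff_QK: "coeff QK n = to_ac (coeff Q n)"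
  by (simp add: coeff_map_poly)

lemma degree_QK: "degree QK = 5"
  using seed by (subst degree_map_poly) (auto simp: is_seed_def)

text \<open>Five distinct roots exhaust the degree, so \<open>QK\<close> and the product of the
  linear factors differ by a constant, which is 1 because both are monic.\<close>

sublocale split_quintic QK "roots_in_closure Q"
proof
  let ?R = "roots_in_closure Q"
  show inf: "infinite (UNIV :: 'k alg_closure set)" by (rule infinite_alg_closed_field)
  show card: "card ?R = 5" using bij_betw_same_card[OF P] by simp
  then have fin: "finite ?R" by (simp add: card_ge_0_finite)
  let ?p = "\<Prod>a\<in>?R. [:- a, 1:]"
  have "?p ^ 1 dvd QK"
    by (rule square_factors_dvd[OF fin]) (simp add: roots_in_closure_def poly_eq_0_iff_dvd)
  then obtain g where g: "QK = ?p * g" by auto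
  have deg: "degree ?p = 5"
    by (subst degree_prod_eq_sum_degree) (auto simp: card)
  have "g \<noteq> 0" using g degree_QK by auto
  moreover have "?p \<noteq> 0" using deg by auto
  ultimately have "degree g = 0" using degree_QK deg by (simp add: g degree_mult_eq)
  then obtain c where c: "g = [:c:]" by (metis degree_eq_zeroE)
  have "Polynomial.lead_coeff QK = 1"
    using seed unfolding degree_QK coeff_QK is_seed_def by (metis to_ac_1)
  moreover have "Polynomial.lead_coeff QK = c"
    unfolding g lead_coeff_mult by (simp add: c lead_coeff_prod)
  ultimately show "QK = ?p" using g c by simp
qed

lemma seed_quintics_eq: "seed_quintics Q = singular_quintics"
  unfolding seed_quintics_def singular_quintics_def base_points_def by blast

lemma standard_basis_defined_over: "defined_over_ground_field (standard_basis QK i)"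
proof -
  note rules = defined_over_add defined_over_diff defined_over_mult defined_over_var
    defined_over_const[OF rangeI]
  have one: "defined_over_ground_field (1 :: (3, 'k alg_closure) mpoly)"
    using defined_over_const[of "1 :: 'k alg_closure"] range_eqI[of 1 to_ac 1] by (simp add: mpoly_const_def)
  have pow: "defined_over_ground_field (p ^ n)" if "defined_over_ground_field p"
    for p :: "(3, 'k alg_closure) mpoly" and n
    using that by (induction n) (auto intro: one defined_over_mult)
  have two: "2 = (1 + 1 :: (3, 'k alg_closure) mpoly)" by simp
  have c: "defined_over_ground_field (conic_form :: (3, 'k alg_closure) mpoly)"
    unfolding conic_def by (intro rules pow)
  have r0: "defined_over_ground_field (cubic0_form QK)"
    unfolding cubic0_def coeff_QK by (intro rules pow)
  have r1: "defined_over_ground_field (cubic1_form QK)"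
    unfolding cubic1_def coeff_QK by (intro rules pow)
  have q: "defined_over_ground_field (quintic_form QK)"
    unfolding quintic_def coeff_QK Let_def two by (intro rules pow one c)
  show ?thesis
  proof -
    have "defined_over_ground_field (conic_form ^ 2 * mpoly_var j :: (3, 'k alg_closure) mpoly)" for j
      by (intro rules pow c)
    moreover have "defined_over_ground_field (conic_form * cubic0_form QK)"
      "defined_over_ground_field (conic_form * cubic1_form QK)"
      using defined_over_mult c r0 r1 by blast+
    ultimately show ?thesis
      using exhaust_6[of i] q by (auto simp: standard_basis_def quintic_system_def)
  qed
qed

lemma standard_seed_basis: "is_seed_basis Q (standard_basis QK)"
  unfolding is_seed_basis_def seed_quintics_eq
  using standard_basis_singular standard_basis_defined_over standard_basis_unique by blast

section \<open>The Galois action on the roots and on the lines\<close>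

lemma galois_permutes_roots:
  assumes "\<sigma> \<in> Gal"
  shows "\<sigma> ` roots_in_closure Q = roots_in_closure Q"
proof -
  interpret coeff_hom \<sigma> by (rule absolute_galois_group_hom[OF assms])
  have "poly QK (\<sigma> x) = \<sigma> (poly QK x)" for x
    by (simp add: poly_altdef hom_sum hom_mult hom_power coeff_QK absolute_galois_groupD(4)[OF assms])
  then have "\<sigma> ` roots_in_closure Q \<subseteq> roots_in_closure Q"
    by (auto simp: roots_in_closure_def)
  then show ?thesis
    using absolute_galois_groupD(1)[OF assms] finite_roots
    by (intro endo_inj_surj) (auto simp: bij_def inj_on_def)
qed

lemma P_inj: "i \<in> {1..5} \<Longrightarrow> j \<in> {1..5} \<Longrightarrow> P i = P j \<longleftrightarrow> i = j"
  and P_root: "i \<in> {1..5} \<Longrightarrow> P i \<in> roots_in_closure Q"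
  using P unfolding bij_betw_def by (auto dest: inj_onD simp del: atLeastAtMost_iff)

abbreviation \<rho> where "\<rho> \<equiv> root_representation P"

lemma root_representation:
  assumes "\<sigma> \<in> Gal"
  shows "\<rho> \<sigma> permutes {1..5}" and "i \<in> {1..5} \<Longrightarrow> P (\<rho> \<sigma> i) = \<sigma> (P i)"
proof -
  have rho: "\<rho> \<sigma> i = (if i \<in> {1..5} then inv_into {1..5} P (\<sigma> (P i)) else i)" for i
    using assms by (simp add: root_representation_def)
  have "bij_betw \<sigma> (roots_in_closure Q) (roots_in_closure Q)"
    using galois_permutes_roots[OF assms] absolute_galois_groupD(1)[OF assms]
    unfolding bij_betw_def bij_def by (auto simp: inj_on_def)
  then have "bij_betw (inv_into {1..5} P \<circ> (\<sigma> \<circ> P)) {1..5} {1..5}"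
    using P by (meson bij_betw_inv_into bij_betw_trans)
  then have "bij_betw (\<rho> \<sigma>) {1..5} {1..5}"
    by (rule bij_betw_cong[THEN iffD1, rotated]) (simp add: rho)
  then show "\<rho> \<sigma> permutes {1..5}"
    by (rule bij_imp_permutes) (simp add: rho del: atLeastAtMost_iff)
  assume i: "i \<in> {1..5}"
  have "\<sigma> (P i) \<in> P ` {1..5}"
    using P galois_permutes_roots[OF assms] P_root[OF i] unfolding bij_betw_def by blast
  then show "P (\<rho> \<sigma> i) = \<sigma> (P i)" using i by (simp add: rho f_inv_into_f del: atLeastAtMost_iff)
qed

text \<open>A permutation is determined by its effect on the distinct roots; multiplicativity and
  continuity of the representation both follow from this.\<close>

lemma root_representation_eqI:
  assumes \<sigma>: "\<sigma> \<in> Gal" and \<tau>: "\<tau> permutes {1..5}"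
    and eq: "\<And>i. i \<in> {1..5} \<Longrightarrow> P (\<tau> i) = \<sigma> (P i)"
  shows "\<rho> \<sigma> = \<tau>"
proof
  fix i
  show "\<rho> \<sigma> i = \<tau> i"
  proof (cases "i \<in> {1..5}")
    case True
    have "P (\<rho> \<sigma> i) = P (\<tau> i)" using root_representation(2)[OF \<sigma> True] eq[OF True] by simp
    then show ?thesis
      using P True permutes_in_image[OF root_representation(1)[OF \<sigma>]] permutes_in_image[OF \<tau>]
      unfolding bij_betw_def by (auto dest: inj_onD simp del: atLeastAtMost_iff)
  next
    case False
    then show ?thesis using permutes_not_in root_representation(1)[OF \<sigma>] \<tau> by metis
  qed
qed

lemma root_representation_galois_hom: "\<rho> \<in> galois_homs"
proof -
  let ?G = "Gal :: ('k alg_closure \<Rightarrow> 'k alg_closure) set"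
  have "\<rho> \<in> hom absolute_galois_group (sym_group 5)"
  proof (rule homI)
    fix \<sigma> assume "\<sigma> \<in> ?G"
    then show "\<rho> \<sigma> \<in> carrier (sym_group 5)" using root_representation(1) by (simp only: sym_group_carrier)
  next
    fix \<sigma> \<tau> assume st: "\<sigma> \<in> ?G" "\<tau> \<in> ?G"
    have "\<rho> (\<sigma> \<circ> \<tau>) = \<rho> \<sigma> \<circ> \<rho> \<tau>"
    proof (rule root_representation_eqI[OF absolute_galois_group_closed[OF st]])
      show "\<rho> \<sigma> \<circ> \<rho> \<tau> permutes {1..5}"
        using root_representation(1) st by (intro permutes_compose)
      fix i :: nat assume i: "i \<in> {1..5}"
      then have "\<rho> \<tau> i \<in> {1..5}" using permutes_in_image[OF root_representation(1)[OF st(2)]] by blast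
      then show "P ((\<rho> \<sigma> \<circ> \<rho> \<tau>) i) = (\<sigma> \<circ> \<tau>) (P i)"
        using root_representation(2) st i by simp
    qed
    then show "\<rho> (\<sigma> \<otimes>\<^bsub>absolute_galois_group\<^esub> \<tau>) = \<rho> \<sigma> \<otimes>\<^bsub>sym_group 5\<^esub> \<rho> \<tau>"
      by (simp add: absolute_galois_group_mult[OF st] sym_group_mult)
  qed
  moreover have "\<rho> \<in> extensional ?G" by (simp add: root_representation_def)
  \<comment> \<open>The finite set of roots is the witness of continuity.\<close>
  moreover have "\<rho> \<sigma> = id" if "\<sigma> \<in> ?G" "\<forall>x\<in>roots_in_closure Q. \<sigma> x = x" for \<sigma>
    by (rule root_representation_eqI[OF that(1) permutes_id]) (use that(2) P_root in auto)
  ultimately show ?thesis unfolding galois_homs_def using finite_roots by blast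
qed

text \<open>The points of the line are given by polynomials in \<open>e1\<close>, \<open>e2\<close>,
  the parameters and the coefficients of Q. The latter are fixed by \<sigma>, and the parameters
  still run through everything because \<sigma> is bijective.\<close>

lemma galois_act_surface_line:
  assumes "\<sigma> \<in> Gal"
  shows "galois_act \<sigma> ` surface_line cf e1 e2 = surface_line cf (\<sigma> e1) (\<sigma> e2)"
proof -
  interpret coeff_hom \<sigma> by (rule absolute_galois_group_hom[OF assms])
  have cf: "\<sigma> (cf n) = cf n" for n by (simp add: coeff_QK absolute_galois_groupD(4)[OF assms])
  have minus: "\<sigma> (- x) = - \<sigma> x" for x using hom_diff[of 0 x] by simp
  have act: "galois_act \<sigma> (line_vec cf e1 e2 y z) = line_vec cf (\<sigma> e1) (\<sigma> e2) (\<sigma> y) (\<sigma> z)" for y z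
    unfolding vec6_eq_iff galois_act_def vec_lambda_beta line_vec_nth quot0_def quot1_def quot2_def Let_def
    by (simp only: hom_add hom_diff hom_mult hom_power hom_numeral minus cf simp_thms)
  have surj: "\<exists>y'. \<sigma> y' = y" for y using absolute_galois_groupD(1)[OF assms] by (metis bij_pointE)
  show ?thesis
  proof (intro equalityI subsetI)
    fix v assume "v \<in> galois_act \<sigma> ` surface_line cf e1 e2"
    then obtain y z where "v = galois_act \<sigma> (line_vec cf e1 e2 y z)"
      unfolding surface_line_def by blast
    then have "v = line_vec cf (\<sigma> e1) (\<sigma> e2) (\<sigma> y) (\<sigma> z)" by (simp only: act)
    then show "v \<in> surface_line cf (\<sigma> e1) (\<sigma> e2)" unfolding surface_line_def by blast
  next
    fix v assume "v \<in> surface_line cf (\<sigma> e1) (\<sigma> e2)"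
    then obtain y z where "v = line_vec cf (\<sigma> e1) (\<sigma> e2) y z" unfolding surface_line_def by blast
    moreover obtain y' z' where "\<sigma> y' = y" "\<sigma> z' = z" using surj by metis
    ultimately have "v = galois_act \<sigma> (line_vec cf e1 e2 y' z')" by (simp add: act)
    then show "v \<in> galois_act \<sigma> ` surface_line cf e1 e2" unfolding surface_line_def by blast
  qed
qed

text \<open>Sum and product are independent of an ordering of the pair and can be reindexed along
  permutations, which makes equivariance immediate.\<close>

definition standard_line :: "nat set \<Rightarrow> ('k alg_closure^6) set" where
  "standard_line A = surface_line cf (sum P A) (prod P A)"

lemma standard_line_marking:
  "is_line_marking (rational_map_image (standard_basis QK)) standard_line"
proof -
  let ?F = "rational_map_image (standard_basis QK)"
  have pair: "standard_line {i, j} = surface_line cf (P i + P j) (P i * P j)" if "i \<noteq> j" for i j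
    using that by (simp add: standard_line_def)
  have "inj_on standard_line pairs5"
  proof (rule inj_onI)
    fix A B assume A: "A \<in> pairs5" and B: "B \<in> pairs5" and eq: "standard_line A = standard_line B"
    obtain i j where ij: "i \<in> {1..5}" "j \<in> {1..5}" "i \<noteq> j" "A = {i, j}" using A by (rule pairs5E)
    obtain k l where kl: "k \<in> {1..5}" "l \<in> {1..5}" "k \<noteq> l" "B = {k, l}" using B by (rule pairs5E)
    have e: "P i + P j = P k + P l" "P i * P j = P k * P l"
      using eq surface_line_inj unfolding ij(4) kl(4) pair[OF ij(3)] pair[OF kl(3)] by blast+
    \<comment> \<open>The quadratic with roots \<open>P k\<close> and \<open>P l\<close> at the
      point \<open>P i\<close>; it is also the quadratic with roots \<open>P i\<close> and
      \<open>P j\<close>.\<close>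
    have "(P i - P k) * (P i - P l) = P i * P i - (P k + P l) * P i + P k * P l"
      by (simp add: algebra_simps)
    also have "\<dots> = 0" unfolding e[symmetric] by (simp add: algebra_simps)
    finally have "P i = P k \<or> P i = P l" by simp
    moreover have "P i = P k \<Longrightarrow> P j = P l" "P i = P l \<Longrightarrow> P j = P k" using e(1) by auto
    ultimately show "A = B" using P_inj ij kl by auto
  qed
  moreover have "standard_line ` pairs5 = lines_on ?F"
  proof (intro equalityI subsetI)
    fix W assume "W \<in> standard_line ` pairs5"
    then obtain A where "A \<in> pairs5" "W = standard_line A" by blast
    moreover from this(1) obtain i j where "i \<in> {1..5}" "j \<in> {1..5}" "i \<noteq> j" "A = {i, j}" by (rule pairs5E)
    ultimately show "W \<in> lines_on ?F"
      unfolding lines_on_standard_surface using pair P_inj P_root by blast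
  next
    fix W assume "W \<in> lines_on ?F"
    then obtain a b where ab: "a \<in> roots_in_closure Q" "b \<in> roots_in_closure Q" "a \<noteq> b"
      "W = surface_line cf (a + b) (a * b)"
      unfolding lines_on_standard_surface by blast
    then obtain i j where ij: "i \<in> {1..5}" "a = P i" "j \<in> {1..5}" "b = P j"
      using P unfolding bij_betw_def by blast
    then have "i \<noteq> j" using ab(3) by blast
    then have "W = standard_line {i, j}" "{i, j} \<in> pairs5"
      using ab(4) ij pair unfolding pair_in_pairs5 by auto
    then show "W \<in> standard_line ` pairs5" by blast
  qed
  moreover have "lines_meet (standard_line A) (standard_line B) \<longleftrightarrow> A \<inter> B = {}"
    if A: "A \<in> pairs5" and B: "B \<in> pairs5" and "A \<noteq> B" for A B
  proof -
    obtain i j where ij: "i \<in> {1..5}" "j \<in> {1..5}" "i \<noteq> j" "A = {i, j}" using A by (rule pairs5E)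
    obtain k l where kl: "k \<in> {1..5}" "l \<in> {1..5}" "k \<noteq> l" "B = {k, l}" using B by (rule pairs5E)
    have neg: "\<not> lines_meet (standard_line {a, b}) (standard_line {a, d})"
      if "a \<in> {1..5}" "b \<in> {1..5}" "d \<in> {1..5}" "a \<noteq> b" "a \<noteq> d" "b \<noteq> d" for a b d
      unfolding pair[OF that(4)] pair[OF that(5)]
      using that P_inj P_root by (intro incident_lines_disjoint) auto
    show ?thesis
    proof (cases "A \<inter> B = {}")
      case True
      then have "lines_meet (standard_line A) (standard_line B)"
        unfolding ij(4) kl(4) pair[OF ij(3)] pair[OF kl(3)]
        using ij kl P_inj P_root by (intro disjoint_lines_meet) auto
      with True show ?thesis by simp
    next
      case False
      then obtain a where a: "a \<in> A" "a \<in> B" by blast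
      obtain b where b: "A = {a, b}" "a \<noteq> b" "b \<in> {1..5}" using a(1) ij by auto
      obtain d where d: "B = {a, d}" "a \<noteq> d" "d \<in> {1..5}" using a(2) kl by auto
      have "a \<in> {1..5}" using a(1) ij by auto
      moreover have "b \<noteq> d" using b d \<open>A \<noteq> B\<close> by auto
      ultimately show ?thesis using neg b d False by simp
    qed
  qed
  ultimately show ?thesis unfolding is_line_marking_def bij_betw_def by blast
qed

lemma galois_act_standard_line:
  assumes \<sigma>: "\<sigma> \<in> Gal" and A: "A \<in> pairs5"
  shows "galois_act \<sigma> ` standard_line A = standard_line (\<rho> \<sigma> ` A)"
proof -
  interpret coeff_hom \<sigma> by (rule absolute_galois_group_hom[OF \<sigma>])
  have inj: "inj_on (\<rho> \<sigma>) A" using permutes_inj[OF root_representation(1)[OF \<sigma>]] inj_on_subset by blast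
  have eq: "P (\<rho> \<sigma> i) = \<sigma> (P i)" if "i \<in> A" for i
    using A that by (intro root_representation(2)[OF \<sigma>]) (auto simp: pairs5_def)
  have "\<sigma> (sum P A) = sum P (\<rho> \<sigma> ` A)" "\<sigma> (prod P A) = prod P (\<rho> \<sigma> ` A)"
    by (simp_all add: hom_sum hom_prod sum.reindex[OF inj] prod.reindex[OF inj] eq)
  then show ?thesis unfolding standard_line_def galois_act_surface_line[OF \<sigma>] by simp
qed

text \<open>Uniqueness of coordinates in the standard basis is used twice: it makes the two base
  changes inverse to each other, and it makes \<open>M\<close> invariant under the Galois group.
  Hence \<open>M\<close> carries the standard lines to an equivariant marking.\<close>

lemma corresponding_homs_seed_surface:
  assumes F: "is_seed_surface Q F"
  shows "corresponding_homs F = S5_conj_class \<rho>"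
proof -
  let ?\<psi> = "standard_basis QK"
  obtain \<phi> where \<phi>: "is_seed_basis Q \<phi>" and F: "F = rational_map_image \<phi>"
    using F unfolding is_seed_surface_def by blast
  have "\<forall>i. \<phi> i \<in> singular_quintics \<and> defined_over_ground_field (\<phi> i)"
    using \<phi> unfolding is_seed_basis_def seed_quintics_eq by (rule conjunct1)
  then have \<phi>_sing: "\<phi> i \<in> singular_quintics" and \<phi>_def: "defined_over_ground_field (\<phi> i)" for i
    by auto
  have \<phi>_basis: "\<forall>p\<in>singular_quintics. \<exists>!c :: 'k alg_closure^6. p = lin_comb c \<phi>"
    using \<phi> unfolding is_seed_basis_def seed_quintics_eq by (rule conjunct2)
  have "\<exists>c :: 'k alg_closure^6. \<phi> i = lin_comb c ?\<psi>" for i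
    by (rule singular_quintic_expand[OF \<phi>_sing])
  then obtain m where m: "\<And>i. \<phi> i = lin_comb (m i) ?\<psi>" by metis
  define M where "M = (\<chi> i. m i)"
  have M: "\<phi> i = lin_comb (M $ i) ?\<psi>" for i using m[of i] by (simp add: M_def)
  have "\<exists>c :: 'k alg_closure^6. ?\<psi> i = lin_comb c \<phi>" for i
    by (rule ex1_implies_ex[OF bspec[OF \<phi>_basis standard_basis_singular]])
  then obtain n where n: "\<And>i. ?\<psi> i = lin_comb (n i) \<phi>" by metis
  define N where "N = (\<chi> i. n i)"
  have N: "?\<psi> i = lin_comb (N $ i) \<phi>" for i using n[of i] by (simp add: N_def)
  note hom_c = coeff_hom.hom_sum[OF coeff_hom_mpoly_const] coeff_hom.hom_mult[OF coeff_hom_mpoly_const]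
  have NM: "N ** M = mat 1"
  proof -
    have "(N ** M) $ i = mat 1 $ i" for i
    proof (rule standard_basis_inject)
      have "lin_comb (mat 1 $ i) ?\<psi> = (\<Sum>j\<in>UNIV. if j = i then ?\<psi> i else 0)"
        by (rule sum.cong) (auto simp: mat_def mpoly_const_def)
      then have one: "lin_comb (mat 1 $ i) ?\<psi> = ?\<psi> i" by simp
      have "?\<psi> i = (\<Sum>k\<in>UNIV. mpoly_const (N $ i $ k) * (lin_comb (M $ k) ?\<psi>))"
        using N[of i] unfolding M .
      also have "\<dots> = (\<Sum>j\<in>UNIV. \<Sum>k\<in>UNIV. mpoly_const (N $ i $ k) * (mpoly_const (M $ k $ j) * ?\<psi> j))"
        unfolding sum_distrib_left by (rule sum.swap)
      also have "\<dots> = lin_comb ((N ** M) $ i) ?\<psi>"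
        by (simp add: matrix_matrix_mult_def hom_c sum_distrib_right mult.assoc)
      finally show "lin_comb ((N ** M) $ i) ?\<psi> = lin_comb (mat 1 $ i) ?\<psi>"
        using one by simp
    qed
    then show ?thesis by (simp add: vec_eq_iff)
  qed
  have M_inj: "inj ((*v) M)"
    by (rule inj_on_inverseI[of _ "(*v) N"]) (simp add: matrix_vector_mul_assoc NM)
  \<comment> \<open>The coefficients of both bases lie in the ground field, so applying \<sigma> to
    an expansion yields a second expansion of the same form.\<close>
  have fixed: "\<sigma> (M $ i $ j) = M $ i $ j" if \<sigma>: "\<sigma> \<in> Gal" for \<sigma> i j
  proof -
    interpret coeff_hom \<sigma> by (rule absolute_galois_group_hom[OF \<sigma>])
    have fix_coeff: "\<sigma> (lookup p e) = lookup p e" if "defined_over_ground_field p"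
      for p :: "(3, 'k alg_closure) mpoly" and e
      using that absolute_galois_groupD(4)[OF \<sigma>] unfolding defined_over_ground_field_def
      by (metis (no_types, lifting) rangeE)
    have "M $ i = (\<chi> j. \<sigma> (M $ i $ j))"
    proof (rule standard_basis_inject)
      show "lin_comb (M $ i) ?\<psi> = lin_comb (\<chi> j. \<sigma> (M $ i $ j)) ?\<psi>"
      proof (rule poly_mapping_eqI)
        fix e
        have "lookup (\<phi> i) e = \<sigma> (lookup (\<phi> i) e)"
          by (simp add: fix_coeff \<phi>_def)
        also have "\<dots> = (\<Sum>j\<in>UNIV. \<sigma> (M $ i $ j) * lookup (?\<psi> j) e)"
          unfolding M[of i]
          by (simp add: lookup_sum lookup_const_mult hom_sum hom_mult fix_coeff standard_basis_defined_over)
        finally show "lookup (lin_comb (M $ i) ?\<psi>) e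
            = lookup (lin_comb (\<chi> j. \<sigma> (M $ i $ j)) ?\<psi>) e"
          unfolding M[of i, symmetric] by (simp add: lookup_sum lookup_const_mult)
      qed
    qed
    then show ?thesis by (metis vec_lambda_beta)
  qed
  have lines: "lines_on F = (\<lambda>W. (*v) M ` W) ` lines_on (rational_map_image ?\<psi>)"
    unfolding F by (rule lines_on_linear_change[OF M N NM])
  let ?l = "\<lambda>A. (*v) M ` standard_line A"
  have marking: "bij_betw standard_line pairs5 (lines_on (rational_map_image ?\<psi>))"
    "\<And>A B. A \<in> pairs5 \<Longrightarrow> B \<in> pairs5 \<Longrightarrow> A \<noteq> B \<Longrightarrow> lines_meet (standard_line A) (standard_line B) \<longleftrightarrow> A \<inter> B = {}"
    using standard_line_marking unfolding is_line_marking_def by auto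
  show ?thesis
  proof (rule corresponding_homs_eq[where l = ?l, OF _ root_representation_galois_hom])
    have "bij_betw (\<lambda>W. (*v) M ` W) (lines_on (rational_map_image ?\<psi>)) (lines_on F)"
      unfolding lines bij_betw_def using M_inj by (auto simp: inj_on_def inj_image_eq_iff)
    from bij_betw_trans[OF marking(1) this] have "bij_betw ?l pairs5 (lines_on F)" by (simp add: comp_def)
    moreover have "lines_meet ((*v) M ` W) ((*v) M ` W') \<longleftrightarrow> lines_meet W W'" for W W'
    proof -
      have "(*v) M ` {0} = {0}" by (simp add: matrix_vector_mult_0_right)
      then show ?thesis
        unfolding lines_meet_def image_Int[OF M_inj, symmetric] using inj_image_eq_iff[OF M_inj] by metis
    qed
    ultimately show "is_line_marking F ?l" unfolding is_line_marking_def using marking(2) by blast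
  next
    fix \<sigma> :: "'k alg_closure \<Rightarrow> 'k alg_closure" and A
    assume \<sigma>: "\<sigma> \<in> Gal" and A: "A \<in> pairs5"
    interpret coeff_hom \<sigma> by (rule absolute_galois_group_hom[OF \<sigma>])
    have "galois_act \<sigma> (M *v v) = M *v galois_act \<sigma> v" for v
      by (simp add: vec_eq_iff galois_act_def matrix_vector_mult_def hom_sum hom_mult fixed[OF \<sigma>])
    then have "galois_act \<sigma> ` ?l A = (*v) M ` galois_act \<sigma> ` standard_line A"
      by (simp add: image_image)
    then show "galois_act \<sigma> ` ?l A = ?l (\<rho> \<sigma> ` A)" using galois_act_standard_line[OF \<sigma> A] by simp
  qed
qed

end

section \<open>Realizing a permutation representation by a quintic\<close>

text \<open>Affine rather than linear, because single values that are already taken have to be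
  avoided along with fixed subfields.\<close>

definition affine_closed :: "'k::field alg_closure set \<Rightarrow> bool" where
  "affine_closed A \<longleftrightarrow> (\<forall>x\<in>A. \<forall>y\<in>A. \<forall>t. to_ac (1 - t) * x + to_ac t * y \<in> A)"

text \<open>A line through a point of \<open>V\<close> outside all \<open>A j\<close> but one meets each \<open>A j\<close> at most once.\<close>

lemma avoid_affine_closed:
  fixes V :: "'k::field alg_closure set"
  assumes "finite J" "affine_closed V" "V \<noteq> {}"
    and "\<And>j. j \<in> J \<Longrightarrow> affine_closed (A j) \<and> \<not> V \<subseteq> A j"
    and "infinite (UNIV :: 'k set) \<or> card J < card (UNIV :: 'k set)"
  shows "\<exists>x\<in>V. \<forall>j\<in>J. x \<notin> A j"
  using assms(1,4,5)
proof (induction J)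
  case empty
  then show ?case using assms(3) by auto
next
  case (insert j J)
  then obtain x where x: "x \<in> V" "\<And>i. i \<in> J \<Longrightarrow> x \<notin> A i" by force
  show ?case
  proof (cases "x \<in> A j")
    case True
    obtain y where y: "y \<in> V" "y \<notin> A j" using insert.prems(1)[of j] by blast
    \<comment> \<open>The line through \<open>x\<close>, which avoids the old sets, and
      \<open>y\<close>, which avoids the new one; its points are indexed by the ground
      field.\<close>
    define z where "z = (\<lambda>t::'k. to_ac (1 - t) * x + to_ac t * y)"
    have z_V: "z t \<in> V" for t using assms(2) x(1) y(1) unfolding affine_closed_def z_def by blast
    have comb: "to_ac (1 - u) * z t + to_ac u * z s = z ((1 - u) * t + u * s)" for u t s
      unfolding z_def by (simp add: algebra_simps)
    have z01: "z 0 = x" "z 1 = y" by (simp_all add: z_def)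
    have closed: "z ((1 - u) * t + u * s) \<in> A i"
      if "i \<in> insert j J" "z t \<in> A i" "z s \<in> A i" for i u t s
      using insert.prems(1)[OF that(1)] that(2,3) unfolding affine_closed_def comb[symmetric] by blast
    \<comment> \<open>Two points of the line in \<open>A i\<close> bring in the whole line:
      \<open>u\<close> is solved for so that the combination of \<open>t\<close> and
      \<open>s\<close> is \<open>r\<close>.\<close>
    have line: "z r \<in> A i" if "i \<in> insert j J" "z t \<in> A i" "z s \<in> A i" "t \<noteq> s" for i t s r
    proof -
      have "(1 - (r - t) / (s - t)) * t + (r - t) / (s - t) * s = t + (r - t) / (s - t) * (s - t)"
      proof -
        have "(1 - u) * t + u * s = t + u * (s - t)" for u by (simp add: algebra_simps)
        then show ?thesis .
      qed
      also have "\<dots> = r" using that(4) by simp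
      finally show ?thesis using closed[OF that(1-3), of "(r - t) / (s - t)"] by simp
    qed
    show ?thesis
    proof (rule ccontr)
      assume "\<not> ?thesis"
      then have "\<forall>t. \<exists>i\<in>insert j J. z t \<in> A i" using z_V by blast
      then obtain c where c: "\<And>t. c t \<in> insert j J" "\<And>t. z t \<in> A (c t)" by metis
      \<comment> \<open>A set with two points of the line would contain \<open>x\<close> and
        \<open>y\<close>, and no set does. So the parameters inject into the sets, of which there
        are too few.\<close>
      have "inj c"
      proof (rule injI, rule ccontr)
        fix t s assume ts: "c t = c s" "t \<noteq> s"
        have "z s \<in> A (c t)" using c(2)[of s] ts(1) by simp
        then have "z r \<in> A (c t)" for r using ts(2) by (rule line[OF c(1) c(2)])
        then have "x \<in> A (c t)" "y \<in> A (c t)" using z01 by metis+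
        then show False using x(2) y(2) c(1)[of t] by auto
      qed
      moreover have "range c \<subseteq> insert j J" using c(1) by blast
      ultimately have "finite (UNIV :: 'k set)" "card (UNIV :: 'k set) \<le> card (insert j J)"
        using insert.hyps(1) by (meson finite_imageD finite_insert finite_subset, meson card_inj_on_le finite_insert)
      then show False using insert.prems(2) by linarith
    qed
  qed (use x in blast)
qed

section \<open>The Galois group of L and its faithful action on five points\<close>

locale galois_representation =
  fixes L :: "'k::field alg_closure set" and f :: "('k alg_closure \<Rightarrow> 'k alg_closure) \<Rightarrow> nat \<Rightarrow> nat"
  assumes galois: "galois_extension L"
    and f_hom: "f \<in> hom (galois_group L) (sym_group 5)"
    and f_inj: "inj_on f (carrier (galois_group L))"
begin

abbreviation G where "G \<equiv> carrier (galois_group L)"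

lemma L_closed:
  "to_ac a \<in> L" "0 \<in> L" "1 \<in> L" "x \<in> L \<Longrightarrow> y \<in> L \<Longrightarrow> x + y \<in> L" "x \<in> L \<Longrightarrow> y \<in> L \<Longrightarrow> x * y \<in> L"
proof -
  have "subring L ring_of_type_algebra" and sub: "range to_ac \<subseteq> L"
    using galois subfieldE(1) unfolding galois_extension_def by auto
  note s = subringE[OF this(1), unfolded ring_of_type_algebra_def, simplified]
  show "to_ac a \<in> L" using sub by blast
  show "0 \<in> L" "1 \<in> L" "x \<in> L \<Longrightarrow> y \<in> L \<Longrightarrow> x + y \<in> L" "x \<in> L \<Longrightarrow> y \<in> L \<Longrightarrow> x * y \<in> L"
    using s by auto
qed

lemma minus_closed: "x \<in> L \<Longrightarrow> - x \<in> L"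
  using L_closed(5)[OF L_closed(1)[of "- 1"], of x] by simp

lemma G_apply:
  assumes "g \<in> G"
  shows "x \<in> L \<Longrightarrow> g x \<in> L" "x \<in> L \<Longrightarrow> y \<in> L \<Longrightarrow> g (x + y) = g x + g y"
    "x \<in> L \<Longrightarrow> y \<in> L \<Longrightarrow> g (x * y) = g x * g y" "g (to_ac a) = to_ac a" "inj_on g L" "g ` L = L"
    "g \<in> extensional L"
  using assms unfolding galois_group_simps Bij_def bij_betw_def by auto

lemma G_minus: "g \<in> G \<Longrightarrow> x \<in> L \<Longrightarrow> g (- x) = - g x"
  using G_apply(3)[OF _ L_closed(1)[of "- 1"], of g x] G_apply(4)[of g "- 1"] by simp

lemma diff_closed: "x \<in> L \<Longrightarrow> y \<in> L \<Longrightarrow> x - y \<in> L"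
  using L_closed(4)[OF _ minus_closed] by simp

lemma G_diff: "g \<in> G \<Longrightarrow> x \<in> L \<Longrightarrow> y \<in> L \<Longrightarrow> g (x - y) = g x - g y"
  using G_apply(2)[OF _ _ minus_closed] by (simp add: G_minus)

lemma G_0_1: "g \<in> G \<Longrightarrow> g 0 = 0" "g \<in> G \<Longrightarrow> g 1 = 1"
  using G_apply(4)[of g 0] G_apply(4)[of g 1] by auto

lemma G_sum:
  assumes "g \<in> G" "\<And>a. a \<in> S \<Longrightarrow> u a \<in> L"
  shows "sum u S \<in> L \<and> g (sum u S) = (\<Sum>a\<in>S. g (u a))"
  using assms(2)
proof (induction S rule: infinite_finite_induct)
  case (insert a S)
  then show ?case using G_apply(2)[OF assms(1)] L_closed(4) by simp
qed (simp_all add: G_0_1[OF assms(1)] L_closed)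

lemma G_ext: "g \<in> G \<Longrightarrow> h \<in> G \<Longrightarrow> (\<And>x. x \<in> L \<Longrightarrow> g x = h x) \<Longrightarrow> g = h"
  by (rule extensionalityI[OF G_apply(7) G_apply(7)])

lemma G_compose:
  assumes g: "g \<in> G" and h: "h \<in> G"
  shows "compose L g h \<in> G"
  unfolding galois_group_simps mem_Collect_eq
proof (intro conjI ballI allI)
  show "compose L g h \<in> Bij L"
    using g h unfolding galois_group_simps by (intro compose_Bij) simp_all
  fix x y assume xy: "x \<in> L" "y \<in> L"
  show "compose L g h (x + y) = compose L g h x + compose L g h y"
    using xy by (simp add: compose_eq L_closed(4) G_apply(1,2)[OF h] G_apply(2)[OF g])
  show "compose L g h (x * y) = compose L g h x * compose L g h y"
    using xy by (simp add: compose_eq L_closed(5) G_apply(1,3)[OF h] G_apply(3)[OF g])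
next
  fix a show "compose L g h (to_ac a) = to_ac a"
    by (simp add: compose_eq L_closed(1) G_apply(4)[OF h] G_apply(4)[OF g])
qed

lemma f_compose: "g \<in> G \<Longrightarrow> h \<in> G \<Longrightarrow> f (compose L g h) = f g \<circ> f h"
  using hom_mult[OF f_hom, of g h] galois_group_mult[of g L h] by (simp add: sym_group_mult)

lemma f_permutes: "g \<in> G \<Longrightarrow> f g permutes {1..5}"
  using hom_in_carrier[OF f_hom] by (simp only: sym_group_carrier)

text \<open>Finiteness comes from the embedding into the permutations of five points.\<close>

lemma finite_G: "finite G"
proof (rule finite_imageD[OF _ f_inj])
  show "finite (f ` G)"
    using f_permutes by (intro finite_subset[OF _ finite_permutations[of "{1..5::nat}"]]) auto
qed

lemma G_id: "(\<lambda>x\<in>L. x) \<in> G" "f (\<lambda>x\<in>L. x) = id"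
proof -
  let ?e = "\<lambda>x\<in>L. x"
  show e: "?e \<in> G" unfolding galois_group_simps using L_closed by (simp add: id_Bij)
  \<comment> \<open>The image of the identity is idempotent, and an injective idempotent map is the
    identity.\<close>
  have "compose L ?e ?e = ?e" by (auto simp: compose_def)
  then have "f ?e \<circ> f ?e = f ?e" using f_compose[OF e e] by simp
  then have idem: "f ?e (f ?e i) = f ?e i" for i by (metis comp_apply)
  show "f ?e = id"
  proof
    fix i show "f ?e i = id i"
      using injD[OF permutes_inj[OF f_permutes[OF e]] idem[of i]] by simp
  qed
qed

lemma G_inverse:
  assumes g: "g \<in> G"
  obtains h where "h \<in> G" "\<And>x. x \<in> L \<Longrightarrow> h (g x) = x" "\<And>x. x \<in> L \<Longrightarrow> g (h x) = x"
    "\<And>i. f h (f g i) = i" "\<And>i. f g (f h i) = i"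
proof -
  let ?h = "\<lambda>x\<in>L. inv_into L g x"
  have gB: "g \<in> Bij L" using g by (simp add: galois_group_simps)
  have hg: "?h (g x) = x" if "x \<in> L" for x
    using that G_apply(1,5)[OF g] by simp
  have gh: "g (?h x) = x" and h_in: "?h x \<in> L" if "x \<in> L" for x
    using that G_apply(6)[OF g] by (auto simp: f_inv_into_f inv_into_into)
  have h: "?h \<in> G"
    unfolding galois_group_simps mem_Collect_eq
  proof (intro conjI ballI allI restrict_inv_into_Bij[OF gB])
    fix x y assume xy: "x \<in> L" "y \<in> L"
    have "g (?h (x + y)) = g (?h x + ?h y)"
      using xy gh h_in L_closed(4) G_apply(2)[OF g] by (simp del: restrict_apply)
    then show "?h (x + y) = ?h x + ?h y"
      using xy h_in L_closed(4) inj_onD[OF G_apply(5)[OF g]] by (simp del: restrict_apply)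
    have "g (?h (x * y)) = g (?h x * ?h y)"
      using xy gh h_in L_closed(5) G_apply(3)[OF g] by (simp del: restrict_apply)
    then show "?h (x * y) = ?h x * ?h y"
      using xy h_in L_closed(5) inj_onD[OF G_apply(5)[OF g]] by (simp del: restrict_apply)
  next
    fix a show "?h (to_ac a) = to_ac a" using hg[OF L_closed(1), of a] G_apply(4)[OF g] by simp
  qed
  have "compose L ?h g = (\<lambda>x\<in>L. x)" "compose L g ?h = (\<lambda>x\<in>L. x)"
    using hg gh by (auto simp: compose_def fun_eq_iff simp del: restrict_apply simp: restrict_def)
  then have "f ?h \<circ> f g = id" "f g \<circ> f ?h = id"
    using f_compose[OF h g] f_compose[OF g h] G_id(2) by auto
  then show ?thesis using that[OF h] hg gh by (metis comp_apply id_apply)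
qed

lemma fixed_field: "x \<in> L \<Longrightarrow> (\<And>g. g \<in> G \<Longrightarrow> g x = x) \<Longrightarrow> x \<in> range to_ac"
  using galois unfolding galois_extension_def by blast

text \<open>Replacing y by z y and subtracting \<open>h z\<close> times the relation removes
  \<open>h\<close> and multiplies the coefficient of \<open>g\<close> by \<open>g z - h z\<close>,
  which is nonzero for a suitable z.\<close>

lemma dedekind_independence:
  assumes "finite S" "S \<subseteq> G" "\<And>y. y \<in> L \<Longrightarrow> (\<Sum>g\<in>S. c g * g y) = 0"
  shows "\<forall>g\<in>S. c g = 0"
  using assms
proof (induction S arbitrary: c)
  case (insert h S)
  have h: "h \<in> G" and S: "S \<subseteq> G" using insert.prems(1) by auto
  have c0: "c g = 0" if g: "g \<in> S" for g
  proof -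
    have "g \<noteq> h" using g insert.hyps by blast
    then obtain z where z: "z \<in> L" "g z \<noteq> h z" using G_ext[OF _ h] g S by blast
    have rel: "(\<Sum>g\<in>S. (c g * (g z - h z)) * g y) = 0" if y: "y \<in> L" for y
    proof -
      have "(\<Sum>g\<in>insert h S. c g * g (z * y)) = (\<Sum>g\<in>insert h S. c g * g z * g y)"
        using insert.prems(1) z(1) y G_apply(3) by (intro sum.cong) (auto simp: mult.assoc)
      then have "0 = (\<Sum>g\<in>insert h S. c g * g z * g y) - h z * (\<Sum>g\<in>insert h S. c g * g y)"
        using insert.prems(2)[OF L_closed(5)[OF z(1) y]] insert.prems(2)[OF y] by simp
      also have "\<dots> = (\<Sum>g\<in>insert h S. (c g * (g z - h z)) * g y)"
        by (simp only: sum_distrib_left sum_subtractf[symmetric]) (simp add: algebra_simps)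
      also have "\<dots> = (\<Sum>g\<in>S. (c g * (g z - h z)) * g y)"
        using insert.hyps by simp
      finally show ?thesis by simp
    qed
    have "c g * (g z - h z) = 0"
      using bspec[OF insert.IH[OF S, of "\<lambda>k. c k * (k z - h z)"] g] rel by simp
    then show ?thesis using z(2) by simp
  qed
  have "c h = 0"
    using insert.prems(2)[OF L_closed(3)] insert.hyps c0 G_0_1(2)[OF h] by simp
  with c0 show ?case by blast
qed simp

text \<open>If the fixed field of the stabiliser were fixed by \<open>s\<close>, the traces would give a linear
  relation between the elements of \<open>H\<close> and of the coset \<open>s H\<close>.\<close>

lemma stabilizer_fixed_point_moved:
  assumes s: "s \<in> G" "f s i \<noteq> i"
  shows "\<exists>x\<in>L. (\<forall>h\<in>G. f h i = i \<longrightarrow> h x = x) \<and> s x \<noteq> x"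
proof (rule ccontr)
  assume neg: "\<not> ?thesis"
  define H where "H = {h \<in> G. f h i = i}"
  have H: "H \<subseteq> G" "finite H" using finite_G by (auto simp: H_def)
  have comp_inj: "inj_on (compose L g) H" if "g \<in> G" for g
  proof (rule inj_onI)
    fix h h' assume hh: "h \<in> H" "h' \<in> H" "compose L g h = compose L g h'"
    have "h x = h' x" if "x \<in> L" for x
    proof -
      have "g (h x) = g (h' x)" using hh(3) that by (metis compose_eq)
      then show ?thesis using inj_onD[OF G_apply(5)[OF \<open>g \<in> G\<close>]] hh H(1) G_apply(1) that by blast
    qed
    then show "h = h'" using G_ext hh H(1) by blast
  qed
  \<comment> \<open>The trace from \<open>L\<close> to the fixed field of \<open>H\<close>.\<close>
  define t where "t = (\<lambda>y. \<Sum>h\<in>H. h y)"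
  have g_t: "t y \<in> L \<and> g (t y) = (\<Sum>h\<in>H. (compose L g h) y)" if "g \<in> G" "y \<in> L" for g y
  proof -
    have "t y \<in> L \<and> g (t y) = (\<Sum>h\<in>H. g (h y))"
      unfolding t_def using G_apply(1) that H(1) by (intro G_sum) auto
    then show ?thesis using that(2) by (simp add: compose_eq)
  qed
  have fixed: "h (t y) = t y" if h: "h \<in> H" and y: "y \<in> L" for h y
  proof -
    have hG: "h \<in> G" using h H(1) by blast
    have "compose L h ` H \<subseteq> H"
      using h G_compose f_compose unfolding H_def by auto
    then have im: "compose L h ` H = H" using comp_inj[OF hG] H(2) by (intro endo_inj_surj)
    have "h (t y) = (\<Sum>h'\<in>compose L h ` H. h' y)"
      using g_t[OF hG y] comp_inj[OF hG] by (simp add: sum.reindex)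
    then show ?thesis unfolding im t_def .
  qed
  define S where "S = H \<union> compose L s ` H"
  \<comment> \<open>Invariance of all traces under \<open>s\<close> is a relation with coefficients
    1 on \<open>H\<close> and -1 on the coset. It is nontrivial because the two are disjoint and
    \<open>H\<close> contains the identity.\<close>
  define c where "c = (\<lambda>g. if g \<in> H then 1 else - 1 :: 'k alg_closure)"
  have disj: "compose L s h \<notin> H" if "h \<in> H" for h
    using that s f_compose[OF s(1), of h] unfolding H_def by auto
  have "(\<Sum>g\<in>S. c g * g y) = 0" if y: "y \<in> L" for y
  proof -
    have "s (t y) = t y" using neg fixed[OF _ y] g_t[OF s(1) y] unfolding H_def by blast
    then have eq: "(\<Sum>h\<in>H. compose L s h y) = (\<Sum>h\<in>H. h y)" using g_t[OF s(1) y] by (simp add: t_def)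
    have "(\<Sum>g\<in>S. c g * g y) = (\<Sum>g\<in>H. c g * g y) + (\<Sum>g\<in>compose L s ` H. c g * g y)"
      unfolding S_def using H(2) disj by (intro sum.union_disjoint) auto
    also have "(\<Sum>g\<in>compose L s ` H. c g * g y) = (\<Sum>h\<in>H. c (compose L s h) * compose L s h y)"
      using comp_inj[OF s(1)] by (simp add: sum.reindex)
    also have "\<dots> = - (\<Sum>h\<in>H. compose L s h y)"
      using disj by (simp add: c_def sum_negf)
    also have "(\<Sum>g\<in>H. c g * g y) = (\<Sum>h\<in>H. h y)" by (simp add: c_def)
    finally show ?thesis using eq by simp
  qed
  then have "\<forall>g\<in>S. c g = 0"
    using H G_compose[OF s(1)] by (intro dedekind_independence) (auto simp: S_def)
  moreover have id: "(\<lambda>x\<in>L. x) \<in> H" using G_id by (simp add: H_def)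
  ultimately have "c (\<lambda>x\<in>L. x) = 0" unfolding S_def by blast
  then show False using id by (simp add: c_def)
qed

text \<open>The value x at a point i must be fixed by the stabiliser of i, and it determines the
  values on the orbit of i. Injectivity has to be arranged only against x: by equivariance, every
  coincidence that involves the orbit can be moved to the point i. This leaves at most four
  conditions.\<close>

lemma equivariant_injection:
  assumes large: "infinite (UNIV :: 'k set) \<or> 5 \<le> card (UNIV :: 'k set)"
    and "I \<subseteq> {1..5}" "\<And>g i. g \<in> G \<Longrightarrow> i \<in> I \<Longrightarrow> f g i \<in> I"
  shows "\<exists>a. (\<forall>i\<in>I. a i \<in> L) \<and> inj_on a I \<and> (\<forall>g\<in>G. \<forall>i\<in>I. g (a i) = a (f g i))"
  using finite_subset[OF assms(2) finite_atLeastAtMost] assms(2,3)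
proof (induction I rule: finite_psubset_induct)
  case (psubset I)
  show ?case
  proof (cases "I = {}")
    case False
    then obtain i where i: "i \<in> I" by blast
    define Orb where "Orb = {f g i | g. g \<in> G}"
    define I' where "I' = I - Orb"
    have i_O: "i \<in> Orb" unfolding Orb_def using G_id by (metis (mono_tags, lifting) id_apply mem_Collect_eq)
    have O_I: "Orb \<subseteq> I" unfolding Orb_def using psubset.prems(2) i by blast
    have I'_inv: "f g j \<in> I'" if g: "g \<in> G" and j: "j \<in> I'" for g j
    proof -
      have "f g j \<notin> Orb"
      proof
        assume "f g j \<in> Orb"
        then obtain h where h: "h \<in> G" "f g j = f h i" unfolding Orb_def by blast
        obtain g' where g': "g' \<in> G" "\<And>i. f g' (f g i) = i" using G_inverse[OF g] by metis
        have "j = f (compose L g' h) i" using f_compose[OF g'(1) h(1)] g'(2)[of j] h(2) by simp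
        then have "j \<in> Orb" unfolding Orb_def using G_compose[OF g'(1) h(1)] by blast
        with j show False by (simp add: I'_def)
      qed
      then show ?thesis using j g psubset.prems(2) by (simp add: I'_def)
    qed
    have "I' \<subset> I" using i i_O by (auto simp: I'_def)
    then have "\<exists>a. (\<forall>j\<in>I'. a j \<in> L) \<and> inj_on a I' \<and> (\<forall>g\<in>G. \<forall>j\<in>I'. g (a j) = a (f g j))"
      using psubset.prems(1) I'_inv by (intro psubset.IH) auto
    then obtain a where a: "\<And>j. j \<in> I' \<Longrightarrow> a j \<in> L" "inj_on a I'"
      "\<And>g j. g \<in> G \<Longrightarrow> j \<in> I' \<Longrightarrow> g (a j) = a (f g j)"
      by blast
    have "\<forall>j\<in>Orb. \<exists>g\<in>G. f g i = j" unfolding Orb_def by blast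
    then obtain r where r: "\<And>j. j \<in> Orb \<Longrightarrow> r j \<in> G" "\<And>j. j \<in> Orb \<Longrightarrow> f (r j) i = j" by metis
    define V where "V = {x \<in> L. \<forall>h\<in>G. f h i = i \<longrightarrow> h x = x}"
    \<comment> \<open>The forbidden values, where \<open>r j\<close> carries \<open>i\<close> to
      \<open>j\<close>: those that would repeat at another point of the orbit, and those already
      taken on other orbits.\<close>
    define A where "A = (\<lambda>j. if j \<in> Orb then {x \<in> V. r j x = x} else {a j})"
    have comb_in: "to_ac u * x + to_ac t * y \<in> L" if "x \<in> L" "y \<in> L" for x y u t
      using that L_closed(1,4,5) by blast
    have comb: "g (to_ac u * x + to_ac t * y) = to_ac u * g x + to_ac t * g y"
      if "g \<in> G" "x \<in> L" "y \<in> L" for g x y u t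
      using that L_closed(1,5) by (simp add: G_apply(2-4)[OF that(1)])
    have V_closed: "affine_closed V"
      unfolding affine_closed_def
    proof (intro ballI allI)
      fix x y t assume "x \<in> V" "y \<in> V"
      then have xy: "x \<in> L" "y \<in> L" "\<And>h. h \<in> G \<Longrightarrow> f h i = i \<Longrightarrow> h x = x \<and> h y = y"
        unfolding V_def by auto
      have "h (to_ac (1 - t) * x + to_ac t * y) = to_ac (1 - t) * x + to_ac t * y"
        if "h \<in> G" "f h i = i" for h
        using comb[OF that(1) xy(1,2), of "1 - t" t] xy(3)[OF that] by (simp del: to_ac_diff)
      then show "to_ac (1 - t) * x + to_ac t * y \<in> V"
        unfolding V_def using comb_in[OF xy(1,2)] by blast
    qed
    have "\<exists>x\<in>V. \<forall>j\<in>I - {i}. x \<notin> A j"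
    proof (rule avoid_affine_closed[OF _ V_closed])
      show "finite (I - {i})" using psubset.hyps by simp
      have V01: "0 \<in> V" "1 \<in> V" unfolding V_def using L_closed G_0_1 by auto
      then show "V \<noteq> {}" by blast
      have "card I \<le> 5" using card_mono[OF _ psubset.prems(1)] by simp
      then have "card (I - {i}) < 5" using i psubset.hyps by (simp add: card_Diff_singleton_if)
      then show "infinite (UNIV :: 'k set) \<or> card (I - {i}) < card (UNIV :: 'k set)" using large by linarith
      fix j assume j: "j \<in> I - {i}"
      show "affine_closed (A j) \<and> \<not> V \<subseteq> A j"
      proof (cases "j \<in> Orb")
        case True
        have "affine_closed {x \<in> V. r j x = x}"
          unfolding affine_closed_def
        proof (intro ballI allI)
          fix x y t assume "x \<in> {x \<in> V. r j x = x}" "y \<in> {x \<in> V. r j x = x}"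
          then have xy: "x \<in> V" "y \<in> V" "x \<in> L" "y \<in> L" "r j x = x" "r j y = y"
            unfolding V_def by auto
          have "to_ac (1 - t) * x + to_ac t * y \<in> V"
            using V_closed xy(1,2) unfolding affine_closed_def by blast
          then show "to_ac (1 - t) * x + to_ac t * y \<in> {x \<in> V. r j x = x}"
            using comb[OF r(1)[OF True] xy(3,4), of "1 - t" t] xy(5,6)
            by (simp del: to_ac_diff)
        qed
        moreover have "\<exists>x\<in>V. r j x \<noteq> x"
          using stabilizer_fixed_point_moved[OF r(1)[OF True], of i] r(2)[OF True] j unfolding V_def by auto
        ultimately show ?thesis using True unfolding A_def by auto
      next
        case False
        have "affine_closed {a j}" unfolding affine_closed_def by (simp add: algebra_simps)
        moreover have "\<not> V \<subseteq> {a j}"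
        proof
          assume "V \<subseteq> {a j}"
          then have "0 = a j" "1 = a j" using V01 by blast+
          then show False using zero_neq_one by metis
        qed
        ultimately show ?thesis using False by (simp add: A_def)
      qed
    qed
    then obtain x where x: "x \<in> V" "\<And>j. j \<in> I - {i} \<Longrightarrow> x \<notin> A j" by blast
    have xL: "x \<in> L" and x_fix: "\<And>h. h \<in> G \<Longrightarrow> f h i = i \<Longrightarrow> h x = x" using x(1) by (auto simp: V_def)
    define b where "b = (\<lambda>j. if j \<in> Orb then r j x else a j)"
    \<comment> \<open>Independence of the chosen representative: \<open>g\<close> and
      \<open>r (f g i)\<close> differ by an element that fixes \<open>i\<close> and therefore
      \<open>x\<close>.\<close>
    have key: "g x = b (f g i)" if g: "g \<in> G" for g
    proof -
      have gO: "f g i \<in> Orb" using g by (auto simp: Orb_def)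
      obtain h where h: "h \<in> G" "\<And>y. y \<in> L \<Longrightarrow> r (f g i) (h y) = y" "\<And>k. f h (f (r (f g i)) k) = k"
        using G_inverse[OF r(1)[OF gO]] by metis
      have "f (compose L h g) i = f h (f (r (f g i)) i)" using f_compose[OF h(1) g] r(2)[OF gO] by simp
      then have "h (g x) = x" using x_fix[OF G_compose[OF h(1) g]] h(3) xL by (simp add: compose_eq)
      then have "g x = r (f g i) x" using h(2)[OF G_apply(1)[OF g xL]] by simp
      then show ?thesis using gO by (simp add: b_def)
    qed
    have bL: "b j \<in> L" if "j \<in> I" for j
      using that a(1) G_apply(1)[OF r(1) xL] by (auto simp: b_def I'_def)
    have equi: "g (b j) = b (f g j)" if g: "g \<in> G" and j: "j \<in> I" for g j
    proof (cases "j \<in> Orb")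
      case True
      have "g (b j) = compose L g (r j) x" using True xL by (simp add: b_def compose_eq)
      also have "\<dots> = b (f g j)"
        using key[OF G_compose[OF g r(1)[OF True]]] f_compose[OF g r(1)[OF True]] r(2)[OF True] by simp
      finally show ?thesis .
    next
      case False
      then have j': "j \<in> I'" using j by (simp add: I'_def)
      have "f g j \<notin> Orb" using I'_inv[OF g j'] by (simp add: I'_def)
      then show ?thesis using a(3)[OF g j'] False by (simp add: b_def)
    qed
    have orbit_distinct: "k = i" if k: "k \<in> I" "b k = x" for k
    proof (rule ccontr)
      assume "k \<noteq> i"
      then have "x \<notin> A k" using x(2) k(1) by blast
      then show False using k(2) x(1) by (auto simp: A_def b_def split: if_splits)
    qed
    \<comment> \<open>The inverse of \<open>r k\<close> moves the coincidence to one with the value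
      \<open>x\<close>.\<close>
    have inj_aux: "k = l" if kl: "k \<in> Orb" "l \<in> I" "b k = b l" for k l
    proof -
      have rk: "r k \<in> G" using r(1) kl(1) by blast
      obtain h where h: "h \<in> G" "\<And>y. y \<in> L \<Longrightarrow> h (r k y) = y" "\<And>m. f (r k) (f h m) = m"
        using G_inverse[OF rk] by metis
      have "b (f h l) = h (b k)" using equi[OF h(1) kl(2)] kl(3) by simp
      also have "\<dots> = x" using kl(1) h(2)[OF xL] by (simp add: b_def)
      finally have "f h l = i" using orbit_distinct psubset.prems(2)[OF h(1) kl(2)] by blast
      then show ?thesis using h(3)[of l] r(2)[OF kl(1)] by simp
    qed
    have "inj_on b I"
    proof (rule inj_onI)
      fix k l assume kl: "k \<in> I" "l \<in> I" "b k = b l"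
      show "k = l"
      proof (cases "k \<in> Orb \<or> l \<in> Orb")
        case True
        then show ?thesis using inj_aux kl by metis
      next
        case False
        then show ?thesis using kl inj_onD[OF a(2)] by (simp add: b_def I'_def)
      qed
    qed
    then show ?thesis using bL equi by blast
  qed simp
qed

section \<open>Descent of polynomials to the ground field and the choice of the quintic\<close>

abbreviation root_product :: "('b \<Rightarrow> 'a::comm_ring_1) \<Rightarrow> 'b set \<Rightarrow> 'a poly" where
  "root_product u S \<equiv> \<Prod>i\<in>S. [:- u i, 1:]"

text \<open>Membership in \<open>L\<close> and the action are proved together, because
  \<open>g\<close> respects sums and products only inside \<open>L\<close>.\<close>

lemma coeff_root_product:
  assumes g: "g \<in> G" and "\<And>i. i \<in> S \<Longrightarrow> u i \<in> L"
  shows "coeff (root_product u S) n \<in> L \<and>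
    g (coeff (root_product u S) n) = coeff (\<Prod>i\<in>S. [:- g (u i), 1:]) n"
  using assms(2)
proof (induction S arbitrary: n rule: infinite_finite_induct)
  case (insert i S)
  have step: "coeff ([:- v, 1:] * p) n = - v * coeff p n
      + (case n of 0 \<Rightarrow> 0 | Suc m \<Rightarrow> coeff p m)" for v and p :: "'k alg_closure poly" and n
    by (simp add: coeff_pCons split: nat.split)
  show ?case
    unfolding prod.insert[OF insert.hyps] step
    using insert.IH insert.prems minus_closed G_minus[OF g] diff_closed G_diff[OF g] G_apply(2,3)[OF g] L_closed(2,4,5) G_0_1(1)[OF g]
    by (auto split: nat.split)
qed (simp_all add: coeff_pCons G_0_1[OF g] L_closed split: nat.split)

text \<open>Permuted roots give invariant coefficients. It is applied to an orbit in
  \<open>L\<close>, for normality, and to the five chosen values, for the seed.\<close>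

lemma invariant_product_over_ground:
  assumes "finite S" "\<And>i. i \<in> S \<Longrightarrow> u i \<in> L"
    and "\<And>g. g \<in> G \<Longrightarrow> \<exists>p. bij_betw p S S \<and> (\<forall>i\<in>S. g (u i) = u (p i))"
  shows "coeff (root_product u S) n \<in> range to_ac"
proof (rule fixed_field)
  show "coeff (root_product u S) n \<in> L"
    by (rule coeff_root_product[OF G_id(1) assms(2), THEN conjunct1])
  fix g assume g: "g \<in> G"
  obtain p where p: "bij_betw p S S" "\<And>i. i \<in> S \<Longrightarrow> g (u i) = u (p i)" using assms(3)[OF g] by blast
  have "(\<Prod>i\<in>S. [:- g (u i), 1:]) = (\<Prod>i\<in>S. [:- u (p i), 1:])" by (intro prod.cong) (simp_all add: p(2))
  also have "\<dots> = root_product u S" by (rule prod.reindex_bij_betw[OF p(1)])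
  finally have eq: "(\<Prod>i\<in>S. [:- g (u i), 1:]) = root_product u S" .
  have "g (coeff (root_product u S) n) = coeff (\<Prod>i\<in>S. [:- g (u i), 1:]) n"
    by (rule coeff_root_product[OF g assms(2), THEN conjunct2])
  then show "g (coeff (root_product u S) n) = coeff (root_product u S) n"
    by (simp only: eq)
qed

text \<open>Normality of \<open>L\<close>: an element of \<open>L\<close> is a root of a polynomial
  over k whose roots form its orbit under \<open>G\<close>, so \<sigma> maps this finite orbit into
  itself. Surjectivity follows inside each orbit.\<close>

lemma restrict_galois:
  assumes \<sigma>: "\<sigma> \<in> Gal"
  shows "restrict \<sigma> L \<in> G"
proof -
  interpret coeff_hom \<sigma> by (rule absolute_galois_group_hom[OF \<sigma>])
  have inj: "inj \<sigma>" using absolute_galois_groupD(1)[OF \<sigma>] by (simp add: bij_def)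
  have orbit: "\<exists>B. finite B \<and> x \<in> B \<and> B \<subseteq> L \<and> \<sigma> ` B \<subseteq> B" if x: "x \<in> L" for x
  proof -
    define B where "B = (\<lambda>g. g x) ` G"
    have B: "finite B" "B \<subseteq> L" using finite_G G_apply(1) x by (auto simp: B_def)
    have "x \<in> B" unfolding B_def using G_id(1) x by (intro image_eqI[of _ _ "\<lambda>x\<in>L. x"]) auto
    let ?p = "\<Prod>b\<in>B. [:- b, 1:]"
    have "coeff ?p n \<in> range to_ac" for n
    proof (rule invariant_product_over_ground)
      fix g assume g: "g \<in> G"
      have "g ` B \<subseteq> B"
      proof
        fix y assume "y \<in> g ` B"
        then obtain h where h: "h \<in> G" "y = g (h x)" by (auto simp: B_def)
        then have "y = compose L g h x" using x by (simp add: compose_eq)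
        then show "y \<in> B" unfolding B_def using G_compose[OF g h(1)] by blast
      qed
      moreover have "inj_on g B" using G_apply(5)[OF g] B(2) by (rule inj_on_subset)
      ultimately have "bij_betw g B B" using B(1) by (simp add: bij_betw_def endo_inj_surj)
      then show "\<exists>p. bij_betw p B B \<and> (\<forall>i\<in>B. g i = p i)" by blast
    qed (use B in auto)
    then have fix_coeff: "\<sigma> (coeff ?p n) = coeff ?p n" for n
      using absolute_galois_groupD(4)[OF \<sigma>] by (metis rangeE)
    have ev: "poly ?p (\<sigma> y) = \<sigma> (poly ?p y)" for y
      by (simp add: poly_altdef hom_sum hom_mult hom_power fix_coeff)
    have root: "poly ?p y = 0 \<longleftrightarrow> y \<in> B" for y using B(1) by (auto simp: poly_prod)
    have "\<sigma> y \<in> B" if "y \<in> B" for y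
    proof -
      have "poly ?p y = 0" using root that by blast
      then have "poly ?p (\<sigma> y) = 0" unfolding ev by simp
      then show ?thesis using root by blast
    qed
    then have "\<sigma> ` B \<subseteq> B" by blast
    then show ?thesis using B \<open>x \<in> B\<close> by blast
  qed
  have "\<sigma> ` L = L"
  proof
    show "\<sigma> ` L \<subseteq> L" using orbit by blast
    show "L \<subseteq> \<sigma> ` L"
    proof
      fix x assume "x \<in> L"
      then obtain B where B: "finite B" "x \<in> B" "B \<subseteq> L" "\<sigma> ` B \<subseteq> B" using orbit by blast
      then have "\<sigma> ` B = B" using inj inj_on_subset by (intro endo_inj_surj) blast+
      then show "x \<in> \<sigma> ` L" using B by blast
    qed
  qed
  then have "bij_betw (restrict \<sigma> L) L L"
    using inj by (auto simp: bij_betw_def inj_on_def)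
  then show ?thesis
    unfolding galois_group_simps Bij_def using L_closed absolute_galois_groupD[OF \<sigma>] by auto
qed

lemma map_poly_to_ac_mult: "map_poly to_ac (p * q) = map_poly to_ac p * map_poly to_ac (q :: 'k poly)"
  by (rule poly_eqI) (simp add: coeff_map_poly coeff_mult to_ac_sum)

lemma seed_realization:
  assumes large: "infinite (UNIV :: 'k set) \<or> 5 \<le> card (UNIV :: 'k set)"
  obtains Q :: "'k poly" and P where "is_seed Q" "bij_betw P {1..5} (roots_in_closure Q)"
    "\<And>g i. g \<in> G \<Longrightarrow> i \<in> {1..5} \<Longrightarrow> g (P i) = P (f g i)" "\<And>i. i \<in> {1..5} \<Longrightarrow> P i \<in> L"
proof -
  have inv: "f g i \<in> {1..5}" if "g \<in> G" "i \<in> {1..5}" for g i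
    using permutes_in_image[OF f_permutes[OF that(1)]] that(2) by blast
  obtain P where P: "\<And>i. i \<in> {1..5} \<Longrightarrow> P i \<in> L" "inj_on P {1..5}"
    "\<And>g i. g \<in> G \<Longrightarrow> i \<in> {1..5} \<Longrightarrow> g (P i) = P (f g i)"
    using equivariant_injection[OF large order.refl] inv by metis
  define p where "p = (\<Prod>i\<in>{1..5::nat}. [:- P i, 1:])"
  define Q where "Q = map_poly of_ac p"
  have "coeff p n \<in> range to_ac" for n
    unfolding p_def
  proof (rule invariant_product_over_ground)
    fix g assume g: "g \<in> G"
    show "\<exists>\<pi>. bij_betw \<pi> {1..5} {1..5} \<and> (\<forall>i\<in>{1..5}. g (P i) = P (\<pi> i))"
      using permutes_imp_bij[OF f_permutes[OF g]] P(3)[OF g] by blast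
  qed (use P in auto)
  then have Qp: "map_poly to_ac Q = p"
    by (intro poly_eqI) (simp add: Q_def coeff_map_poly to_ac_of_ac)
  have "degree p = 5"
    unfolding p_def by (subst degree_prod_eq_sum_degree) auto
  then have degQ: "degree Q = 5"
    using degree_map_poly[of to_ac Q] Qp by simp
  have "Polynomial.lead_coeff p = 1" unfolding p_def by (simp add: lead_coeff_prod)
  then have "to_ac (Polynomial.lead_coeff Q) = 1"
    using Qp degQ \<open>degree p = 5\<close> by (metis coeff_map_poly to_ac_0)
  then have leadQ: "Polynomial.lead_coeff Q = 1" by (metis to_ac_1 to_ac_eq_iff)
  have root: "poly p x = 0 \<longleftrightarrow> x \<in> P ` {1..5}" for x
    unfolding p_def by (auto simp: poly_prod)
  \<comment> \<open>A nonconstant \<open>r\<close> has a root in the algebraic closure; if its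
    square divided Q, this would be a double root of \<open>p\<close>, whose five roots are
    distinct.\<close>
  have "squarefree Q"
    unfolding squarefree_def
  proof (intro allI impI)
    fix r :: "'k poly" assume "r ^ 2 dvd Q"
    then obtain q where q: "Q = r * r * q" unfolding power2_eq_square by blast
    have "r \<noteq> 0" using q degQ by auto
    have "degree r = 0"
    proof (rule ccontr)
      assume "degree r \<noteq> 0"
      then have "degree (map_poly to_ac r) > 0"
        by (subst degree_map_poly) auto
      then obtain c where "poly (map_poly to_ac r) c = 0" using alg_closed_imp_poly_has_root by blast
      then obtain r' where r': "map_poly to_ac r = [:- c, 1:] * r'" by (metis dvdE poly_eq_0_iff_dvd)
      have p2: "p = [:- c, 1:] * ([:- c, 1:] * (r' * r' * map_poly to_ac q))"
        unfolding Qp[symmetric] q map_poly_to_ac_mult r' by (simp only: mult_ac)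
      then have "poly p c = 0" by simp
      then obtain i where i: "i \<in> {1..5}" "c = P i" using root by blast
      have "p = [:- c, 1:] * (\<Prod>j\<in>{1..5} - {i}. [:- P j, 1:])"
        unfolding p_def i(2) by (rule prod.remove) (use i in auto)
      with p2 have "(\<Prod>j\<in>{1..5} - {i}. [:- P j, 1:]) = [:- c, 1:] * (r' * r' * map_poly to_ac q)"
        by (metis mult_left_cancel pCons_eq_0_iff zero_neq_one)
      then have "poly (\<Prod>j\<in>{1..5} - {i}. [:- P j, 1:]) c = 0" by simp
      then have "\<exists>j\<in>{1..5} - {i}. P j = P i" unfolding i(2) by (auto simp: poly_prod)
      then show False using inj_onD[OF P(2)] i(1) by blast
    qed
    then show "r dvd 1" using \<open>r \<noteq> 0\<close> by (simp add: is_unit_iff_degree)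
  qed
  then have "is_seed Q" using degQ leadQ by (simp add: is_seed_def)
  moreover have "roots_in_closure Q = P ` {1..5}"
    unfolding roots_in_closure_def Qp using root by blast
  then have "bij_betw P {1..5} (roots_in_closure Q)" using P(2) by (simp add: bij_betw_def)
  ultimately show ?thesis using that P by blast
qed

text \<open>The roots \<open>P i\<close> lie in \<open>L\<close>, where \<sigma> agrees with its
  restriction, so the permutation of the roots is the prescribed one.\<close>

lemma seed_surface_realization:
  assumes "infinite (UNIV :: 'k set) \<or> 5 \<le> card (UNIV :: 'k set)"
  shows "\<exists>(Q :: 'k poly) F. is_seed Q \<and> is_seed_surface Q F \<and>
    corresponding_homs F = S5_conj_class (\<lambda>\<sigma> \<in> Gal. f (restrict \<sigma> L))"
proof -
  obtain Q :: "'k poly" and P where Q: "is_seed Q" "bij_betw P {1..5} (roots_in_closure Q)"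
    and equi: "\<And>g i. g \<in> G \<Longrightarrow> i \<in> {1..5} \<Longrightarrow> g (P i) = P (f g i)" "\<And>i. i \<in> {1..5} \<Longrightarrow> P i \<in> L"
    using seed_realization[OF assms] by blast
  interpret marked_seed Q P using Q by unfold_locales
  have "root_representation P = (\<lambda>\<sigma> \<in> Gal. f (restrict \<sigma> L))"
  proof (rule extensionalityI[of _ Gal])
    show "root_representation P \<in> extensional (Gal)"
      by (simp add: root_representation_def)
    fix \<sigma> :: "'k alg_closure \<Rightarrow> 'k alg_closure" assume \<sigma>: "\<sigma> \<in> Gal"
    have "root_representation P \<sigma> = f (restrict \<sigma> L)"
    proof (rule root_representation_eqI[OF \<sigma> f_permutes[OF restrict_galois[OF \<sigma>]]])
      fix i :: nat assume i: "i \<in> {1..5}"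
      show "P (f (restrict \<sigma> L) i) = \<sigma> (P i)"
        using equi(1)[OF restrict_galois[OF \<sigma>] i] equi(2)[OF i] by simp
    qed
    then show "root_representation P \<sigma> = (\<lambda>\<sigma> \<in> Gal. f (restrict \<sigma> L)) \<sigma>"
      using \<sigma> by simp
  qed simp
  moreover have surf: "is_seed_surface Q (rational_map_image (standard_basis QK))"
    unfolding is_seed_surface_def using standard_seed_basis by blast
  ultimately show ?thesis using Q(1) corresponding_homs_seed_surface[OF surf] by metis
qed

end

theorem lemma15:
  assumes "perfect_field TYPE('k::field)"
  shows "(\<forall>(Q :: 'k poly) P F.
            is_seed Q \<and> bij_betw P {1..5} (roots_in_closure Q) \<and> is_seed_surface Q F \<longrightarrow>
            corresponding_homs F = S5_conj_class (root_representation P))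
       \<and> (infinite (UNIV :: 'k set) \<or> 5 \<le> card (UNIV :: 'k set) \<longrightarrow>
            (\<forall>(L :: 'k alg_closure set) f.
               galois_extension L \<and> f \<in> hom (galois_group L) (sym_group 5) \<and>
               inj_on f (carrier (galois_group L)) \<longrightarrow>
               (\<exists>(Q :: 'k poly) F. is_seed Q \<and> is_seed_surface Q F \<and>
                  corresponding_homs F =
                    S5_conj_class (\<lambda>\<sigma> \<in> carrier absolute_galois_group. f (restrict \<sigma> L)))))"
proof (intro conjI allI impI)
  fix Q :: "'k poly" and P :: "nat \<Rightarrow> 'k alg_closure" and F
  assume "is_seed Q \<and> bij_betw P {1..5} (roots_in_closure Q) \<and> is_seed_surface Q F"
  then show "corresponding_homs F = S5_conj_class (root_representation P)"
    using marked_seed.corresponding_homs_seed_surface marked_seed.intro by blast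
next
  fix L :: "'k alg_closure set" and f
  assume "infinite (UNIV :: 'k set) \<or> 5 \<le> card (UNIV :: 'k set)"
    and "galois_extension L \<and> f \<in> hom (galois_group L) (sym_group 5) \<and> inj_on f (carrier (galois_group L))"
  then show "\<exists>(Q :: 'k poly) F. is_seed Q \<and> is_seed_surface Q F \<and> corresponding_homs F =
      S5_conj_class (\<lambda>\<sigma> \<in> carrier absolute_galois_group. f (restrict \<sigma> L))"
    using galois_representation.seed_surface_realization galois_representation.intro by blast
qed

end
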